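(* Let $\boldsymbol K=(K,\oplus,\otimes)$ be the Bag-Set Maximization 2-monoid, let $Q$ be a fixed hierarchical self-join-free Boolean conjunctive query, let $(\mathcal D,\mathcal D^{\mathsf r},\theta)$ be an input instance of Bag-Set Maximization for $Q$, and let $\psi(\mathcal D,\mathcal D^{\mathsf r})$ be the associated $\boldsymbol K$-annotated database instance. Then, on inputs $Q$ and $\psi(\mathcal D,\mathcal D^{\mathsf r})$, the Hierarchical Elimination Algorithm runs in time $O\big((|\mathcal D|+|\mathcal D^{\mathsf r}|)\cdot|\mathcal D^{\mathsf r}|^2\big)$ and space $O\big((|\mathcal D|+|\mathcal D^{\mathsf r}|)\cdot|\mathcal D^{\mathsf r}|\big)$, and outputs a vector $q\in K$ such that for every $i\in\mathbb N$, the entry $q(i)$ is the maximum multiplicity of $Q$ that can be achieved within a repair cost at most $i$, i.e. $$q(i)=\max\{\,Q(\mathcal D') : \mathcal D\subseteq\mathcal D'\subseteq\mathcal D\cup\mathcal D^{\mathsf r},\ |\mathcal D'\setminus\mathcal D|\le i\,\}.$$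
   Context: **Queries and databases.** An atom is $R(\boldsymbol X)$ with $R$ a relation symbol and $\boldsymbol X$ a finite set of variables. A self-join-free Boolean conjunctive query (SJF-BCQ) is $Q() \text{ :- } \bigwedge_{R(\boldsymbol X)\in \mathsf{at}(Q)} R(\boldsymbol X)$, with $\mathsf{at}(Q)$ a finite nonempty set of atoms with pairwise distinct relation symbols; $\mathsf{vars}(Q)$ is its set of variables and $\mathsf{at}(Y)$ is the set of atoms of $Q$ containing the variable $Y$. $Q$ is hierarchical if for all $X,Y\in\mathsf{vars}(Q)$: $\mathsf{at}(X)\subseteq\mathsf{at}(Y)$, or $\mathsf{at}(Y)\subseteq\mathsf{at}(X)$, or $\mathsf{at}(X)\cap\mathsf{at}(Y)=\emptyset$. $\mathsf{Dom}$ is a countably infinite domain; $\mathsf{Dom}^{\boldsymbol X}$ is the set of functions $\boldsymbol X\to\mathsf{Dom}$. A fact is $R(\boldsymbol x)$ with $R(\boldsymbol X)\in\mathsf{at}(Q)$, $\boldsymbol x\in\mathsf{Dom}^{\boldsymbol X}$. A database instance for $Q$ is a finite set of facts; $|\mathcal D|$ is its number of facts. Under bag-set semantics, $Q(\mathcal D)$ (the multiplicity of $Q$) is the number of $\boldsymbol w\in\mathsf{Dom}^{\mathsf{vars}(Q)}$ with $R(\boldsymbol w|_{\boldsymbol X})\in\mathcal D$ for all $R(\boldsymbol X)\in\mathsf{at}(Q)$. **Bag-Set Maximization** for $Q$: the input is $(\mathcal D,\mathcal D^{\mathsf r},\theta)$ with $\mathcal D,\mathcal D^{\mathsf r}$ database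 instances for $Q$ and $\theta\in\mathbb N$; the goal is the maximum of $Q(\mathcal D')$ over all $\mathcal D'$ with $\mathcal D\subseteq\mathcal D'\subseteq\mathcal D\cup\mathcal D^{\mathsf r}$ and repair cost $|\mathcal D'\setminus\mathcal D|\le\theta$. **2-monoids and annotations.** A 2-monoid $\boldsymbol K=(K,\oplus,\otimes)$ consists of two commutative monoids $(K,\oplus)$ with identity $\boldsymbol 0$ and $(K,\otimes)$ with identity $\boldsymbol 1$ such that $\boldsymbol 0\otimes\boldsymbol 0=\boldsymbol 0$. A $\boldsymbol K$-annotated relation $R(\boldsymbol X)$ assigns to each $\boldsymbol x\in\mathsf{Dom}^{\boldsymbol X}$ an annotation $R(\boldsymbol x)\in K$, all but finitely many equal to $\boldsymbol 0$; only the facts with annotation $\ne\boldsymbol 0$ are stored. A $\boldsymbol K$-annotated database instance for $Q$ consists of one such relation for each atom of $Q$. **Hierarchical Elimination Algorithm** (parameter: a 2-monoid $\boldsymbol K$; input: a hierarchical SJF-BCQ $Q$ and a $\boldsymbol K$-annotated database instance). While $Q$ is not of the form $Q()\text{ :- }R()$: (Rule 1) if some variable $Y$ occurs in only one atom $R(\boldsymbol X)$, let $\boldsymbol X'=\boldsymbol X\setminus\{Y\}$ and replace $R(\boldsymbol X)$ by a new atom $R'(\boldsymbol X')$ annotated by $R'(\boldsymbol x')=\bigoplus_{y\in\mathsf{Dom}}R(\boldsymbol x',y)$ for all $\boldsymbol x'\in\mathsf{Dom}^{\boldsymbol X'}$; (Rule 2) else if there are two distinct atoms $R_1(\boldsymbol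 X),R_2(\boldsymbol X)$ with the same variable set, replace both by a single new atom $R'(\boldsymbol X)$ annotated by $R'(\boldsymbol x)=R_1(\boldsymbol x)\otimes R_2(\boldsymbol x)$ for all $\boldsymbol x\in\mathsf{Dom}^{\boldsymbol X}$; else report that $Q$ is not hierarchical. At the end return the annotation $R()\in K$ of the empty tuple. **Bag-Set Maximization 2-monoid.** $K=\{\boldsymbol x\in\mathbb N^{\mathbb N}\mid \boldsymbol x(i)\le\boldsymbol x(j)\text{ for all }i<j\}$, and for $\boldsymbol x_1,\boldsymbol x_2\in K$, $i\in\mathbb N$, $$(\boldsymbol x_1\oplus\boldsymbol x_2)(i)=\max_{i_1+i_2=i}\big(\boldsymbol x_1(i_1)+\boldsymbol x_2(i_2)\big),\qquad(\boldsymbol x_1\otimes\boldsymbol x_2)(i)=\max_{i_1+i_2=i}\boldsymbol x_1(i_1)\cdot\boldsymbol x_2(i_2),$$ with $i_1,i_2$ ranging over $\mathbb N$; $\boldsymbol 0$ is the all-zeros vector and $\boldsymbol 1$ the all-ones vector. **Annotated input.** Let $\star\in K$ with $\star(0)=0$ and $\star(i)=1$ for $i\ge1$. In $\psi(\mathcal D,\mathcal D^{\mathsf r})$, a fact $R(\boldsymbol x)$ is annotated with $\boldsymbol 1$ if $R(\boldsymbol x)\in\mathcal D$, with $\star$ if $R(\boldsymbol x)\in\mathcal D^{\mathsf r}\setminus\mathcal D$, and with $\boldsymbol 0$ otherwise. **Complexity conventions.** Data complexity: $Q$ is fixed and constants may depend on $Q$. Arithmetic operations on natural numbers cost unit time and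 space. Vectors are stored by finitely many entries (indices up to $|\mathcal D^{\mathsf r}|$, after which they are constant). Inside $O(\cdot)$, sizes are read as at least $1$. *)

theory Defs
  imports
    "HOL-Algebra.Ring"
    "HOL-Library.AList"
    "HOL-Library.Countable"
    "HOL-Library.Infinite_Typeclass"
begin

section \<open>Queries and databases\<close>

text \<open>
  A query is represented by its set of atoms; the atom R(X) is the pair (R, X).
  A tuple over X, i.e. a function from X to Dom, is a partial map with domain X.
\<close>

type_synonym ('r, 'v) query = "('r \<times> 'v set) set"
type_synonym ('v, 'd) tuple = "'v \<rightharpoonup> 'd"
type_synonym ('r, 'v, 'd) fact = "'r \<times> ('v, 'd) tuple"

definition sjf_bcq :: "('r, 'v) query \<Rightarrow> bool" where
  "sjf_bcq Q \<longleftrightarrow> finite Q \<and> Q \<noteq> {} \<and> (\<forall>(R, X)\<in>Q. finite X) \<and> inj_on fst Q"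

definition vars :: "('r, 'v) query \<Rightarrow> 'v set" where
  "vars Q = (\<Union>(R, X)\<in>Q. X)"

definition atoms_with :: "('r, 'v) query \<Rightarrow> 'v \<Rightarrow> ('r, 'v) query" where
  "atoms_with Q Y = {(R, X)\<in>Q. Y \<in> X}"

definition hierarchical :: "('r, 'v) query \<Rightarrow> bool" where
  "hierarchical Q \<longleftrightarrow>
     (\<forall>X\<in>vars Q. \<forall>Y\<in>vars Q.
        atoms_with Q X \<subseteq> atoms_with Q Y \<or> atoms_with Q Y \<subseteq> atoms_with Q X \<or>
        atoms_with Q X \<inter> atoms_with Q Y = {})"

definition facts :: "('r, 'v) query \<Rightarrow> ('r, 'v, 'd) fact set" where
  "facts Q = {(R, x). (R, dom x) \<in> Q}"

definition database :: "('r, 'v) query \<Rightarrow> ('r, 'v, 'd) fact set \<Rightarrow> bool" where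
  "database Q D \<longleftrightarrow> finite D \<and> D \<subseteq> facts Q"

definition multiplicity :: "('r, 'v) query \<Rightarrow> ('r, 'v, 'd) fact set \<Rightarrow> nat" where
  "multiplicity Q D = card {w. dom w = vars Q \<and> (\<forall>(R, X)\<in>Q. (R, w |` X) \<in> D)}"

definition bsm_instance ::
    "('r, 'v) query \<Rightarrow> ('r, 'v, 'd) fact set \<times> ('r, 'v, 'd) fact set \<times> nat \<Rightarrow> bool" where
  "bsm_instance Q I \<longleftrightarrow> (case I of (D, Dr, \<theta>) \<Rightarrow> database Q D \<and> database Q Dr)"

definition bsm_optimum ::
    "('r, 'v) query \<Rightarrow> ('r, 'v, 'd) fact set \<times> ('r, 'v, 'd) fact set \<times> nat \<Rightarrow> nat" where
  "bsm_optimum Q I = (case I of (D, Dr, \<theta>) \<Rightarrow>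
     Max {multiplicity Q D' | D'. D \<subseteq> D' \<and> D' \<subseteq> D \<union> Dr \<and> card (D' - D) \<le> \<theta>})"

section \<open>2-monoids and the Hierarchical Elimination Algorithm\<close>

text \<open>The ring record of HOL-Algebra serves only as the signature of a 2-monoid.\<close>

definition two_monoid :: "('k, 'm) ring_scheme \<Rightarrow> bool" where
  "two_monoid K \<longleftrightarrow>
     comm_monoid (add_monoid K) \<and> comm_monoid K \<and>
     \<zero>\<^bsub>K\<^esub> \<otimes>\<^bsub>K\<^esub> \<zero>\<^bsub>K\<^esub> = \<zero>\<^bsub>K\<^esub>"

text \<open>
  The annotated relation of an atom (R, X) is the restriction of A R to tuples with domain X;
  the values of A elsewhere are irrelevant.
\<close>

type_synonym ('r, 'v, 'd, 'k) annotated_db = "'r \<Rightarrow> ('v, 'd) tuple \<Rightarrow> 'k"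

text \<open>
  The effect of the two rules on the query. The choice of the variable, of the two atoms and of
  the new relation symbol is left open; Rule 2 applies only if Rule 1 does not.
\<close>

definition elim_var ::
    "('r, 'v) query \<Rightarrow> 'r \<Rightarrow> 'v set \<Rightarrow> 'v \<Rightarrow> 'r \<Rightarrow> ('r, 'v) query \<Rightarrow> bool" where
  "elim_var Q R X Y R' Q' \<longleftrightarrow>
     atoms_with Q Y = {(R, X)} \<and> R' \<notin> fst ` Q \<and>
     Q' = insert (R', X - {Y}) (Q - {(R, X)})"

definition elim_atom ::
    "('r, 'v) query \<Rightarrow> 'r \<Rightarrow> 'r \<Rightarrow> 'v set \<Rightarrow> 'r \<Rightarrow> ('r, 'v) query \<Rightarrow> bool" where
  "elim_atom Q R1 R2 X R' Q' \<longleftrightarrow>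
     (\<nexists>Y a. atoms_with Q Y = {a}) \<and>
     (R1, X) \<in> Q \<and> (R2, X) \<in> Q \<and> R1 \<noteq> R2 \<and> R' \<notin> fst ` Q \<and>
     Q' = insert (R', X) (Q - {(R1, X), (R2, X)})"

definition no_rule_applies :: "('r, 'v) query \<Rightarrow> bool" where
  "no_rule_applies Q \<longleftrightarrow>
     (\<nexists>R X Y R' Q'. elim_var Q R X Y R' Q') \<and> (\<nexists>R1 R2 X R' Q'. elim_atom Q R1 R2 X R' Q')"

text \<open>
  The sum over the infinite domain in Rule 1 is taken over its support, because finsum over an
  infinite index set is a dummy value. Neither rule applies to a query of the form R().
\<close>

inductive hea_step ::
    "('k, 'm) ring_scheme \<Rightarrow>
     ('r, 'v) query \<times> ('r, 'v, 'd, 'k) annotated_db \<Rightarrow>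
     ('r, 'v) query \<times> ('r, 'v, 'd, 'k) annotated_db \<Rightarrow> bool"
  for K where
  rule1: "hea_step K (Q, A)
            (Q', A(R' := \<lambda>x'. finsum K (\<lambda>y. A R (x'(Y \<mapsto> y)))
                                       {y. A R (x'(Y \<mapsto> y)) \<noteq> \<zero>\<^bsub>K\<^esub>}))"
    if "elim_var Q R X Y R' Q'"
| rule2: "hea_step K (Q, A) (Q', A(R' := \<lambda>x. A R1 x \<otimes>\<^bsub>K\<^esub> A R2 x))"
    if "elim_atom Q R1 R2 X R' Q'"

text \<open>
  All runs terminate, none reports that the query is not hierarchical, and all return q.
\<close>

definition hea_outputs ::
    "('k, 'm) ring_scheme \<Rightarrow> ('r, 'v) query \<Rightarrow> ('r, 'v, 'd, 'k) annotated_db \<Rightarrow> 'k \<Rightarrow> bool" where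
  "hea_outputs K Q A q \<longleftrightarrow>
     (\<nexists>f. f 0 = (Q, A) \<and> (\<forall>n. hea_step K (f n) (f (Suc n)))) \<and>
     (\<forall>Q' A'. (hea_step K)\<^sup>*\<^sup>* (Q, A) (Q', A') \<and> no_rule_applies Q' \<longrightarrow>
        (\<exists>R. Q' = {(R, {})} \<and> A' R Map.empty = q))"

section \<open>The Bag-Set Maximization 2-monoid\<close>

definition bsm :: "(nat \<Rightarrow> nat) ring" where
  "bsm = \<lparr>carrier = {x. \<forall>i j. i < j \<longrightarrow> x i \<le> x j},
          mult = (\<lambda>x1 x2 i. Max {x1 i1 * x2 i2 | i1 i2. i1 + i2 = i}),
          one = (\<lambda>_. 1),
          zero = (\<lambda>_. 0),
          add = (\<lambda>x1 x2 i. Max {x1 i1 + x2 i2 | i1 i2. i1 + i2 = i})\<rparr>"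

lemma conv_le_iff:
  fixes f :: "nat \<Rightarrow> nat \<Rightarrow> nat"
  shows "Max {f i1 i2 | i1 i2. i1 + i2 = i} \<le> b \<longleftrightarrow> (\<forall>i1 i2. i1 + i2 = i \<longrightarrow> f i1 i2 \<le> b)"
    and "\<exists>i1 i2. i1 + i2 = i \<and> Max {f i1 i2 | i1 i2. i1 + i2 = i} = f i1 i2"
proof -
  have eq: "{f i1 i2 | i1 i2. i1 + i2 = i} = (\<lambda>i1. f i1 (i - i1)) ` {..i}"
    by (auto simp: image_iff) (metis atMost_iff diff_add_inverse le_add1, metis le_add_diff_inverse)
  have fin: "finite {f i1 i2 | i1 i2. i1 + i2 = i}" and ne: "{f i1 i2 | i1 i2. i1 + i2 = i} \<noteq> {}"
    unfolding eq by auto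
  show "Max {f i1 i2 | i1 i2. i1 + i2 = i} \<le> b \<longleftrightarrow> (\<forall>i1 i2. i1 + i2 = i \<longrightarrow> f i1 i2 \<le> b)"
    using fin ne by (subst Max_le_iff) auto
  show "\<exists>i1 i2. i1 + i2 = i \<and> Max {f i1 i2 | i1 i2. i1 + i2 = i} = f i1 i2"
    using Max_in[OF fin ne] by blast
qed

lemma conv_mono:
  fixes x y :: "nat \<Rightarrow> nat" and f :: "nat \<Rightarrow> nat \<Rightarrow> nat"
  assumes "\<forall>i j. i < j \<longrightarrow> x i \<le> x j" "i < j"
    and m: "\<And>a b c. a \<le> b \<Longrightarrow> f a c \<le> (f b c)"
  shows "Max {f (x i1) (y i2) | i1 i2. i1 + i2 = i} \<le> Max {f (x i1) (y i2) | i1 i2. i1 + i2 = j}"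
proof -
  have "f (x i1) (y i2) \<le> Max {f (x i1) (y i2) | i1 i2. i1 + i2 = j}" if "i1 + i2 = i" for i1 i2
  proof -
    have "f (x i1) (y i2) \<le> f (x (j - i2)) (y i2)"
      using assms that by (intro m) auto
    moreover have "(j - i2) + i2 = j" using that assms by auto
    ultimately show ?thesis
      using iffD1[OF conv_le_iff(1)[where f="\<lambda>i1 i2. f (x i1) (y i2)" and i=j], OF order.refl] 
      by (meson le_trans)
  qed
  thus ?thesis by (subst conv_le_iff(1)) blast
qed

lemma conv_comm:
  fixes f :: "nat \<Rightarrow> nat \<Rightarrow> nat" assumes "\<And>a b. f a b = f b a"
  shows "{f (x i1) (y i2) | i1 i2. i1 + i2 = i} = {f (y i1) (x i2) | i1 i2. i1 + i2 = (i::nat)}"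
proof -
  have "(\<exists>i1 i2. u = f (x i1) (y i2) \<and> i1 + i2 = i) \<longleftrightarrow>
        (\<exists>i1 i2. u = f (y i1) (x i2) \<and> i1 + i2 = i)" for u
    by (metis assms add.commute)
  thus ?thesis by simp
qed

lemma conv_assoc_gen:
  fixes f :: "nat \<Rightarrow> nat \<Rightarrow> nat" and x y z :: "nat \<Rightarrow> nat"
  assumes c: "\<And>a b. f a b = f b a" and as: "\<And>a b c. f (f a b) c = f a (f b c)"
    and m: "\<And>a b c. a \<le> b \<Longrightarrow> f a c \<le> f b c"
  shows "Max {f (Max {f (x i1) (y i2) | i1 i2. i1 + i2 = j}) (z k) | j k. j + k = i} \<le> b
     \<longleftrightarrow> (\<forall>i1 i2 k. i1 + i2 + k = i \<longrightarrow> f (f (x i1) (y i2)) (z k) \<le> b)" (is "?L \<longleftrightarrow> ?R")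
proof
  assume L: ?L
  show ?R
  proof (intro allI impI)
    fix i1 i2 k assume s: "i1 + i2 + k = i"
    have "f (x i1) (y i2) \<le> Max {f (x a) (y b) | a b. a + b = i1 + i2}"
      using iffD1[OF conv_le_iff(1)[where f="\<lambda>i1 i2. f (x i1) (y i2)" and i="i1+i2"], OF order.refl] by blast
    hence "f (f (x i1) (y i2)) (z k) \<le> f (Max {f (x a) (y b) | a b. a + b = i1 + i2}) (z k)" by (rule m)
    also have "\<dots> \<le> b" using L s 
       iffD1[OF conv_le_iff(1)[where f="\<lambda>j k. f (Max {f (x a) (y b) | a b. a + b = j}) (z k)"]] by blast
    finally show "f (f (x i1) (y i2)) (z k) \<le> b" .
  qed
next
  assume R: ?R
  have "f (Max {f (x i1) (y i2) | i1 i2. i1 + i2 = j}) (z k) \<le> b" if "j + k = i" for j k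
    using conv_le_iff(2)[where f="\<lambda>i1 i2. f (x i1) (y i2)" and i=j] R that by metis
  thus ?L using conv_le_iff(1)[where f="\<lambda>j k. f (Max {f (x i1) (y i2) | i1 i2. i1 + i2 = j}) (z k)"]
    by blast
qed

lemma conv_assoc:
  fixes f :: "nat \<Rightarrow> nat \<Rightarrow> nat" and x y z :: "nat \<Rightarrow> nat"
  assumes c: "\<And>a b. f a b = f b a" and as: "\<And>a b c. f (f a b) c = f a (f b c)"
    and m: "\<And>a b c. a \<le> b \<Longrightarrow> f a c \<le> f b c"
  shows "Max {f (Max {f (x i1) (y i2) | i1 i2. i1 + i2 = j}) (z k) | j k. j + k = i} =
     Max {f (x k) (Max {f (y i1) (z i2) | i1 i2. i1 + i2 = j}) | k j. k + j = (i::nat)}" (is "?l = ?r")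
proof -
  have r: "?r = Max {f (Max {f (y i1) (z i2) | i1 i2. i1 + i2 = j}) (x k) | j k. j + k = i}"
    by (rule arg_cong[where f=Max], rule conv_comm, rule c)
  have rot: "f (f u v) w = f (f v w) u" for u v w
    using as[of u v w] c[of u "f v w"] by simp
  have "?l \<le> b \<longleftrightarrow> ?r \<le> b" for b
  proof -
    have "(\<forall>i1 i2 k. i1 + i2 + k = i \<longrightarrow> f (f (x i1) (y i2)) (z k) \<le> b) \<longleftrightarrow>
          (\<forall>i1 i2 k. i1 + i2 + k = i \<longrightarrow> f (f (y i1) (z i2)) (x k) \<le> b)"
      (is "?A \<longleftrightarrow> ?B")
    proof (intro iffI allI impI)
      fix i1 i2 k assume A: ?A and i: "i1 + i2 + k = i"
      have "k + i1 + i2 = i" using i by simp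
      thus "f (f (y i1) (z i2)) (x k) \<le> b"
        using A rot[of "x k" "y i1" "z i2"] by metis
    next
      fix i1 i2 k assume B: ?B and i: "i1 + i2 + k = i"
      have "i2 + k + i1 = i" using i by simp
      thus "f (f (x i1) (y i2)) (z k) \<le> b"
        using B rot[of "x i1" "y i2" "z k"] by metis
    qed
    thus ?thesis
      using conv_assoc_gen[where f=f and x=x and y=y and z=z and i=i and b=b, OF assms]
        conv_assoc_gen[where f=f and x=y and y=z and z=x and i=i and b=b, OF assms] r
      by simp
  qed
  thus ?thesis by (meson order.antisym order.refl)
qed

lemma conv_unit:
  fixes f :: "nat \<Rightarrow> nat \<Rightarrow> nat" and x :: "nat \<Rightarrow> nat"
  assumes c: "\<And>a. f e a = a" and mo: "\<forall>i j. i < j \<longrightarrow> x i \<le> x j"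
  shows "Max {f e (x i2) | i1 i2. i1 + i2 = (i::nat)} = x i"
proof -
  have le: "x i2 \<le> x i" if "i1 + i2 = i" for i1 i2
    using mo that by (cases "i1 = 0") auto
  have "Max {x i2 | i1 i2. i1 + i2 = i} \<le> b \<longleftrightarrow> x i \<le> b" for b
    unfolding conv_le_iff(1)[where f="\<lambda>i1 i2. x i2"]
    using add_0[of i] le le_trans by blast
  hence "Max {x i2 | i1 i2. i1 + i2 = i} = x i"
    by (meson order.antisym order.refl)
  thus ?thesis unfolding c .
qed

lemma two_monoid_bsm: "two_monoid bsm"
proof -
  have 1: "comm_monoid (add_monoid bsm)"
    apply (rule comm_monoidI)
    subgoal by (simp add: bsm_def conv_mono)
    subgoal by (simp add: bsm_def)
    subgoal for x y z
      using conv_assoc[where f="(+)" and x=x and y=y and z=z, OF add.commute add.assoc add_le_mono1]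
      by (simp add: bsm_def fun_eq_iff)
    subgoal for x using conv_unit[where f="(+)" and e=0 and x=x] by (simp add: bsm_def fun_eq_iff)
    subgoal for x y using conv_comm[where f="(+)" and x=x and y=y, OF add.commute] by (simp add: bsm_def fun_eq_iff)
    done
  have 2: "comm_monoid bsm"
    apply (rule comm_monoidI)
    subgoal by (simp add: bsm_def conv_mono[where f="(*)"])
    subgoal by (simp add: bsm_def)
    subgoal for x y z
      using conv_assoc[where f="(*)" and x=x and y=y and z=z, OF mult.commute mult.assoc mult_le_mono1]
      by (simp add: bsm_def fun_eq_iff)
    subgoal for x using conv_unit[where f="(*)" and e=1 and x=x] by (simp add: bsm_def fun_eq_iff)
    subgoal for x y using conv_comm[where f="(*)" and x=x and y=y, OF mult.commute] by (simp add: bsm_def fun_eq_iff)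
    done
  have "Max {0 :: nat | i1 i2. i1 + i2 = (i :: nat)} = 0" for i
  proof -
    have "{0 :: nat | i1 i2. i1 + i2 = i} = {0}" by (auto intro: exI[of _ 0])
    thus ?thesis by simp
  qed
  hence 3: "\<zero>\<^bsub>bsm\<^esub> \<otimes>\<^bsub>bsm\<^esub> \<zero>\<^bsub>bsm\<^esub> = \<zero>\<^bsub>bsm\<^esub>"
    by (simp add: bsm_def fun_eq_iff)
  show ?thesis using 1 2 3 by (simp add: two_monoid_def)
qed

definition star :: "nat \<Rightarrow> nat" where
  "star i = (if i = 0 then 0 else 1)"

definition psi ::
    "('r, 'v, 'd) fact set \<Rightarrow> ('r, 'v, 'd) fact set \<Rightarrow> ('r, 'v, 'd, nat \<Rightarrow> nat) annotated_db" where
  "psi D Dr R x =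
     (if (R, x) \<in> D then \<one>\<^bsub>bsm\<^esub> else if (R, x) \<in> Dr - D then star else \<zero>\<^bsub>bsm\<^esub>)"

section \<open>Cost model\<close>

text \<open>
  A value of type cost is the result of a program together with its running time and the number
  of memory cells it allocates. Memory is never reclaimed, so the space of a run is the total
  number of cells ever allocated; this bounds the space of any execution that reuses memory.
  The programs below are composed with bind from the primitive operations only, all of which take
  constant time on a unit-cost random access machine for a bounded number of variables per atom.
\<close>

datatype 'a cost = Cost (result: 'a) (ticks: nat) (cells: nat)

definition ret :: "'a \<Rightarrow> 'a cost" where
  "ret a = Cost a 0 0"

definition bind :: "'a cost \<Rightarrow> ('a \<Rightarrow> 'b cost) \<Rightarrow> 'b cost"  (infixl "\<triangleright>" 54) where
  "m \<triangleright> f = (let n = f (result m)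
           in Cost (result n) (ticks m + ticks n) (cells m + cells n))"

text \<open>One arithmetic operation, comparison or Boolean operation.\<close>

definition arith :: "'a \<Rightarrow> 'a cost" where
  "arith a = Cost a 1 0"

definition read :: "'a list \<Rightarrow> nat \<Rightarrow> 'a cost" where
  "read v i = Cost (v ! i) 1 0"

text \<open>
  A bounded loop with accumulator. Each iteration costs one tick for the loop control, and the
  loop owns two cells, for the counter and the accumulator. The list is only iterated over: it is
  either a range of indices or a stored relation.
\<close>

primrec loop :: "('x \<Rightarrow> 'a \<Rightarrow> 'a cost) \<Rightarrow> 'x list \<Rightarrow> 'a \<Rightarrow> 'a cost" where
  "loop body [] a = Cost a 1 2"
| "loop body (x # xs) a = Cost () 1 0 \<triangleright> (\<lambda>_. body x a \<triangleright> loop body xs)"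

text \<open>
  A new array whose entries are computed by g: per entry one tick for the loop control, one for
  the write, and one cell.
\<close>

primrec fill :: "(nat \<Rightarrow> 'a cost) \<Rightarrow> nat list \<Rightarrow> 'a list cost" where
  "fill g [] = Cost [] 1 1"
| "fill g (i # is) =
     g i \<triangleright> (\<lambda>a. Cost () 2 1 \<triangleright> (\<lambda>_. fill g is \<triangleright> (\<lambda>as. ret (a # as))))"

text \<open>
  A stored relation is a dictionary from tuples to annotations, whose entries can also be
  enumerated. Accessing it costs time linear in the length of the key, as with direct addressing;
  storing an entry occupies one cell per component of the key and one for the reference to the
  annotation, even if an existing entry is overwritten.
\<close>

type_synonym ('v, 'd, 's) stored_relation = "(('v, 'd) tuple \<times> 's) list"

definition project :: "'v set \<Rightarrow> ('v, 'd) tuple \<Rightarrow> ('v, 'd) tuple cost" where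
  "project X x = Cost (x |` X) (card (dom x) + 1) (card X)"

definition lookup :: "('v, 'd, 's) stored_relation \<Rightarrow> ('v, 'd) tuple \<Rightarrow> 's option cost" where
  "lookup T x = Cost (map_of T x) (card (dom x) + 1) 0"

definition store ::
    "('v, 'd) tuple \<Rightarrow> 's \<Rightarrow> ('v, 'd, 's) stored_relation \<Rightarrow> ('v, 'd, 's) stored_relation cost" where
  "store x a T = Cost (AList.update x a T) (card (dom x) + 1) (card (dom x) + 1)"

section \<open>Implementation of the algorithm\<close>

text \<open>The implementation is parametric in an implementation of the operations of the 2-monoid.\<close>

record 's annotation_ops =
  add_op :: "'s \<Rightarrow> 's \<Rightarrow> 's cost"
  mult_op :: "'s \<Rightarrow> 's \<Rightarrow> 's cost"
  zero_op :: "'s cost"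
  is_zero_op :: "'s \<Rightarrow> bool cost"
  size_op :: "'s \<Rightarrow> nat"

text \<open>Vectors are arrays holding the entries with indices up to N, and constant from there on.\<close>

definition convolution :: "(nat \<Rightarrow> nat \<Rightarrow> nat) \<Rightarrow> nat \<Rightarrow> nat list \<Rightarrow> nat list \<Rightarrow> nat list cost" where
  "convolution f N v w =
     fill (\<lambda>i. loop (\<lambda>i1 m.
                read v i1 \<triangleright> (\<lambda>a. arith (i - i1) \<triangleright> (\<lambda>i2. read w i2 \<triangleright> (\<lambda>b.
                arith (f a b) \<triangleright> (\<lambda>c. arith (max m c)))))) [0..<Suc i] 0)
       [0..<Suc N]"

definition bsm_ops :: "nat \<Rightarrow> nat list annotation_ops" where
  "bsm_ops N =
     \<lparr>add_op = convolution (+) N,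
      mult_op = convolution (*) N,
      zero_op = fill (\<lambda>_. ret 0) [0..<Suc N],
      is_zero_op = (\<lambda>v. loop (\<lambda>i b. read v i \<triangleright> (\<lambda>a. arith (a = 0) \<triangleright> (\<lambda>c. arith (b \<and> c))))
                          [0..<Suc N] True),
      size_op = length\<rparr>"

definition vec_of :: "nat list \<Rightarrow> nat \<Rightarrow> nat" where
  "vec_of v i = v ! min i (length v - 1)"

definition drop_zeros ::
    "('s, 'm) annotation_ops_scheme \<Rightarrow> ('v, 'd, 's) stored_relation \<Rightarrow>
     ('v, 'd, 's) stored_relation cost" where
  "drop_zeros ops T =
     loop (\<lambda>(x, a) U. is_zero_op ops a \<triangleright> (\<lambda>z. if z then ret U else store x a U)) T []"

definition rule1_prog ::
    "('s, 'm) annotation_ops_scheme \<Rightarrow> 'v set \<Rightarrow> ('v, 'd, 's) stored_relation \<Rightarrow>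
     ('v, 'd, 's) stored_relation cost" where
  "rule1_prog ops X' T =
     loop (\<lambda>(x, a) U.
         project X' x \<triangleright> (\<lambda>x'. lookup U x' \<triangleright> (\<lambda>e.
           case e of
             None \<Rightarrow> store x' a U
           | Some b \<Rightarrow> add_op ops b a \<triangleright> (\<lambda>c. store x' c U)))) T []
     \<triangleright> drop_zeros ops"

text \<open>
  In a general 2-monoid zero need not be absorbing, so Rule 2 visits all facts occurring in at
  least one of the two relations.
\<close>

definition fetch ::
    "('s, 'm) annotation_ops_scheme \<Rightarrow> ('v, 'd, 's) stored_relation \<Rightarrow> ('v, 'd) tuple \<Rightarrow> 's cost" where
  "fetch ops T x = lookup T x \<triangleright> (\<lambda>e. case e of None \<Rightarrow> zero_op ops | Some a \<Rightarrow> ret a)"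

definition rule2_prog ::
    "('s, 'm) annotation_ops_scheme \<Rightarrow> ('v, 'd, 's) stored_relation \<Rightarrow>
     ('v, 'd, 's) stored_relation \<Rightarrow> ('v, 'd, 's) stored_relation cost" where
  "rule2_prog ops T1 T2 =
     loop (\<lambda>(x, a) U.
         fetch ops T2 x \<triangleright> (\<lambda>b. mult_op ops a b \<triangleright> (\<lambda>c. store x c U))) T1 []
     \<triangleright> loop (\<lambda>(x, b) U.
         lookup T1 x \<triangleright> (\<lambda>e.
           case e of
             None \<Rightarrow> zero_op ops \<triangleright> (\<lambda>a. mult_op ops a b \<triangleright> (\<lambda>c. store x c U))
           | Some a \<Rightarrow> ret U)) T2
     \<triangleright> drop_zeros ops"

type_synonym ('r, 'v, 'd, 's) stored_db = "'r \<Rightarrow> ('v, 'd, 's) stored_relation"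

text \<open>
  The time for testing the loop condition and selecting a rule by scanning the whole query once
  for every variable (to count its occurrences) and once for every atom (to compare variable sets).
\<close>

definition scan_cost :: "('r, 'v) query \<Rightarrow> nat" where
  "scan_cost Q = (card (vars Q) + card Q + 1) * (\<Sum>(R, X)\<in>Q. card X + 1)"

text \<open>
  The space of the input. The constant accounts for the intermediate scalars of the straight-line
  code in the loop bodies, which use the same registers throughout the run.
\<close>

definition input_cells ::
    "('s, 'm) annotation_ops_scheme \<Rightarrow> ('r, 'v) query \<Rightarrow> ('r, 'v, 'd, 's) stored_db \<Rightarrow> nat" where
  "input_cells ops Q S =
     16 + (\<Sum>(R, X)\<in>Q. card X + 1) +
     (\<Sum>(R, X)\<in>Q. \<Sum>(x, a)\<leftarrow>S R. card X + 1 + size_op ops a)"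

text \<open>
  A partial execution of the implementation, with the time spent and the space used so far; the
  loop condition of the reached state has already been tested.
\<close>

inductive hea_exec ::
    "('s, 'm) annotation_ops_scheme \<Rightarrow> ('r, 'v) query \<Rightarrow> ('r, 'v, 'd, 's) stored_db \<Rightarrow>
     ('r, 'v) query \<Rightarrow> ('r, 'v, 'd, 's) stored_db \<Rightarrow> nat \<Rightarrow> nat \<Rightarrow> bool"
  for ops Q0 S0 where
  start: "hea_exec ops Q0 S0 Q0 S0 (scan_cost Q0) (input_cells ops Q0 S0)"
| exec1: "hea_exec ops Q0 S0 Q' (S(R' := result m))
            (t + ticks m + scan_cost Q') (s + cells m + card (X - {Y}) + 1)"
    if "hea_exec ops Q0 S0 Q S t s" and "elim_var Q R X Y R' Q'"
       and "m = rule1_prog ops (X - {Y}) (S R)"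
| exec2: "hea_exec ops Q0 S0 Q' (S(R' := result m))
            (t + ticks m + scan_cost Q') (s + cells m + card X + 1)"
    if "hea_exec ops Q0 S0 Q S t s" and "elim_atom Q R1 R2 X R' Q'"
       and "m = rule2_prog ops (S R1) (S R2)"

text \<open>Only the facts with nonzero annotation are stored, once each and in any order.\<close>

definition stores ::
    "nat \<Rightarrow> ('r, 'v) query \<Rightarrow> ('r, 'v, 'd, nat list) stored_db \<Rightarrow>
     ('r, 'v, 'd, nat \<Rightarrow> nat) annotated_db \<Rightarrow> bool" where
  "stores N Q S A \<longleftrightarrow>
     (\<forall>(R, X)\<in>Q.
        distinct (map fst (S R)) \<and>
        fst ` set (S R) = {x. dom x = X \<and> A R x \<noteq> \<zero>\<^bsub>bsm\<^esub>} \<and>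
        (\<forall>(x, v)\<in>set (S R). length v = Suc N \<and> vec_of v = A R x))"

lemma stores_psi_exists:
  fixes Q :: "('r, 'v) query" and D Dr :: "('r, 'v, 'd) fact set"
  assumes "sjf_bcq Q" "bsm_instance Q (D, Dr, \<theta>)"
  shows "\<exists>S. stores (card Dr) Q S (psi D Dr)"
proof -
  let ?N = "card Dr"
  have fin: "finite D" "finite Dr" using assms by (auto simp: bsm_instance_def database_def)
  define vec where "vec R x = map (psi D Dr R x) [0..<Suc ?N]" for R x
  have vec: "length (vec R x) = Suc ?N" "vec_of (vec R x) = psi D Dr R x" for R x
  proof -
    have "?N = 0 \<Longrightarrow> Dr = {}" using fin by simp
    thus "vec_of (vec R x) = psi D Dr R x"
      unfolding vec_def vec_of_def fun_eq_iff
      by (auto simp: psi_def star_def bsm_def min_def nth_append simp del: upt_Suc)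
  qed (simp add: vec_def)
  have "\<exists>xs. set xs = {x. dom x = X \<and> psi D Dr R x \<noteq> \<zero>\<^bsub>bsm\<^esub>} \<and> distinct xs" for X R
  proof (rule finite_distinct_list)
    have "{x. dom x = X \<and> psi D Dr R x \<noteq> \<zero>\<^bsub>bsm\<^esub>} \<subseteq> snd ` (D \<union> Dr)"
      by (force simp: psi_def)
    thus "finite {x. dom x = X \<and> psi D Dr R x \<noteq> \<zero>\<^bsub>bsm\<^esub>}" using fin by (meson finite_UnI finite_imageI finite_subset)
  qed
  then obtain L where L: "set (L X R) = {x. dom x = X \<and> psi D Dr R x \<noteq> \<zero>\<^bsub>bsm\<^esub>} \<and> distinct (L X R)" for X R
    by metis
  hence "stores ?N Q (\<lambda>R. map (\<lambda>x. (x, vec R x)) (L (THE X. (R, X) \<in> Q) R)) (psi D Dr)" if "sjf_bcq Q"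
  proof -
    have "(THE X. (R, X) \<in> Q) = X" if "(R, X) \<in> Q" for R X
    proof (rule the_equality)
      have "inj_on fst Q" using \<open>sjf_bcq Q\<close> by (simp add: sjf_bcq_def)
      thus "X' = X" if "(R, X') \<in> Q" for X'
        using that \<open>(R, X) \<in> Q\<close> by (metis fst_conv inj_on_def snd_conv)
    qed (fact that)
    thus ?thesis unfolding stores_def using vec L
      by (auto simp: comp_def image_image)
  qed
  thus ?thesis using assms by blast
qed
text \<open>
  Started in S, every execution of the implementation with vectors of length N + 1 stays within
  time tm and space sp, follows a run of the algorithm on A, never gets stuck before the query has
  the form R(), and finally returns q. As each step takes at least one tick, the bound on the time
  of partial executions entails termination.
\<close>

definition hea_runs_within ::
    "nat \<Rightarrow> ('r, 'v) query \<Rightarrow> ('r, 'v, 'd, nat list) stored_db \<Rightarrow>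
     ('r, 'v, 'd, nat \<Rightarrow> nat) annotated_db \<Rightarrow> (nat \<Rightarrow> nat) \<Rightarrow> nat \<Rightarrow> nat \<Rightarrow> bool" where
  "hea_runs_within N Q S A q tm sp \<longleftrightarrow>
     (\<forall>Q' S' t s. hea_exec (bsm_ops N) Q S Q' S' t s \<longrightarrow>
        t \<le> tm \<and> s \<le> sp \<and>
        (\<exists>A'. (hea_step bsm)\<^sup>*\<^sup>* (Q, A) (Q', A') \<and> stores N Q' S' A') \<and>
        (no_rule_applies Q' \<longrightarrow>
           (\<exists>R. Q' = {(R, {})} \<and>
              (let m = fetch (bsm_ops N) (S' R) Map.empty
               in vec_of (result m) = q \<and> t + ticks m \<le> tm \<and> s + cells m \<le> sp))))"

end

theory Submission
  imports Defs
begin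

text \<open>
  An allocation c assigns a budget to every fact. Its value on an annotated database A is the sum,
  over all assignments w of the variables, of the product over the atoms R(X) of the entry of the
  annotation of R(w|X) at the budget of that fact. The set of pairs (total budget, attained value)
  is preserved by both rules of the algorithm: an entry of a sum or product in the 2-monoid is a
  maximum over all ways of splitting the budget, and the eliminated variable occurs in one factor
  only, so that distributivity applies. For the input annotation the values are the multiplicities
  of the repairs, and for a query of the form R() they are the entries of the annotation of the
  empty tuple.

  Truncating vectors to N + 1 entries loses nothing, because the annotations become constant from
  certain budgets on whose total is at most N, and the rules preserve this. The running time
  follows since the number of stored facts never grows and every step decreases the number of
  variables plus the number of atoms by one.
\<close>

section \<open>The Bag-Set Maximization 2-monoid\<close>

text \<open>The obstacle is that \<open>\<otimes>\<close> does not distribute over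
  \<open>\<oplus>\<close>: at budget 1, \<open>star \<otimes> (\<one> \<oplus> \<one>)\<close> has
  entry 2, but \<open>(star \<otimes> \<one>) \<oplus> (star \<otimes> \<one>)\<close> has entry 1,
  since it pays for the same fact twice. So the sum of products over all assignments, evaluated in
  the 2-monoid, is in general not preserved by Rule 1. Fixing a budget for every fact before
  evaluating removes the maxima and leaves a sum of products in \<open>nat\<close>. The maxima then
  have to be resolved once per new fact. This works because the old facts merged into different new
  facts are disjoint, so that optimal splits chosen separately glue to one allocation.

  The same disjointness governs truncation. A bound on each threshold separately need not survive a
  step, since thresholds add up in sums and products. Their total over all facts is not increased by
  either rule, and initially it is at most \<open>card Dr\<close>, because only facts of
  \<open>Dr\<close> carry an annotation that is not constant.\<close>

lemma carrier_bsm: "x \<in> carrier bsm \<longleftrightarrow> mono x"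
  by (auto simp: bsm_def mono_def) (metis le_eq_less_or_eq)

lemma zero_bsm: "\<zero>\<^bsub>bsm\<^esub> = (\<lambda>_. 0)"
  by (simp add: bsm_def)

interpretation bsm: abelian_monoid bsm
  using two_monoid_bsm by (intro abelian_monoid.intro) (simp add: two_monoid_def)

interpretation bsm_mult: comm_monoid bsm
  using two_monoid_bsm by (simp add: two_monoid_def)

section \<open>Entries of sums and products as maxima over splits of the budget\<close>

lemma add_bsm: "(x \<oplus>\<^bsub>bsm\<^esub> y) i = Max {x i1 + y i2 | i1 i2. i1 + i2 = i}"
  by (simp add: bsm_def)

lemma mult_bsm: "(x \<otimes>\<^bsub>bsm\<^esub> y) i = Max {x i1 * y i2 | i1 i2. i1 + i2 = i}"
  by (simp add: bsm_def)

lemma add_bsm_ge: "x a + y b \<le> (x \<oplus>\<^bsub>bsm\<^esub> y) (a + b)"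
  using conv_le_iff(1)[where f = "\<lambda>i j. x i + y j" and i = "a + b"] by (auto simp: add_bsm)

lemma mult_bsm_ge: "x a * y b \<le> (x \<otimes>\<^bsub>bsm\<^esub> y) (a + b)"
  using conv_le_iff(1)[where f = "\<lambda>i j. x i * y j" and i = "a + b"] by (auto simp: mult_bsm)

lemma add_bsm_attained: "\<exists>a b. a + b = i \<and> (x \<oplus>\<^bsub>bsm\<^esub> y) i = x a + y b"
  using conv_le_iff(2)[where f = "\<lambda>i j. x i + y j"] by (auto simp: add_bsm)

lemma mult_bsm_attained: "\<exists>a b. a + b = i \<and> (x \<otimes>\<^bsub>bsm\<^esub> y) i = x a * y b"
  using conv_le_iff(2)[where f = "\<lambda>i j. x i * y j"] by (auto simp: mult_bsm)

text \<open>The 2-monoid axioms only give the product of zero with itself. Full absorption holds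
  here because every split of the budget yields a product of numbers with a factor 0; it keeps the
  support of a product inside the support of each factor.\<close>

lemma mult_zero_bsm:
  "\<zero>\<^bsub>bsm\<^esub> \<otimes>\<^bsub>bsm\<^esub> x = \<zero>\<^bsub>bsm\<^esub>" "x \<otimes>\<^bsub>bsm\<^esub> \<zero>\<^bsub>bsm\<^esub> = \<zero>\<^bsub>bsm\<^esub>"
proof -
  show "\<zero>\<^bsub>bsm\<^esub> \<otimes>\<^bsub>bsm\<^esub> x = \<zero>\<^bsub>bsm\<^esub>"
    using mult_bsm_attained[of _ "\<zero>\<^bsub>bsm\<^esub>" x] by (fastforce simp: zero_bsm)
  show "x \<otimes>\<^bsub>bsm\<^esub> \<zero>\<^bsub>bsm\<^esub> = \<zero>\<^bsub>bsm\<^esub>"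
    using mult_bsm_attained[of _ x "\<zero>\<^bsub>bsm\<^esub>"] by (fastforce simp: zero_bsm)
qed

lemma finsum_bsm_ge:
  assumes "finite I" "\<And>i. i \<in> I \<Longrightarrow> g i \<in> carrier bsm"
  shows "(\<Sum>i\<in>I. g i (c i)) \<le> finsum bsm g I (\<Sum>i\<in>I. c i)"
  using assms
proof (induction I)
  case (insert i I)
  have "g i (c i) + (\<Sum>j\<in>I. g j (c j)) \<le> g i (c i) + finsum bsm g I (\<Sum>j\<in>I. c j)"
    using insert by auto
  also have "\<dots> \<le> (g i \<oplus>\<^bsub>bsm\<^esub> finsum bsm g I) (c i + (\<Sum>j\<in>I. c j))"
    by (rule add_bsm_ge)
  finally show ?case
    using insert by (simp add: bsm.finsum_insert Pi_def)
qed simp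

text \<open>Together with \<open>finsum_bsm_ge\<close>, this makes an entry of a finite sum the best
  total over ways of distributing the budget. The distribution is only bounded by \<open>n\<close>:
  over an empty index set all of \<open>n\<close> stays unspent.\<close>

lemma finsum_bsm_attained:
  assumes "finite I" "\<And>i. i \<in> I \<Longrightarrow> g i \<in> carrier bsm"
  shows "\<exists>c. (\<Sum>i\<in>I. c i) \<le> n \<and> finsum bsm g I n = (\<Sum>i\<in>I. g i (c i))"
  using assms
proof (induction I arbitrary: n)
  case empty
  then show ?case by (simp add: zero_bsm)
next
  case (insert i I)
  obtain a b where ab: "a + b = n" "(g i \<oplus>\<^bsub>bsm\<^esub> finsum bsm g I) n = g i a + finsum bsm g I b"
    using add_bsm_attained by metis
  obtain c where c: "(\<Sum>j\<in>I. c j) \<le> b" "finsum bsm g I b = (\<Sum>j\<in>I. g j (c j))"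
    using insert by blast
  have eq: "(\<Sum>j\<in>I. (c(i := a)) j) = (\<Sum>j\<in>I. c j)"
       "(\<Sum>j\<in>I. g j ((c(i := a)) j)) = (\<Sum>j\<in>I. g j (c j))"
    using insert.hyps by (auto intro!: sum.cong)
  have "(\<Sum>j\<in>insert i I. (c(i := a)) j) \<le> n"
    unfolding sum.insert[OF insert.hyps] eq using ab c by simp
  moreover have "finsum bsm g (insert i I) n = (\<Sum>j\<in>insert i I. g j ((c(i := a)) j))"
    unfolding sum.insert[OF insert.hyps] eq using insert ab c by (simp add: bsm.finsum_insert Pi_def)
  ultimately show ?case by blast
qed

section \<open>Thresholds from which a vector is constant\<close>

definition stable_from :: "nat \<Rightarrow> (nat \<Rightarrow> nat) \<Rightarrow> bool" where
  "stable_from k x \<longleftrightarrow> (\<forall>i\<ge>k. x i = x k)"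

lemma stable_from_zero: "stable_from k \<zero>\<^bsub>bsm\<^esub>"
  by (simp add: stable_from_def zero_bsm)

lemma stable_from_le: "stable_from k x \<Longrightarrow> mono x \<Longrightarrow> x i \<le> x k"
  by (metis stable_from_def monoD nat_le_linear order_refl)

text \<open>From index \<open>a + b\<close> on, the split into \<open>a\<close> and
  \<open>i - a\<close> gives both arguments their final values, and by monotonicity no other split
  does better. Stated for a general monotone \<open>f\<close> so as to cover \<open>\<oplus>\<close>
  and \<open>\<otimes>\<close> at once.\<close>

lemma stable_from_conv:
  fixes z :: "nat \<Rightarrow> nat" and f :: "nat \<Rightarrow> nat \<Rightarrow> nat"
  assumes "mono x" "mono y" "stable_from a x" "stable_from b y"
    and f: "\<And>p q r s. p \<le> q \<Longrightarrow> r \<le> s \<Longrightarrow> f p r \<le> f q s"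
    and ge: "\<And>i j. f (x i) (y j) \<le> z (i + j)"
    and ex: "\<And>i. \<exists>p q. p + q = i \<and> z i = f (x p) (y q)"
  shows "stable_from (a + b) z"
proof -
  have "z i = f (x a) (y b)" if "a + b \<le> i" for i
  proof (rule antisym)
    show "z i \<le> f (x a) (y b)"
      using ex[of i] f[OF stable_from_le[OF assms(3,1)] stable_from_le[OF assms(4,2)]] by metis
    have "y (i - a) = y b"
      using assms(4) that unfolding stable_from_def by (metis le_diff_conv2 add_leD1 add.commute)
    then show "f (x a) (y b) \<le> z i"
      using ge[of a "i - a"] that by simp
  qed
  then show ?thesis unfolding stable_from_def by (metis order_refl)
qed

lemma stable_from_add:
  assumes "x \<in> carrier bsm" "y \<in> carrier bsm" "stable_from a x" "stable_from b y"
  shows "stable_from (a + b) (x \<oplus>\<^bsub>bsm\<^esub> y)"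
  using assms unfolding carrier_bsm
  by (rule stable_from_conv[where f = "(+)"]) (auto simp: add_bsm_ge add_bsm_attained add_mono)

lemma stable_from_mult:
  assumes "x \<in> carrier bsm" "y \<in> carrier bsm" "stable_from a x" "stable_from b y"
  shows "stable_from (a + b) (x \<otimes>\<^bsub>bsm\<^esub> y)"
  using assms unfolding carrier_bsm
  by (rule stable_from_conv[where f = "(*)"]) (auto simp: mult_bsm_ge mult_bsm_attained mult_mono)

lemma stable_from_finsum:
  assumes "finite I" "\<And>i. i \<in> I \<Longrightarrow> g i \<in> carrier bsm" "\<And>i. i \<in> I \<Longrightarrow> stable_from (k i) (g i)"
  shows "stable_from (\<Sum>i\<in>I. k i) (finsum bsm g I)"
  using assms
proof (induction I)
  case (insert i I)
  then show ?case by (simp add: bsm.finsum_insert Pi_def stable_from_add)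
qed (simp add: stable_from_zero)

section \<open>Allocations\<close>

text \<open>A sum over an infinite index set is a dummy value, so costs and values range over tuples
  with values in a set \<open>E\<close>, which is finite wherever they are used.\<close>

definition tuples :: "'d set \<Rightarrow> 'v set \<Rightarrow> ('v, 'd) tuple set" where
  "tuples E X = {x. dom x = X \<and> ran x \<subseteq> E}"

definition alloc_cost ::
    "'d set \<Rightarrow> ('r, 'v) query \<Rightarrow> ('r \<Rightarrow> ('v, 'd) tuple \<Rightarrow> nat) \<Rightarrow> nat" where
  "alloc_cost E Q c = (\<Sum>(R, X)\<in>Q. \<Sum>x\<in>tuples E X. c R x)"

text \<open>A budget belongs to a fact and not to an assignment: all \<open>w\<close> that restrict
  to the same fact see the same entry of its annotation, while \<open>alloc_cost\<close> charges it
  once. This is how adding one fact can serve many assignments.\<close>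

definition alloc_value ::
    "'d set \<Rightarrow> ('r, 'v) query \<Rightarrow> ('r, 'v, 'd, nat \<Rightarrow> nat) annotated_db \<Rightarrow>
     ('r \<Rightarrow> ('v, 'd) tuple \<Rightarrow> nat) \<Rightarrow> nat" where
  "alloc_value E Q A c =
     (\<Sum>w\<in>tuples E (vars Q). \<Prod>(R, X)\<in>Q. A R (w |` X) (c R (w |` X)))"

text \<open>Two inequalities instead of equalities, because an optimal distribution may leave budget
  over. The values attained at a fixed \<open>i\<close> then form a downward closed set, and
  comparing such sets determines entries without speaking of a maximum over infinitely many
  allocations.\<close>

definition attains ::
    "'d set \<Rightarrow> ('r, 'v) query \<Rightarrow> ('r, 'v, 'd, nat \<Rightarrow> nat) annotated_db \<Rightarrow> nat \<Rightarrow> nat \<Rightarrow> bool" where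
  "attains E Q A i m \<longleftrightarrow> (\<exists>c. alloc_cost E Q c \<le> i \<and> m \<le> alloc_value E Q A c)"

text \<open>
  E contains the active domain; k assigns to every fact a budget from which on its annotation is
  constant.
\<close>

definition admissible ::
    "nat \<Rightarrow> 'd set \<Rightarrow> ('r, 'v) query \<Rightarrow> ('r, 'v, 'd, nat \<Rightarrow> nat) annotated_db \<Rightarrow> bool" where
  "admissible N E Q A \<longleftrightarrow>
     finite E \<and> sjf_bcq Q \<and> hierarchical Q \<and>
     (\<forall>(R, X)\<in>Q. \<forall>x. dom x = X \<longrightarrow>
        A R x \<in> carrier bsm \<and> (A R x \<noteq> \<zero>\<^bsub>bsm\<^esub> \<longrightarrow> ran x \<subseteq> E)) \<and>
     (\<exists>k. alloc_cost E Q k \<le> N \<and>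
        (\<forall>(R, X)\<in>Q. \<forall>x\<in>tuples E X. stable_from (k R x) (A R x)))"

lemma finite_tuples: "finite E \<Longrightarrow> finite X \<Longrightarrow> finite (tuples E X)"
  unfolding tuples_def by (rule finite_set_of_finite_maps)

lemma tuples_empty: "tuples E {} = {Map.empty}"
  by (auto simp: tuples_def)

lemma restrict_in_tuples: "w \<in> tuples E V \<Longrightarrow> X \<subseteq> V \<Longrightarrow> w |` X \<in> tuples E X"
  by (fastforce simp: tuples_def ran_def restrict_map_def split: if_splits)

lemma sum_tuples_insert:
  assumes "Y \<notin> V"
  shows "(\<Sum>w\<in>tuples E (insert Y V). f w) = (\<Sum>w\<in>tuples E V. \<Sum>y\<in>E. f (w(Y \<mapsto> y)))"
proof -
  have "(\<Sum>w\<in>tuples E (insert Y V). f w) = (\<Sum>(w, y)\<in>tuples E V \<times> E. f (w(Y \<mapsto> y)))"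
  proof (rule sum.reindex_bij_witness[where j = "\<lambda>w. (w(Y := None), the (w Y))"
        and i = "\<lambda>(w, y). w(Y \<mapsto> y)"], goal_cases)
    case (1 w)
    then have "Y \<in> dom w" by (simp add: tuples_def)
    then show ?case by auto
  next
    case (2 w)
    then have "Y \<in> dom w" by (simp add: tuples_def)
    then obtain y where "w Y = Some y" by blast
    with 2 assms show ?case by (auto simp: tuples_def ran_def split: if_splits)
  next
    case (3 p)
    then have "fst p Y = None" using assms by (force simp: tuples_def)
    then show ?case by (auto simp: fun_eq_iff split: prod.splits)
  next
    case (4 p)
    then have "fst p Y = None" using assms by (force simp: tuples_def)
    with 4 show ?case by (auto simp: tuples_def)
  next
    case (5 w)
    then have "Y \<in> dom w" by (simp add: tuples_def)
    then show ?case by (auto simp: fun_upd_idem)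
  qed
  then show ?thesis by (simp add: sum.cartesian_product)
qed

lemma alloc_cost_insert:
  assumes "finite Q" "R \<notin> fst ` Q"
  shows "alloc_cost E (insert (R, X) Q) c = (\<Sum>x\<in>tuples E X. c R x) + alloc_cost E Q c"
proof -
  have "(R, X) \<notin> Q" using assms(2) by force
  then show ?thesis using assms(1) by (simp add: alloc_cost_def)
qed

lemma alloc_cost_cong:
  assumes "\<And>R X x. (R, X) \<in> Q \<Longrightarrow> x \<in> tuples E X \<Longrightarrow> c R x = c' R x"
  shows "alloc_cost E Q c = alloc_cost E Q c'"
  using assms by (auto simp: alloc_cost_def intro!: sum.cong)

lemma member_le_alloc_cost:
  assumes "finite E" "sjf_bcq Q" "(R, X) \<in> Q" "x \<in> tuples E X"
  shows "c R x \<le> alloc_cost E Q c"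
proof -
  have "finite (tuples E X)" "finite Q"
    using assms by (auto simp: sjf_bcq_def intro!: finite_tuples)
  then have "c R x \<le> (\<Sum>x\<in>tuples E X. c R x)"
    using assms by (intro member_le_sum) auto
  also have "\<dots> \<le> alloc_cost E Q c"
    using assms \<open>finite Q\<close> unfolding alloc_cost_def
    by (intro member_le_sum[where f = "\<lambda>(R, X). \<Sum>x\<in>tuples E X. c R x" and i = "(R, X)", simplified]) auto
  finally show ?thesis .
qed

section \<open>Elimination steps\<close>

lemma sjf_bcq_unique: "sjf_bcq Q \<Longrightarrow> (R, X) \<in> Q \<Longrightarrow> (R, X') \<in> Q \<Longrightarrow> X = X'"
  unfolding sjf_bcq_def by (metis fst_conv inj_onD snd_conv)

lemma in_atoms_with: "a \<in> atoms_with Q Y \<longleftrightarrow> a \<in> Q \<and> Y \<in> snd a"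
  by (cases a) (simp add: atoms_with_def)

text \<open>Isolates the remainder \<open>Q0\<close> shared by \<open>Q\<close> and
  \<open>Q'\<close>. Costs and values split into a part for the changed atom and a part over
  \<open>Q0\<close>, on which the allocations before and after the step agree.\<close>

lemma elim_varE:
  assumes "elim_var Q R X Y R' Q'" "sjf_bcq Q"
  obtains Q0 where "Q = insert (R, X) Q0" "Q' = insert (R', X - {Y}) Q0" "finite Q0"
    "R \<notin> fst ` Q0" "R' \<notin> fst ` Q0" "R \<noteq> R'" "Y \<in> X" "finite X"
    "\<forall>(S, Z)\<in>Q0. Y \<notin> Z \<and> finite Z"
proof
  let ?Q0 = "Q - {(R, X)}"
  have *: "(R, X) \<in> Q" "Y \<in> X"
    using assms by (auto simp: elim_var_def atoms_with_def)
  show "Q = insert (R, X) ?Q0" "Y \<in> X" "finite ?Q0" "finite X"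
    using * assms by (auto simp: sjf_bcq_def)
  show "Q' = insert (R', X - {Y}) ?Q0"
    using assms(1) by (simp add: elim_var_def)
  have "R' \<notin> fst ` Q" using assms(1) by (simp add: elim_var_def)
  then show "R' \<notin> fst ` ?Q0" "R \<noteq> R'"
    using *(1) by (blast, metis image_eqI fst_conv)
  show "R \<notin> fst ` ?Q0"
    using sjf_bcq_unique[OF assms(2) *(1)] by auto
  show "\<forall>(S, Z)\<in>?Q0. Y \<notin> Z \<and> finite Z"
    using assms unfolding elim_var_def atoms_with_def sjf_bcq_def by blast
qed

lemma elim_atomE:
  assumes "elim_atom Q R1 R2 X R' Q'" "sjf_bcq Q"
  obtains Q0 where "Q = insert (R1, X) (insert (R2, X) Q0)" "Q' = insert (R', X) Q0" "finite Q0"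
    "R1 \<notin> fst ` Q0" "R2 \<notin> fst ` Q0" "R' \<notin> fst ` Q0" "R1 \<noteq> R2" "R1 \<noteq> R'" "R2 \<noteq> R'" "finite X"
    "\<forall>(S, Z)\<in>Q0. finite Z"
proof
  let ?Q0 = "Q - {(R1, X), (R2, X)}"
  have *: "(R1, X) \<in> Q" "(R2, X) \<in> Q" "R1 \<noteq> R2" "R' \<notin> fst ` Q"
    using assms by (auto simp: elim_atom_def)
  show "Q = insert (R1, X) (insert (R2, X) ?Q0)" "finite ?Q0" "R1 \<noteq> R2" "finite X"
    using * assms by (auto simp: sjf_bcq_def)
  show "Q' = insert (R', X) ?Q0"
    using assms(1) by (simp add: elim_atom_def)
  show "R' \<notin> fst ` ?Q0" "R1 \<noteq> R'" "R2 \<noteq> R'"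
    using * by (blast, (metis image_eqI fst_conv)+)
  show "R1 \<notin> fst ` ?Q0" "R2 \<notin> fst ` ?Q0"
    using sjf_bcq_unique[OF assms(2) *(1)] sjf_bcq_unique[OF assms(2) *(2)] by auto
  show "\<forall>(S, Z)\<in>?Q0. finite Z"
    using assms unfolding sjf_bcq_def by blast
qed

section \<open>Queries after an elimination step\<close>

lemma vars_insert [simp]: "vars (insert (R, X) Q) = X \<union> vars Q"
  by (auto simp: vars_def)

lemma finite_vars: "sjf_bcq Q \<Longrightarrow> finite (vars Q)"
  by (auto simp: sjf_bcq_def vars_def)

lemma vars_elim_var:
  assumes "elim_var Q R X Y R' Q'" "sjf_bcq Q"
  shows "vars Q = insert Y (vars Q')" "Y \<notin> vars Q'" "card Q' = card Q" "sjf_bcq Q'"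
proof -
  obtain Q0 where Q0: "Q = insert (R, X) Q0" "Q' = insert (R', X - {Y}) Q0" "finite Q0"
    "R \<notin> fst ` Q0" "R' \<notin> fst ` Q0" "R \<noteq> R'" "Y \<in> X" "finite X"
    "\<forall>(S, Z)\<in>Q0. Y \<notin> Z \<and> finite Z"
    by (rule elim_varE[OF assms]) (rule that)
  have "(R, X) \<notin> Q0" "(R', X - {Y}) \<notin> Q0"
    using Q0(4,5) by (metis image_eqI fst_conv)+
  then show "card Q' = card Q"
    using Q0(1-3) by simp
  have "Y \<notin> vars Q0"
    using Q0(9) by (auto simp: vars_def)
  then show "vars Q = insert Y (vars Q')" "Y \<notin> vars Q'"
    using Q0(1,2,7) by auto
  have "inj_on fst Q0"
    using assms(2) Q0(1) by (simp add: sjf_bcq_def)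
  then have "inj_on fst Q'"
    using Q0(2,5) by auto
  then show "sjf_bcq Q'"
    using Q0(2,3,8,9) by (auto simp: sjf_bcq_def)
qed

lemma vars_elim_atom:
  assumes "elim_atom Q R1 R2 X R' Q'" "sjf_bcq Q"
  shows "vars Q' = vars Q" "card Q = Suc (card Q')" "sjf_bcq Q'"
proof -
  obtain Q0 where Q0: "Q = insert (R1, X) (insert (R2, X) Q0)" "Q' = insert (R', X) Q0" "finite Q0"
    "R1 \<notin> fst ` Q0" "R2 \<notin> fst ` Q0" "R' \<notin> fst ` Q0" "R1 \<noteq> R2" "R1 \<noteq> R'" "R2 \<noteq> R'" "finite X"
    "\<forall>(S, Z)\<in>Q0. finite Z"
    by (rule elim_atomE[OF assms]) (rule that)
  have "(R1, X) \<notin> Q0" "(R2, X) \<notin> Q0" "(R', X) \<notin> Q0"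
    using Q0(4-6) by (metis image_eqI fst_conv)+
  then show "vars Q' = vars Q" "card Q = Suc (card Q')"
    using Q0(1-3,7) by auto
  have "inj_on fst Q0"
    using assms(2) Q0(1) by (simp add: sjf_bcq_def)
  then have "inj_on fst Q'"
    using Q0(2,6) by auto
  then show "sjf_bcq Q'"
    using Q0(2,3,10,11) by (auto simp: sjf_bcq_def)
qed

text \<open>Negating the three alternatives leaves a forbidden pattern: an atom with
  \<open>Y\<close> but not \<open>Z\<close>, one with \<open>Z\<close> but not \<open>Y\<close>, and
  one with both. This form mentions only the variable sets of atoms of \<open>Q\<close>, so a
  pattern in the reduced query can be pulled back atom by atom.\<close>

lemma hierarchical_iff:
  "hierarchical Q \<longleftrightarrow>
     (\<forall>Y Z a b c. a \<in> Q \<longrightarrow> b \<in> Q \<longrightarrow> c \<in> Q \<longrightarrow> Y \<in> snd a \<longrightarrow> Y \<notin> snd b \<longrightarrow>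
        Z \<in> snd b \<longrightarrow> Z \<notin> snd a \<longrightarrow> Y \<in> snd c \<longrightarrow> Z \<notin> snd c)"
    (is "_ \<longleftrightarrow> ?R")
proof -
  have vars: "Y \<in> vars Q" if "a \<in> Q" "Y \<in> snd a" for a Y
    using that unfolding vars_def by (cases a) auto
  show ?thesis
  proof
    assume H: "hierarchical Q"
    show ?R
    proof (intro allI impI notI)
      fix Y Z a b c
      assume *: "a \<in> Q" "b \<in> Q" "c \<in> Q" "Y \<in> snd a" "Y \<notin> snd b" "Z \<in> snd b" "Z \<notin> snd a"
        "Y \<in> snd c" "Z \<in> snd c"
      then have "atoms_with Q Y \<subseteq> atoms_with Q Z \<or> atoms_with Q Z \<subseteq> atoms_with Q Y \<or>
        atoms_with Q Y \<inter> atoms_with Q Z = {}"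
        using H vars unfolding hierarchical_def by meson
      moreover have "a \<in> atoms_with Q Y" "a \<notin> atoms_with Q Z" "b \<in> atoms_with Q Z"
        "b \<notin> atoms_with Q Y" "c \<in> atoms_with Q Y" "c \<in> atoms_with Q Z"
        using * by (auto simp: in_atoms_with)
      ultimately show False by blast
    qed
  next
    assume R: ?R
    show "hierarchical Q"
      unfolding hierarchical_def
    proof (intro ballI, rule ccontr)
      fix Y Z
      assume "\<not> (atoms_with Q Y \<subseteq> atoms_with Q Z \<or> atoms_with Q Z \<subseteq> atoms_with Q Y \<or>
        atoms_with Q Y \<inter> atoms_with Q Z = {})"
      then obtain a b c where "a \<in> atoms_with Q Y" "a \<notin> atoms_with Q Z" "b \<in> atoms_with Q Z"
        "b \<notin> atoms_with Q Y" "c \<in> atoms_with Q Y" "c \<in> atoms_with Q Z"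
        by blast
      then show False
        using R unfolding in_atoms_with by metis
    qed
  qed
qed

text \<open>Every variable set in \<open>Q'\<close> is a variable set in \<open>Q\<close> without
  \<open>Y\<close>. The variables of a forbidden pattern in \<open>Q'\<close> occur there and hence
  differ from \<open>Y\<close>, so the pattern was already present in \<open>Q\<close>.\<close>

lemma hierarchical_elim_var:
  assumes "elim_var Q R X Y R' Q'" "hierarchical Q"
  shows "hierarchical Q'"
proof -
  have Q': "Q' = insert (R', X - {Y}) (Q - {(R, X)})" and RX: "(R, X) \<in> Q"
    using assms(1) by (auto simp: elim_var_def atoms_with_def)
  have at: "atoms_with Q Y = {(R, X)}"
    using assms(1) by (simp only: elim_var_def)
  have only: "a = (R, X)" if "a \<in> Q" "Y \<in> snd a" for a
    using that in_atoms_with[of a Q Y, unfolded at] by blast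
  have lift: "\<exists>b\<in>Q. snd a = snd b - {Y}" if "a \<in> Q'" for a
  proof (cases "a = (R', X - {Y})")
    case True
    with RX show ?thesis by (intro bexI[of _ "(R, X)"]) auto
  next
    case False
    with that have "a \<in> Q" "a \<noteq> (R, X)" unfolding Q' by auto
    then have "Y \<notin> snd a" using only by metis
    with \<open>a \<in> Q\<close> show ?thesis by (intro bexI[of _ a]) auto
  qed
  show ?thesis
    unfolding hierarchical_iff
  proof (intro allI impI notI)
    fix Z W a b c
    assume a: "a \<in> Q'" and b: "b \<in> Q'" and c: "c \<in> Q'"
      and *: "Z \<in> snd a" "Z \<notin> snd b" "W \<in> snd b" "W \<notin> snd a" "Z \<in> snd c" "W \<in> snd c"
    obtain a' b' c' where l: "a' \<in> Q" "snd a = snd a' - {Y}" "b' \<in> Q" "snd b = snd b' - {Y}"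
       "c' \<in> Q" "snd c = snd c' - {Y}"
      using lift[OF a] lift[OF b] lift[OF c] by blast
    with * have "Z \<in> snd a'" "Z \<notin> snd b'" "W \<in> snd b'" "W \<notin> snd a'" "Z \<in> snd c'" "W \<in> snd c'"
      by auto
    with l assms(2) show False unfolding hierarchical_iff by metis
  qed
qed

lemma hierarchical_elim_atom:
  assumes "elim_atom Q R1 R2 X R' Q'" "hierarchical Q"
  shows "hierarchical Q'"
proof -
  have lift: "\<exists>b\<in>Q. snd a = snd b" if "a \<in> Q'" for a
    using that assms(1) unfolding elim_atom_def by (metis Diff_iff insertE snd_conv)
  show ?thesis
    unfolding hierarchical_iff
  proof (intro allI impI notI)
    fix Z W a b c
    assume a: "a \<in> Q'" and b: "b \<in> Q'" and c: "c \<in> Q'"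
      and *: "Z \<in> snd a" "Z \<notin> snd b" "W \<in> snd b" "W \<notin> snd a" "Z \<in> snd c" "W \<in> snd c"
    obtain a' b' c' where "a' \<in> Q" "snd a = snd a'" "b' \<in> Q" "snd b = snd b'"
       "c' \<in> Q" "snd c = snd c'"
      using lift[OF a] lift[OF b] lift[OF c] by blast
    with * assms(2) show False unfolding hierarchical_iff by metis
  qed
qed

text \<open>If variables remain, take \<open>Y\<close> occurring in the fewest atoms; as Rule 1
  fails, there are at least two of them. A variable \<open>Z\<close> sharing an atom with
  \<open>Y\<close> has a comparable set of atoms, and minimality makes it contain that of
  \<open>Y\<close>. So all atoms with \<open>Y\<close> have the same variable set, and Rule 2
  applies.\<close>

lemma no_rule_applies_imp:
  fixes Q :: "('r::infinite, 'v) query"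
  assumes "no_rule_applies Q" "sjf_bcq Q" "hierarchical Q"
  shows "\<exists>R. Q = {(R, {})}"
proof -
  have fin: "finite Q" using assms(2) by (simp add: sjf_bcq_def)
  \<comment> \<open>The rules leave the new symbol open, so refuting \<open>no_rule_applies\<close>
    requires exhibiting a fresh one; this is where the type of relation symbols must be
    infinite.\<close>
  obtain R' :: 'r where R': "R' \<notin> fst ` Q"
    using ex_new_if_finite[OF infinite_UNIV, of "fst ` Q"] fin by auto
  have no_single: "\<nexists>Y a. atoms_with Q Y = {a}"
    using assms(1) R' unfolding no_rule_applies_def elim_var_def by (metis surj_pair)
  have no_pair: "R1 = R2" if "(R1, X) \<in> Q" "(R2, X) \<in> Q" for R1 R2 X
    using assms(1) R' no_single that unfolding no_rule_applies_def elim_atom_def by blast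
  have fin_at: "finite (atoms_with Q Y)" for Y
    by (rule finite_subset[OF _ fin]) (auto simp: atoms_with_def)
  have "vars Q = {}"
  proof (rule ccontr)
    assume "vars Q \<noteq> {}"
    then obtain Y where Y: "Y \<in> vars Q"
      and min: "\<And>Z. Z \<in> vars Q \<Longrightarrow> card (atoms_with Q Y) \<le> card (atoms_with Q Z)"
      using ex_has_least_nat[of "\<lambda>Y. Y \<in> vars Q" _ "\<lambda>Y. card (atoms_with Q Y)"] by blast
    then obtain R1 X1 where 1: "(R1, X1) \<in> atoms_with Q Y"
      by (auto simp: vars_def atoms_with_def)
    then obtain R2 X2 where 2: "(R2, X2) \<in> atoms_with Q Y" "(R2, X2) \<noteq> (R1, X1)"
      using no_single by (metis is_singletonI' is_singleton_def surj_pair empty_iff)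
    have sub: "X \<subseteq> X'" if "(R, X) \<in> atoms_with Q Y" "(R', X') \<in> atoms_with Q Y" for R R' X X'
    proof
      fix Z assume "Z \<in> X"
      then have Z: "(R, X) \<in> atoms_with Q Z" "Z \<in> vars Q"
        using that by (auto simp: atoms_with_def vars_def)
      then have "atoms_with Q Z \<subseteq> atoms_with Q Y \<or> atoms_with Q Y \<subseteq> atoms_with Q Z"
        using assms(3) Y that(1) unfolding hierarchical_def by blast
      then have "atoms_with Q Y \<subseteq> atoms_with Q Z"
        using card_seteq[OF fin_at _ min[OF Z(2)]] by blast
      then show "Z \<in> X'"
        using that(2) by (auto simp: atoms_with_def)
    qed
    have "X1 = X2" using sub 1 2 by blast
    then show False using no_pair 1 2 by (auto simp: atoms_with_def)
  qed
  then have emp: "X = {}" if "(R, X) \<in> Q" for R X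
    using that by (auto simp: vars_def)
  obtain R X where RX: "(R, X) \<in> Q" using assms(2) by (auto simp: sjf_bcq_def)
  have "Q \<subseteq> {(R, {})}"
  proof (rule subrelI)
    fix R1 X1 assume "(R1, X1) \<in> Q"
    then show "(R1, X1) \<in> {(R, {})}"
      using emp no_pair RX by blast
  qed
  then have "Q = {(R, {})}"
    using RX emp by blast
  then show ?thesis ..
qed

text \<open>The support in Rule 1 varies with the tuple. Passing to one fixed finite set makes the
  sums for different tuples uniform.\<close>

lemma finsum_support:
  assumes "finite I" "\<And>i. i \<in> I \<Longrightarrow> g i \<in> carrier bsm" "\<And>i. g i \<noteq> \<zero>\<^bsub>bsm\<^esub> \<Longrightarrow> i \<in> I"
  shows "finsum bsm g {i. g i \<noteq> \<zero>\<^bsub>bsm\<^esub>} = finsum bsm g I"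
  by (rule bsm.add.finprod_mono_neutral_cong_left) (use assms in auto)

lemma admissible_carrier:
  "admissible N E Q A \<Longrightarrow> (R, dom x) \<in> Q \<Longrightarrow> A R x \<in> carrier bsm"
  unfolding admissible_def by blast

lemma admissible_ran:
  "admissible N E Q A \<Longrightarrow> (R, dom x) \<in> Q \<Longrightarrow> A R x \<noteq> \<zero>\<^bsub>bsm\<^esub> \<Longrightarrow> ran x \<subseteq> E"
  unfolding admissible_def by blast

lemma admissible_stable:
  assumes "admissible N E Q A"
  obtains k where "alloc_cost E Q k \<le> N"
    "\<And>R X x. (R, X) \<in> Q \<Longrightarrow> x \<in> tuples E X \<Longrightarrow> stable_from (k R x) (A R x)"
proof -
  have "\<exists>k. alloc_cost E Q k \<le> N \<and>
      (\<forall>(R, X)\<in>Q. \<forall>x\<in>tuples E X. stable_from (k R x) (A R x))"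
    using assms by (simp only: admissible_def)
  then obtain k where k: "alloc_cost E Q k \<le> N"
      "\<forall>(R, X)\<in>Q. \<forall>x\<in>tuples E X. stable_from (k R x) (A R x)"
    by (elim exE conjE)
  show ?thesis
    by (rule that[OF k(1)]) (use k(2) in blast)
qed

section \<open>Rule 1 on allocations\<close>

definition elim_var_annot ::
    "('r, 'v, 'd, nat \<Rightarrow> nat) annotated_db \<Rightarrow> 'r \<Rightarrow> 'v \<Rightarrow> ('v, 'd) tuple \<Rightarrow> nat \<Rightarrow> nat" where
  "elim_var_annot A R Y x' =
     finsum bsm (\<lambda>y. A R (x'(Y \<mapsto> y))) {y. A R (x'(Y \<mapsto> y)) \<noteq> \<zero>\<^bsub>bsm\<^esub>}"

lemma elim_var_annot_props:
  assumes adm: "admissible N E Q A" and RX: "(R, X) \<in> Q" and Y: "Y \<in> X" and x': "dom x' = X - {Y}"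
  shows "elim_var_annot A R Y x' = finsum bsm (\<lambda>y. A R (x'(Y \<mapsto> y))) E"
    and "elim_var_annot A R Y x' \<in> carrier bsm"
    and "elim_var_annot A R Y x' \<noteq> \<zero>\<^bsub>bsm\<^esub> \<Longrightarrow> ran x' \<subseteq> E"
    and "A R (x'(Y \<mapsto> y)) \<in> carrier bsm"
    and "A R (x'(Y \<mapsto> y)) \<noteq> \<zero>\<^bsub>bsm\<^esub> \<Longrightarrow> y \<in> E"
proof -
  have dom: "dom (x'(Y \<mapsto> y)) = X" for y
    using Y x' by auto
  have ran: "ran (x'(Y \<mapsto> y)) = insert y (ran x')" for y
    using x' by (intro ran_map_upd) auto
  have car: "A R (x'(Y \<mapsto> y)) \<in> carrier bsm" for y
    using admissible_carrier[OF adm, of R "x'(Y \<mapsto> y)"] RX unfolding dom .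
  have nz: "insert y (ran x') \<subseteq> E" if "A R (x'(Y \<mapsto> y)) \<noteq> \<zero>\<^bsub>bsm\<^esub>" for y
    using admissible_ran[OF adm, of R "x'(Y \<mapsto> y)"] RX that unfolding dom ran by blast
  show eq: "elim_var_annot A R Y x' = finsum bsm (\<lambda>y. A R (x'(Y \<mapsto> y))) E"
    unfolding elim_var_annot_def using adm car nz
    by (intro finsum_support) (auto simp: admissible_def)
  show "elim_var_annot A R Y x' \<in> carrier bsm"
    unfolding eq using car by (intro bsm.finsum_closed) auto
  show "ran x' \<subseteq> E" if nonzero: "elim_var_annot A R Y x' \<noteq> \<zero>\<^bsub>bsm\<^esub>"
  proof (rule ccontr)
    assume "\<not> ran x' \<subseteq> E"
    \<comment> \<open>A value of \<open>x'\<close> outside \<open>E\<close> occurs in every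
      extension of \<open>x'\<close>, so all extensions are annotated with zero.\<close>
    then have "{y. A R (x'(Y \<mapsto> y)) \<noteq> \<zero>\<^bsub>bsm\<^esub>} = {}"
      using nz by blast
    then have "elim_var_annot A R Y x' = \<zero>\<^bsub>bsm\<^esub>"
      unfolding elim_var_annot_def by (metis bsm.finsum_empty)
    with nonzero show False by contradiction
  qed
  show "A R (x'(Y \<mapsto> y)) \<in> carrier bsm" by (rule car)
  show "A R (x'(Y \<mapsto> y)) \<noteq> \<zero>\<^bsub>bsm\<^esub> \<Longrightarrow> y \<in> E" using nz by blast
qed

lemma alloc_value_insert:
  assumes "finite Q" "R \<notin> fst ` Q"
  shows "alloc_value E (insert (R, X) Q) A c =
    (\<Sum>w\<in>tuples E (X \<union> vars Q). A R (w |` X) (c R (w |` X)) *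
       (\<Prod>(S, Z)\<in>Q. A S (w |` Z) (c S (w |` Z))))"
proof -
  have "(R, X) \<notin> Q" using assms(2) by force
  then show ?thesis using assms(1) by (simp add: alloc_value_def)
qed

lemma prod_atoms_cong:
  assumes "\<And>S Z. (S, Z) \<in> Q \<Longrightarrow> f S Z = g S Z"
  shows "(\<Prod>(S, Z)\<in>Q. f S Z) = (\<Prod>(S, Z)\<in>Q. g S Z)"
  using assms by (intro prod.cong) auto

lemma not_in_fst_imageD: "R \<notin> fst ` Q \<Longrightarrow> (S, Z) \<in> Q \<Longrightarrow> S \<noteq> R"
  by force

text \<open>One-sided comparisons, because the two directions build different allocations: merging
  sets the new budget to the exact sum, while splitting only guarantees that the parts do not exceed
  it.\<close>

lemma alloc_cost_elim_var:
  assumes elim: "elim_var Q R X Y R' Q'" and sjf: "sjf_bcq Q"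
    and c': "\<And>S. S \<noteq> R \<Longrightarrow> S \<noteq> R' \<Longrightarrow> c' S = c S"
  shows "(\<forall>x'\<in>tuples E (X - {Y}). (\<Sum>y\<in>E. c R (x'(Y \<mapsto> y))) \<le> c' R' x') \<longrightarrow>
       alloc_cost E Q c \<le> alloc_cost E Q' c'" (is "?H1 \<longrightarrow> ?C1")
    and "(\<forall>x'\<in>tuples E (X - {Y}). c' R' x' \<le> (\<Sum>y\<in>E. c R (x'(Y \<mapsto> y)))) \<longrightarrow>
       alloc_cost E Q' c' \<le> alloc_cost E Q c" (is "?H2 \<longrightarrow> ?C2")
proof -
  obtain Q0 where Q0: "Q = insert (R, X) Q0" "Q' = insert (R', X - {Y}) Q0" "finite Q0"
    "R \<notin> fst ` Q0" "R' \<notin> fst ` Q0" "R \<noteq> R'" "Y \<in> X" "finite X"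
    "\<forall>(S, Z)\<in>Q0. Y \<notin> Z \<and> finite Z"
    by (rule elim_varE[OF elim sjf]) (rule that)
  have "alloc_cost E Q0 c = alloc_cost E Q0 c'"
    using c' not_in_fst_imageD[OF Q0(4)] not_in_fst_imageD[OF Q0(5)]
    by (intro alloc_cost_cong) metis
  moreover have "(\<Sum>x\<in>tuples E X. c R x) = (\<Sum>x'\<in>tuples E (X - {Y}). \<Sum>y\<in>E. c R (x'(Y \<mapsto> y)))"
    using sum_tuples_insert[of Y "X - {Y}" "c R" E] Q0(7) by (simp add: insert_absorb)
  ultimately have *: "alloc_cost E Q c =
      (\<Sum>x'\<in>tuples E (X - {Y}). \<Sum>y\<in>E. c R (x'(Y \<mapsto> y))) + alloc_cost E Q0 c'"
    "alloc_cost E Q' c' = (\<Sum>x'\<in>tuples E (X - {Y}). c' R' x') + alloc_cost E Q0 c'"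
    unfolding Q0(1,2) alloc_cost_insert[OF Q0(3,4)] alloc_cost_insert[OF Q0(3,5)] by simp_all
  show "?H1 \<longrightarrow> ?C1" "?H2 \<longrightarrow> ?C2"
    unfolding * by (simp_all add: sum_mono)
qed

text \<open>The only use of distributivity: \<open>Y\<close> occurs in no other atom, so for a fixed
  assignment of the remaining variables the product \<open>?P\<close> over the other atoms does not
  depend on the value of \<open>Y\<close> and can be taken out of the inner sum.\<close>

lemma alloc_value_elim_var:
  assumes elim: "elim_var Q R X Y R' Q'" and sjf: "sjf_bcq Q"
    and c': "\<And>S. S \<noteq> R \<Longrightarrow> S \<noteq> R' \<Longrightarrow> c' S = c S"
  shows "(\<forall>x'\<in>tuples E (X - {Y}).
         (\<Sum>y\<in>E. A R (x'(Y \<mapsto> y)) (c R (x'(Y \<mapsto> y)))) \<le> B x' (c' R' x')) \<longrightarrow>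
       alloc_value E Q A c \<le> alloc_value E Q' (A(R' := B)) c'" (is "?H1 \<longrightarrow> ?C1")
    and "(\<forall>x'\<in>tuples E (X - {Y}).
         B x' (c' R' x') \<le> (\<Sum>y\<in>E. A R (x'(Y \<mapsto> y)) (c R (x'(Y \<mapsto> y))))) \<longrightarrow>
       alloc_value E Q' (A(R' := B)) c' \<le> alloc_value E Q A c" (is "?H2 \<longrightarrow> ?C2")
proof -
  obtain Q0 where Q0: "Q = insert (R, X) Q0" "Q' = insert (R', X - {Y}) Q0" "finite Q0"
    "R \<notin> fst ` Q0" "R' \<notin> fst ` Q0" "R \<noteq> R'" "Y \<in> X" "finite X"
    "\<forall>(S, Z)\<in>Q0. Y \<notin> Z \<and> finite Z"
    by (rule elim_varE[OF elim sjf]) (rule that)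
  note vars' = vars_elim_var[OF elim sjf]
  have V: "X \<union> vars Q0 = insert Y (vars Q')" "X - {Y} \<union> vars Q0 = vars Q'"
    using vars'(1) unfolding Q0(1,2) by simp_all
  let ?P = "\<lambda>w. \<Prod>(S, Z)\<in>Q0. A S (w |` Z) (c S (w |` Z))"
  have restr: "w(Y \<mapsto> y) |` X = (w |` (X - {Y}))(Y \<mapsto> y)" for w y
    using Q0(7) by (auto simp: restrict_map_def)
  have P: "?P (w(Y \<mapsto> y)) = ?P w" for w y
  proof (rule prod_atoms_cong)
    fix S Z assume "(S, Z) \<in> Q0"
    then have "Y \<notin> Z" using Q0(9) by blast
    then have "w(Y \<mapsto> y) |` Z = w |` Z" by (auto simp: restrict_map_def)
    then show "A S (w(Y \<mapsto> y) |` Z) (c S (w(Y \<mapsto> y) |` Z)) = A S (w |` Z) (c S (w |` Z))" by simp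
  qed
  have P': "(\<Prod>(S, Z)\<in>Q0. (A(R' := B)) S (w |` Z) (c' S (w |` Z))) = ?P w" for w
  proof (rule prod_atoms_cong)
    fix S Z assume "(S, Z) \<in> Q0"
    then have "S \<noteq> R" "S \<noteq> R'"
      using not_in_fst_imageD[OF Q0(4)] not_in_fst_imageD[OF Q0(5)] by metis+
    then show "(A(R' := B)) S (w |` Z) (c' S (w |` Z)) = A S (w |` Z) (c S (w |` Z))"
      using c' by simp
  qed
  have "alloc_value E Q A c =
      (\<Sum>w\<in>tuples E (vars Q'). \<Sum>y\<in>E. A R ((w |` (X - {Y}))(Y \<mapsto> y)) (c R ((w |` (X - {Y}))(Y \<mapsto> y))) * ?P w)"
    unfolding Q0(1) alloc_value_insert[OF Q0(3,4)] V sum_tuples_insert[OF vars'(2)] restr P ..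
  also have "\<dots> = (\<Sum>w\<in>tuples E (vars Q').
      (\<Sum>y\<in>E. A R ((w |` (X - {Y}))(Y \<mapsto> y)) (c R ((w |` (X - {Y}))(Y \<mapsto> y)))) * ?P w)"
    by (simp only: sum_distrib_right)
  finally have 1: "alloc_value E Q A c = \<dots>" .
  have "alloc_value E Q' (A(R' := B)) c' = alloc_value E (insert (R', X - {Y}) Q0) (A(R' := B)) c'"
    by (simp only: Q0(2))
  also have "\<dots> = (\<Sum>w\<in>tuples E (vars Q'). B (w |` (X - {Y})) (c' R' (w |` (X - {Y}))) * ?P w)"
    unfolding alloc_value_insert[OF Q0(3,5)] V P' by simp
  finally have 2: "alloc_value E Q' (A(R' := B)) c' = \<dots>" .
  have "w |` (X - {Y}) \<in> tuples E (X - {Y})" if "w \<in> tuples E (vars Q')" for w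
    using restrict_in_tuples[OF that] V(2) by blast
  then show "?H1 \<longrightarrow> ?C1" "?H2 \<longrightarrow> ?C2"
    unfolding 1 2 by (auto intro!: sum_mono mult_right_mono)
qed

text \<open>The annotation of the new fact at its budget is the best way to divide that budget among
  its extensions. Each old fact extends exactly one \<open>x'\<close>, so the divisions do not
  interfere with each other.\<close>

lemma attains_elim_var:
  assumes adm: "admissible N E Q A" and elim: "elim_var Q R X Y R' Q'"
  shows "attains E Q' (A(R' := elim_var_annot A R Y)) i m \<longleftrightarrow> attains E Q A i m"
proof -
  have sjf: "sjf_bcq Q" and fin: "finite E" using adm by (auto simp: admissible_def)
  obtain Q0 where "Q = insert (R, X) Q0" and Y: "Y \<in> X" and R: "R \<noteq> R'"
    by (rule elim_varE[OF elim sjf]) (rule that)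
  then have RX: "(R, X) \<in> Q" by simp
  note annot = elim_var_annot_props[OF adm RX Y]
  have dom: "dom x' = X - {Y}" if "x' \<in> tuples E (X - {Y})" for x'
    using that by (simp add: tuples_def)
  show ?thesis
  proof
    assume "attains E Q' (A(R' := elim_var_annot A R Y)) i m"
    then obtain c' where c': "alloc_cost E Q' c' \<le> i"
      "m \<le> alloc_value E Q' (A(R' := elim_var_annot A R Y)) c'"
      unfolding attains_def by blast
    have "\<exists>d. (\<Sum>y\<in>E. d y) \<le> c' R' x' \<and>
        elim_var_annot A R Y x' (c' R' x') = (\<Sum>y\<in>E. A R (x'(Y \<mapsto> y)) (d y))"
      if "x' \<in> tuples E (X - {Y})" for x'
      unfolding annot(1)[OF dom[OF that]]
      by (rule finsum_bsm_attained[OF fin]) (rule annot(4)[OF dom[OF that]])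
    then obtain d where d: "\<And>x'. x' \<in> tuples E (X - {Y}) \<Longrightarrow> (\<Sum>y\<in>E. d x' y) \<le> c' R' x'"
        "\<And>x'. x' \<in> tuples E (X - {Y}) \<Longrightarrow>
        elim_var_annot A R Y x' (c' R' x') = (\<Sum>y\<in>E. A R (x'(Y \<mapsto> y)) (d x' y))"
      by metis
    \<comment> \<open>A tuple over \<open>X\<close> is recovered from its restriction and its value
      at \<open>Y\<close>; this glues the separate choices \<open>d x'\<close> into a single budget
      function for \<open>R\<close>.\<close>
    define c where "c = c'(R := \<lambda>x. d (x(Y := None)) (the (x Y)))"
    have c: "c R (x'(Y \<mapsto> y)) = d x' y" if "x' \<in> tuples E (X - {Y})" for x' y
    proof -
      have "x' Y = None" using dom[OF that] by blast
      then have "x'(Y := None) = x'" by (simp add: fun_upd_idem)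
      then show ?thesis by (simp add: c_def)
    qed
    have "alloc_cost E Q c \<le> alloc_cost E Q' c'"
      by (rule alloc_cost_elim_var(1)[OF elim sjf, rule_format]) (simp_all add: c d(1), simp add: c_def)
    moreover have "alloc_value E Q' (A(R' := elim_var_annot A R Y)) c' \<le> alloc_value E Q A c"
      by (rule alloc_value_elim_var(2)[OF elim sjf, rule_format]) (simp_all add: c d(2), simp add: c_def)
    ultimately show "attains E Q A i m"
      using c' unfolding attains_def by (meson order_trans)
  next
    assume "attains E Q A i m"
    then obtain c where c: "alloc_cost E Q c \<le> i" "m \<le> alloc_value E Q A c"
      unfolding attains_def by blast
    define c' where "c' = c(R' := \<lambda>x'. \<Sum>y\<in>E. c R (x'(Y \<mapsto> y)))"
    have "alloc_cost E Q' c' \<le> alloc_cost E Q c"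
      by (rule alloc_cost_elim_var(2)[OF elim sjf, rule_format]) (simp_all add: c'_def)
    moreover have "alloc_value E Q A c \<le> alloc_value E Q' (A(R' := elim_var_annot A R Y)) c'"
    proof (rule alloc_value_elim_var(1)[OF elim sjf, rule_format])
      fix x' assume x': "x' \<in> tuples E (X - {Y})"
      show "(\<Sum>y\<in>E. A R (x'(Y \<mapsto> y)) (c R (x'(Y \<mapsto> y)))) \<le> elim_var_annot A R Y x' (c' R' x')"
        unfolding annot(1)[OF dom[OF x']] c'_def fun_upd_same
        using annot(4)[OF dom[OF x']] by (intro finsum_bsm_ge fin)
    qed (simp add: c'_def)
    ultimately show "attains E Q' (A(R' := elim_var_annot A R Y)) i m"
      using c unfolding attains_def by (meson order_trans)
  qed
qed

lemma admissible_elim_var: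
  assumes adm: "admissible N E Q A" and elim: "elim_var Q R X Y R' Q'"
  shows "admissible N E Q' (A(R' := elim_var_annot A R Y))" (is "admissible N E Q' ?A")
proof -
  have sjf: "sjf_bcq Q" and fin: "finite E" using adm by (auto simp: admissible_def)
  obtain Q0 where Q0: "Q = insert (R, X) Q0" "Q' = insert (R', X - {Y}) Q0" "R' \<notin> fst ` Q0"
     and Y: "Y \<in> X"
    by (rule elim_varE[OF elim sjf]) (rule that)
  have RX: "(R, X) \<in> Q" unfolding Q0(1) by simp
  note annot = elim_var_annot_props[OF adm RX Y]
  obtain k where k: "alloc_cost E Q k \<le> N"
      "\<And>S Z x. (S, Z) \<in> Q \<Longrightarrow> x \<in> tuples E Z \<Longrightarrow> stable_from (k S x) (A S x)"
    by (rule admissible_stable[OF adm]) (rule that)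
  have old: "(S, Z) \<in> Q \<and> S \<noteq> R'" if "(S, Z) \<in> Q'" "(S, Z) \<noteq> (R', X - {Y})" for S Z
    using that Q0 not_in_fst_imageD[OF Q0(3)] by auto
  \<comment> \<open>The threshold of a sum is the sum of the thresholds of its summands. Regrouping
    by \<open>x'\<close> then shows that the total does not grow.\<close>
  let ?k = "k(R' := \<lambda>x'. \<Sum>y\<in>E. k R (x'(Y \<mapsto> y)))"
  have "alloc_cost E Q' ?k \<le> alloc_cost E Q k"
    by (rule alloc_cost_elim_var(2)[OF elim sjf, rule_format]) simp_all
  then have "alloc_cost E Q' ?k \<le> N" using k(1) by simp
  moreover have "stable_from (?k S x) (?A S x)" if "(S, Z) \<in> Q'" "x \<in> tuples E Z" for S Z x
  proof (cases "(S, Z) = (R', X - {Y})")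
    case True
    then have x: "dom x = X - {Y}" "ran x \<subseteq> E" using that by (auto simp: tuples_def)
    have "x(Y \<mapsto> y) \<in> tuples E X" if "y \<in> E" for y
    proof -
      have "dom (x(Y \<mapsto> y)) = X" using x Y by auto
      moreover have "ran (x(Y \<mapsto> y)) = insert y (ran x)" using x by (intro ran_map_upd) auto
      ultimately show ?thesis using that x by (simp add: tuples_def)
    qed
    then have stab: "stable_from (\<Sum>y\<in>E. k R (x(Y \<mapsto> y))) (finsum bsm (\<lambda>y. A R (x(Y \<mapsto> y))) E)"
      using annot(4)[OF x(1)] by (intro stable_from_finsum fin k(2)[OF RX])
    have "S = R'" using True by simp
    show ?thesis unfolding \<open>S = R'\<close> fun_upd_same annot(1)[OF x(1)] by (rule stab)
  next
    case False
    have "(S, Z) \<in> Q" "S \<noteq> R'" using old[OF that(1) False] by simp_all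
    then show ?thesis using k(2)[of S Z x] that(2) by simp
  qed
  moreover have "?A S x \<in> carrier bsm \<and> (?A S x \<noteq> \<zero>\<^bsub>bsm\<^esub> \<longrightarrow> ran x \<subseteq> E)" if "(S, dom x) \<in> Q'" for S x
  proof (cases "(S, dom x) = (R', X - {Y})")
    case True
    then show ?thesis using annot(2,3)[of x] by simp
  next
    case False
    show ?thesis
      using old[OF that False] admissible_carrier[OF adm, of S x] admissible_ran[OF adm, of S x] by simp
  qed
  moreover have "sjf_bcq Q'" by (rule vars_elim_var(4)[OF elim sjf])
  moreover have "hierarchical Q'"
    using hierarchical_elim_var[OF elim] adm by (simp add: admissible_def)
  ultimately show ?thesis
    unfolding admissible_def using fin by blast
qed

section \<open>Rule 2 on allocations\<close>

definition elim_atom_annot ::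
    "('r, 'v, 'd, nat \<Rightarrow> nat) annotated_db \<Rightarrow> 'r \<Rightarrow> 'r \<Rightarrow> ('v, 'd) tuple \<Rightarrow> nat \<Rightarrow> nat" where
  "elim_atom_annot A R1 R2 x = A R1 x \<otimes>\<^bsub>bsm\<^esub> A R2 x"

lemma alloc_cost_elim_atom:
  assumes elim: "elim_atom Q R1 R2 X R' Q'" and sjf: "sjf_bcq Q"
    and c': "\<And>S. S \<noteq> R1 \<Longrightarrow> S \<noteq> R2 \<Longrightarrow> S \<noteq> R' \<Longrightarrow> c' S = c S"
    and eq: "\<And>x. x \<in> tuples E X \<Longrightarrow> c' R' x = c R1 x + c R2 x"
  shows "alloc_cost E Q' c' = alloc_cost E Q c"
proof -
  obtain Q0 where Q0: "Q = insert (R1, X) (insert (R2, X) Q0)" "Q' = insert (R', X) Q0" "finite Q0"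
    "R1 \<notin> fst ` Q0" "R2 \<notin> fst ` Q0" "R' \<notin> fst ` Q0" "R1 \<noteq> R2"
    by (rule elim_atomE[OF elim sjf]) (rule that)
  have 0: "alloc_cost E Q0 c = alloc_cost E Q0 c'"
    using c' not_in_fst_imageD[OF Q0(4)] not_in_fst_imageD[OF Q0(5)] not_in_fst_imageD[OF Q0(6)]
    by (intro alloc_cost_cong) metis
  have fin: "finite (insert (R2, X) Q0)" "R1 \<notin> fst ` insert (R2, X) Q0"
    using Q0(3,4,7) by simp_all
  show ?thesis
    unfolding Q0(1,2) alloc_cost_insert[OF fin] alloc_cost_insert[OF Q0(3,5)]
      alloc_cost_insert[OF Q0(3,6)] 0
    by (simp add: eq sum.distrib)
qed

text \<open>Both queries have the same variables, so the sums are compared term by term: two factors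
  depending on the same restriction of \<open>w\<close> are replaced by one.\<close>

lemma alloc_value_elim_atom:
  assumes elim: "elim_atom Q R1 R2 X R' Q'" and sjf: "sjf_bcq Q"
    and c': "\<And>S. S \<noteq> R1 \<Longrightarrow> S \<noteq> R2 \<Longrightarrow> S \<noteq> R' \<Longrightarrow> c' S = c S"
  shows "(\<forall>x\<in>tuples E X. A R1 x (c R1 x) * A R2 x (c R2 x) \<le> B x (c' R' x)) \<longrightarrow>
       alloc_value E Q A c \<le> alloc_value E Q' (A(R' := B)) c'" (is "?H1 \<longrightarrow> ?C1")
    and "(\<forall>x\<in>tuples E X. B x (c' R' x) \<le> A R1 x (c R1 x) * A R2 x (c R2 x)) \<longrightarrow>
       alloc_value E Q' (A(R' := B)) c' \<le> alloc_value E Q A c" (is "?H2 \<longrightarrow> ?C2")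
proof -
  obtain Q0 where Q0: "Q = insert (R1, X) (insert (R2, X) Q0)" "Q' = insert (R', X) Q0" "finite Q0"
    "R1 \<notin> fst ` Q0" "R2 \<notin> fst ` Q0" "R' \<notin> fst ` Q0" "R1 \<noteq> R2"
    by (rule elim_atomE[OF elim sjf]) (rule that)
  have fin: "finite (insert (R2, X) Q0)" "R1 \<notin> fst ` insert (R2, X) Q0" "(R2, X) \<notin> Q0"
    using Q0(3,4,7) not_in_fst_imageD[OF Q0(5)] by auto
  let ?P = "\<lambda>w. \<Prod>(S, Z)\<in>Q0. A S (w |` Z) (c S (w |` Z))"
  have P': "(\<Prod>(S, Z)\<in>Q0. (A(R' := B)) S (w |` Z) (c' S (w |` Z))) = ?P w" for w
  proof (rule prod_atoms_cong)
    fix S Z assume SZ: "(S, Z) \<in> Q0"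
    have "S \<noteq> R1" "S \<noteq> R2" "S \<noteq> R'"
      using not_in_fst_imageD[OF Q0(4) SZ] not_in_fst_imageD[OF Q0(5) SZ]
        not_in_fst_imageD[OF Q0(6) SZ] by simp_all
    then show "(A(R' := B)) S (w |` Z) (c' S (w |` Z)) = A S (w |` Z) (c S (w |` Z))"
      using c' by simp
  qed
  have 1: "alloc_value E Q A c = (\<Sum>w\<in>tuples E (X \<union> vars Q0).
      (A R1 (w |` X) (c R1 (w |` X)) * A R2 (w |` X) (c R2 (w |` X))) * ?P w)"
    unfolding Q0(1) alloc_value_insert[OF fin(1,2)] prod.insert[OF Q0(3) fin(3)]
    by (simp add: mult.assoc)
  have "alloc_value E Q' (A(R' := B)) c' = alloc_value E (insert (R', X) Q0) (A(R' := B)) c'"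
    by (simp only: Q0(2))
  also have "\<dots> = (\<Sum>w\<in>tuples E (X \<union> vars Q0). B (w |` X) (c' R' (w |` X)) * ?P w)"
    unfolding alloc_value_insert[OF Q0(3,6)] P' by simp
  finally have 2: "alloc_value E Q' (A(R' := B)) c' = \<dots>" .
  have "w |` X \<in> tuples E X" if "w \<in> tuples E (X \<union> vars Q0)" for w
    by (rule restrict_in_tuples[OF that]) simp
  then show "?H1 \<longrightarrow> ?C1" "?H2 \<longrightarrow> ?C2"
    unfolding 1 2 by (auto intro!: sum_mono mult_right_mono)
qed

text \<open>An entry of a product is attained by a split that uses the whole budget, so here the
  costs before and after are equal in both directions.\<close>

lemma attains_elim_atom:
  assumes adm: "admissible N E Q A" and elim: "elim_atom Q R1 R2 X R' Q'"
  shows "attains E Q' (A(R' := elim_atom_annot A R1 R2)) i m \<longleftrightarrow> attains E Q A i m"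
proof -
  have sjf: "sjf_bcq Q" using adm by (auto simp: admissible_def)
  have ne: "R1 \<noteq> R2" "R1 \<noteq> R'" "R2 \<noteq> R'"
    by (rule elim_atomE[OF elim sjf], simp)+
  show ?thesis
  proof
    assume "attains E Q' (A(R' := elim_atom_annot A R1 R2)) i m"
    then obtain c' where c': "alloc_cost E Q' c' \<le> i"
      "m \<le> alloc_value E Q' (A(R' := elim_atom_annot A R1 R2)) c'"
      unfolding attains_def by blast
    obtain f g where fg: "\<And>x. f x + g x = c' R' x"
        "\<And>x. elim_atom_annot A R1 R2 x (c' R' x) = A R1 x (f x) * A R2 x (g x)"
      using mult_bsm_attained[of "c' R' x" "A R1 x" "A R2 x" for x]
      unfolding elim_atom_annot_def by metis
    define c where "c = c'(R1 := f, R2 := g)"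
    have "alloc_cost E Q' c' = alloc_cost E Q c"
      by (rule alloc_cost_elim_atom[OF elim sjf]) (simp_all add: c_def fg(1) ne)
    moreover have "alloc_value E Q' (A(R' := elim_atom_annot A R1 R2)) c' \<le> alloc_value E Q A c"
      by (rule alloc_value_elim_atom(2)[OF elim sjf, rule_format]) (simp_all add: c_def fg(2) ne)
    ultimately show "attains E Q A i m"
      using c' unfolding attains_def by (metis order_trans)
  next
    assume "attains E Q A i m"
    then obtain c where c: "alloc_cost E Q c \<le> i" "m \<le> alloc_value E Q A c"
      unfolding attains_def by blast
    define c' where "c' = c(R' := \<lambda>x. c R1 x + c R2 x)"
    have "alloc_cost E Q' c' = alloc_cost E Q c"
      by (rule alloc_cost_elim_atom[OF elim sjf]) (simp_all add: c'_def)
    moreover have "alloc_value E Q A c \<le> alloc_value E Q' (A(R' := elim_atom_annot A R1 R2)) c'"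
      by (rule alloc_value_elim_atom(1)[OF elim sjf, rule_format])
        (simp_all add: c'_def elim_atom_annot_def mult_bsm_ge)
    ultimately show "attains E Q' (A(R' := elim_atom_annot A R1 R2)) i m"
      using c unfolding attains_def by (metis order_trans)
  qed
qed

lemma admissible_elim_atom:
  assumes adm: "admissible N E Q A" and elim: "elim_atom Q R1 R2 X R' Q'"
  shows "admissible N E Q' (A(R' := elim_atom_annot A R1 R2))" (is "admissible N E Q' ?A")
proof -
  have sjf: "sjf_bcq Q" and fin: "finite E" using adm by (auto simp: admissible_def)
  obtain Q0 where Q0: "Q = insert (R1, X) (insert (R2, X) Q0)" "Q' = insert (R', X) Q0"
     "R' \<notin> fst ` Q0"
    by (rule elim_atomE[OF elim sjf]) (rule that)
  have RX: "(R1, X) \<in> Q" "(R2, X) \<in> Q" unfolding Q0(1) by simp_all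
  obtain k where k: "alloc_cost E Q k \<le> N"
      "\<And>S Z x. (S, Z) \<in> Q \<Longrightarrow> x \<in> tuples E Z \<Longrightarrow> stable_from (k S x) (A S x)"
    by (rule admissible_stable[OF adm]) (rule that)
  have old: "(S, Z) \<in> Q \<and> S \<noteq> R'" if "(S, Z) \<in> Q'" "(S, Z) \<noteq> (R', X)" for S Z
    using that Q0 not_in_fst_imageD[OF Q0(3)] by auto
  have car: "A R1 x \<in> carrier bsm" "A R2 x \<in> carrier bsm" if "dom x = X" for x
    using admissible_carrier[OF adm, of _ x] RX that by simp_all
  \<comment> \<open>Thresholds add under \<open>\<otimes>\<close>, exactly as budgets do, so the
    cost computation for allocations also bounds the total threshold.\<close>
  let ?k = "k(R' := \<lambda>x. k R1 x + k R2 x)"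
  have "alloc_cost E Q' ?k = alloc_cost E Q k"
    by (rule alloc_cost_elim_atom[OF elim sjf]) simp_all
  then have "alloc_cost E Q' ?k \<le> N" using k(1) by simp
  moreover have "stable_from (?k S x) (?A S x)" if "(S, Z) \<in> Q'" "x \<in> tuples E Z" for S Z x
  proof (cases "(S, Z) = (R', X)")
    case True
    then have x: "x \<in> tuples E X" "dom x = X" using that by (auto simp: tuples_def)
    have "stable_from (k R1 x + k R2 x) (A R1 x \<otimes>\<^bsub>bsm\<^esub> A R2 x)"
      by (intro stable_from_mult car x(2) k(2)[OF _ x(1)] RX)
    then show ?thesis using True by (simp add: elim_atom_annot_def)
  next
    case False
    have "(S, Z) \<in> Q" "S \<noteq> R'" using old[OF that(1) False] by simp_all
    then show ?thesis using k(2)[of S Z x] that(2) by simp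
  qed
  moreover have "?A S x \<in> carrier bsm \<and> (?A S x \<noteq> \<zero>\<^bsub>bsm\<^esub> \<longrightarrow> ran x \<subseteq> E)" if "(S, dom x) \<in> Q'" for S x
  proof (cases "(S, dom x) = (R', X)")
    case True
    then have "dom x = X" by simp
    have "A R1 x \<otimes>\<^bsub>bsm\<^esub> A R2 x \<in> carrier bsm"
      using car[OF \<open>dom x = X\<close>] by (rule bsm_mult.m_closed)
    moreover have "ran x \<subseteq> E" if "A R1 x \<otimes>\<^bsub>bsm\<^esub> A R2 x \<noteq> \<zero>\<^bsub>bsm\<^esub>"
    proof -
      have "A R1 x \<noteq> \<zero>\<^bsub>bsm\<^esub>" using that by (metis mult_zero_bsm(1))
      then show ?thesis using admissible_ran[OF adm, of R1 x] RX \<open>dom x = X\<close> by simp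
    qed
    ultimately show ?thesis using True by (simp add: elim_atom_annot_def)
  next
    case False
    show ?thesis
      using old[OF that False] admissible_carrier[OF adm, of S x] admissible_ran[OF adm, of S x] by simp
  qed
  moreover have "sjf_bcq Q'" by (rule vars_elim_atom(3)[OF elim sjf])
  moreover have "hierarchical Q'"
    using hierarchical_elim_atom[OF elim] adm by (simp add: admissible_def)
  ultimately show ?thesis
    unfolding admissible_def using fin by blast
qed

section \<open>Invariants along a run and the returned vector\<close>

lemma hea_step_cases:
  assumes "hea_step bsm (Q, A) (Q', A')"
  obtains (1) R X Y R' where "elim_var Q R X Y R' Q'" "A' = A(R' := elim_var_annot A R Y)"
  | (2) R1 R2 X R' where "elim_atom Q R1 R2 X R' Q'" "A' = A(R' := elim_atom_annot A R1 R2)"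
  using assms
proof (cases rule: hea_step.cases)
  case (rule1 R X Y R')
  show ?thesis
    by (rule 1[OF rule1(2)]) (simp add: rule1(1) elim_var_annot_def[abs_def])
next
  case (rule2 R1 R2 X R')
  show ?thesis
    by (rule 2[OF rule2(2)]) (simp add: rule2(1) elim_atom_annot_def[abs_def])
qed

definition query_size :: "('r, 'v) query \<Rightarrow> nat" where
  "query_size Q = card (vars Q) + card Q"

lemma query_size_elim_var:
  "elim_var Q R X Y R' Q' \<Longrightarrow> sjf_bcq Q \<Longrightarrow> query_size Q = Suc (query_size Q')"
  unfolding query_size_def
  by (simp add: vars_elim_var(1)[of Q R X Y R' Q'] vars_elim_var(2-3) finite_vars[OF vars_elim_var(4)])

lemma query_size_elim_atom:
  "elim_atom Q R1 R2 X R' Q' \<Longrightarrow> sjf_bcq Q \<Longrightarrow> query_size Q = Suc (query_size Q')"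
  unfolding query_size_def by (simp add: vars_elim_atom(1-2))

lemma hea_step_invariant:
  assumes "hea_step bsm (Q, A) (Q', A')" "admissible N E Q A"
  shows "admissible N E Q' A'" "attains E Q' A' = attains E Q A" "query_size Q = Suc (query_size Q')"
proof -
  have sjf: "sjf_bcq Q" using assms(2) by (auto simp: admissible_def)
  have "admissible N E Q' A' \<and> attains E Q' A' = attains E Q A \<and>
      query_size Q = Suc (query_size Q')"
    using assms(1)
  proof (cases rule: hea_step_cases)
    case (1 R X Y R')
    show ?thesis
      unfolding 1(2) using admissible_elim_var[OF assms(2) 1(1)] attains_elim_var[OF assms(2) 1(1)]
        query_size_elim_var[OF 1(1) sjf] by (intro conjI ext)
  next
    case (2 R1 R2 X R')
    show ?thesis
      unfolding 2(2) using admissible_elim_atom[OF assms(2) 2(1)] attains_elim_atom[OF assms(2) 2(1)]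
        query_size_elim_atom[OF 2(1) sjf] by (intro conjI ext)
  qed
  then show "admissible N E Q' A'" "attains E Q' A' = attains E Q A"
      "query_size Q = Suc (query_size Q')"
    by simp_all
qed

lemma hea_steps_invariant:
  assumes "(hea_step bsm)\<^sup>*\<^sup>* (Q, A) (Q', A')" "admissible N E Q A"
  shows "admissible N E Q' A'" "attains E Q' A' = attains E Q A"
proof -
  have "admissible N E Q' A' \<and> attains E Q' A' = attains E Q A"
    using assms(1)
  proof (induction rule: rtranclp_induct2)
    case refl
    show ?case using assms(2) by simp
  next
    case (step Q1 A1 Q2 A2)
    then show ?case using hea_step_invariant by metis
  qed
  then show "admissible N E Q' A'" "attains E Q' A' = attains E Q A" by simp_all
qed

text \<open>The empty tuple is the only fact and the only assignment, so an allocation is a single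
  number. Monotonicity makes spending all of \<open>i\<close> optimal.\<close>

lemma attains_final:
  assumes "mono (A R Map.empty)"
  shows "attains E {(R, {})} A i m \<longleftrightarrow> m \<le> A R Map.empty i"
proof -
  have vars: "vars {} = {}" by (simp add: vars_def)
  have *: "alloc_cost E {(R, {})} c = c R Map.empty"
    "alloc_value E {(R, {})} A c = A R Map.empty (c R Map.empty)" for c
    by (simp_all add: alloc_cost_def alloc_value_def tuples_empty vars)
  show ?thesis
    unfolding attains_def *
  proof
    assume "m \<le> A R Map.empty i"
    then show "\<exists>c. c R Map.empty \<le> i \<and> m \<le> A R Map.empty (c R Map.empty)"
      by (intro exI[of _ "\<lambda>_ _. i"]) simp
  qed (use assms monoD order_trans in blast)
qed

text \<open>Two vectors agree as soon as the same \<open>m\<close> lie below each of their entries.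
  The invariance of \<open>attains\<close> gives this for \<open>q\<close> and the annotation that
  is left at the end.\<close>

lemma hea_outputs_bsm:
  fixes Q :: "('r::infinite, 'v) query"
  assumes adm: "admissible N E Q A" and q: "\<And>i m. attains E Q A i m \<longleftrightarrow> m \<le> q i"
  shows "hea_outputs bsm Q A q"
    and "(hea_step bsm)\<^sup>*\<^sup>* (Q, A) (Q', A') \<Longrightarrow> no_rule_applies Q' \<Longrightarrow>
       \<exists>R. Q' = {(R, {})} \<and> A' R Map.empty = q"
proof -
  show final: "\<exists>R. Q' = {(R, {})} \<and> A' R Map.empty = q"
    if run: "(hea_step bsm)\<^sup>*\<^sup>* (Q, A) (Q', A')" and fin: "no_rule_applies Q'" for Q' A'
  proof -
    note inv = hea_steps_invariant[OF run adm]
    have "sjf_bcq Q'" "hierarchical Q'" using inv(1) by (auto simp: admissible_def)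
    then obtain R where R: "Q' = {(R, {})}" using no_rule_applies_imp[OF fin] by blast
    have "A' R Map.empty \<in> carrier bsm"
      using admissible_carrier[OF inv(1), of R Map.empty] R by simp
    then have "m \<le> A' R Map.empty i \<longleftrightarrow> m \<le> q i" for i m
      using attains_final[of A' R E i m] inv(2) q R by (simp add: carrier_bsm)
    then have "A' R Map.empty = q"
      by (intro ext antisym) (metis order_refl)+
    with R show ?thesis by blast
  qed
  have "\<nexists>f. f 0 = (Q, A) \<and> (\<forall>n. hea_step bsm (f n) (f (Suc n)))"
  proof
    assume "\<exists>f. f 0 = (Q, A) \<and> (\<forall>n. hea_step bsm (f n) (f (Suc n)))"
    then obtain f where f: "f 0 = (Q, A)" "\<And>n. hea_step bsm (f n) (f (Suc n))" by blast
    have "admissible N E (fst (f n)) (snd (f n)) \<and> query_size (fst (f n)) + n = query_size Q" for n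
    proof (induction n)
      case 0
      then show ?case using f(1) adm by simp
    next
      case (Suc n)
      have step: "hea_step bsm (fst (f n), snd (f n)) (fst (f (Suc n)), snd (f (Suc n)))"
        using f(2) by simp
      show ?case
        using hea_step_invariant[OF step conjunct1[OF Suc]] Suc by simp
    qed
    \<comment> \<open>The invariant at index \<open>Suc (query_size Q)\<close>, one step more than
      the initial query admits.\<close>
    then have "Suc (query_size Q) \<le> query_size Q" by (metis le_add2)
    then show False by simp
  qed
  with final show "hea_outputs bsm Q A q" unfolding hea_outputs_def by blast
qed

section \<open>Repairs as allocations\<close>

definition active_facts :: "'d set \<Rightarrow> ('r, 'v) query \<Rightarrow> ('r, 'v, 'd) fact set" where
  "active_facts E Q = {(R, x). (R, dom x) \<in> Q \<and> ran x \<subseteq> E}"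

text \<open>A fact \<open>(R, x)\<close> determines its atom as \<open>(R, dom x)\<close>, so the
  sum over atoms and tuples can be reindexed by facts; this is what relates costs to cardinalities
  of databases.\<close>

lemma alloc_cost_eq_sum_facts:
  assumes "finite E" "sjf_bcq Q"
  shows "finite (active_facts E Q)" "alloc_cost E Q c = (\<Sum>(R, x)\<in>active_facts E Q. c R x)"
proof -
  let ?S = "Sigma Q (\<lambda>(R, X). tuples E X)"
  have finQ: "finite Q" and finX: "\<forall>(R, X)\<in>Q. finite X"
    using assms(2) by (auto simp: sjf_bcq_def)
  then have fin: "finite (tuples E X)" if "(R, X) \<in> Q" for R X
    using that assms(1) finite_tuples by blast
  have "alloc_cost E Q c = (\<Sum>p\<in>Q. \<Sum>x\<in>(case p of (R, X) \<Rightarrow> tuples E X). c (fst p) x)"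
    unfolding alloc_cost_def by (intro sum.cong) auto
  also have "\<dots> = (\<Sum>(p, x)\<in>?S. c (fst p) x)"
    using finQ fin by (intro sum.Sigma) auto
  also have "\<dots> = (\<Sum>(R, x)\<in>active_facts E Q. c R x)"
    by (rule sum.reindex_bij_witness[where j = "\<lambda>(p, x). (fst p, x)" and i = "\<lambda>(R, x). ((R, dom x), x)"])
      (auto simp: active_facts_def tuples_def)
  finally show "alloc_cost E Q c = (\<Sum>(R, x)\<in>active_facts E Q. c R x)" .
  have "active_facts E Q = (\<lambda>(p, x). (fst p, x)) ` ?S"
    by (force simp: active_facts_def tuples_def)
  moreover have "finite ?S"
    using finQ fin by (intro finite_SigmaI) auto
  ultimately show "finite (active_facts E Q)" by simp
qed

text \<open>Counting as the cost of a 0/1 allocation. It serves for the repair cost, for the total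
  of the initial thresholds and for the number of stored facts.\<close>

lemma sum_of_bool_facts:
  assumes "finite E" "sjf_bcq Q" "G \<subseteq> active_facts E Q"
  shows "alloc_cost E Q (\<lambda>R x. of_bool ((R, x) \<in> G)) = card G"
proof -
  have "alloc_cost E Q (\<lambda>R x. of_bool ((R, x) \<in> G)) = (\<Sum>f\<in>active_facts E Q. of_bool (f \<in> G))"
    unfolding alloc_cost_eq_sum_facts(2)[OF assms(1,2)] by (intro sum.cong) auto
  also have "\<dots> = card (active_facts E Q \<inter> {f. f \<in> G})"
    using alloc_cost_eq_sum_facts(1)[OF assms(1,2)] by (subst sum_of_bool_eq) auto
  also have "active_facts E Q \<inter> {f. f \<in> G} = G" using assms(3) by auto
  finally show ?thesis .
qed

lemma prod_of_bool:
  "finite A \<Longrightarrow> (\<Prod>x\<in>A. of_bool (P x)) = (of_bool (\<forall>x\<in>A. P x) :: nat)"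
  by (induction A rule: finite_induct) auto

text \<open>Every variable lies in some atom, so each value of a counted assignment appears in a
  fact of \<open>D\<close> and thus in \<open>E\<close>. Restricting the sum to \<open>E\<close>
  loses no assignment.\<close>

lemma multiplicity_eq_sum:
  assumes "finite E" "sjf_bcq Q" "D \<subseteq> active_facts E Q"
  shows "multiplicity Q D = (\<Sum>w\<in>tuples E (vars Q). \<Prod>(R, X)\<in>Q. of_bool ((R, w |` X) \<in> D))"
proof -
  have prod: "(\<Prod>(R, X)\<in>Q. of_bool ((R, w |` X) \<in> D) :: nat) =
      of_bool (\<forall>(R, X)\<in>Q. (R, w |` X) \<in> D)" for w
    using prod_of_bool[of Q "\<lambda>(R, X). (R, w |` X) \<in> D"] assms(2)
    by (simp add: sjf_bcq_def case_prod_unfold)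
  have "ran w \<subseteq> E" if w: "dom w = vars Q" "\<forall>(R, X)\<in>Q. (R, w |` X) \<in> D" for w
  proof
    fix d assume "d \<in> ran w"
    then obtain a where a: "w a = Some d" by (auto simp: ran_def)
    then have "a \<in> vars Q" using w(1) by blast
    then obtain R X where RX: "(R, X) \<in> Q" "a \<in> X" by (auto simp: vars_def)
    then have "(w |` X) a = Some d" using a by simp
    then have "d \<in> ran (w |` X)" by (rule ranI)
    moreover have "(R, w |` X) \<in> active_facts E Q" using w(2) RX assms(3) by blast
    ultimately show "d \<in> E" by (auto simp: active_facts_def)
  qed
  then have "{w. dom w = vars Q \<and> (\<forall>(R, X)\<in>Q. (R, w |` X) \<in> D)} =
      tuples E (vars Q) \<inter> {w. \<forall>(R, X)\<in>Q. (R, w |` X) \<in> D}"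
    unfolding tuples_def by blast
  then have "multiplicity Q D = card (tuples E (vars Q) \<inter> {w. \<forall>(R, X)\<in>Q. (R, w |` X) \<in> D})"
    unfolding multiplicity_def by simp
  also have "\<dots> = (\<Sum>w\<in>tuples E (vars Q). of_bool (\<forall>(R, X)\<in>Q. (R, w |` X) \<in> D))"
    using finite_tuples[OF assms(1) finite_vars[OF assms(2)]] by (subst sum_of_bool_eq) auto
  finally show ?thesis unfolding prod .
qed

definition active_domain :: "('r, 'v, 'd) fact set \<Rightarrow> 'd set" where
  "active_domain D = (\<Union>(R, x)\<in>D. ran x)"

context
  fixes Q :: "('r, 'v) query" and D Dr :: "('r, 'v, 'd) fact set" and \<theta> :: nat and E :: "'d set"
  assumes sjf: "sjf_bcq Q" and inst: "bsm_instance Q (D, Dr, \<theta>)"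
    and E: "E = active_domain (D \<union> Dr)"
begin

lemma finite_instance: "finite D" "finite Dr"
  using inst by (auto simp: bsm_instance_def database_def)

lemma instance_active: "D \<union> Dr \<subseteq> active_facts E Q"
  using inst by (fastforce simp: E bsm_instance_def database_def facts_def active_facts_def active_domain_def)

lemma finite_active_domain: "finite E"
proof -
  have "finite (dom x)" if "(R, x) \<in> D \<union> Dr" for R x
    using that instance_active sjf unfolding active_facts_def sjf_bcq_def by blast
  then show ?thesis
    unfolding E active_domain_def using finite_instance by (auto intro!: finite_ran)
qed

text \<open>Read with \<open>j\<close> as the budget of the fact, this is its presence in the
  repaired database: facts of \<open>D\<close> are free, facts of \<open>Dr\<close> are present once
  paid for.\<close>

lemma psi_eq_of_bool: "psi D Dr R x j = of_bool ((R, x) \<in> D \<or> (R, x) \<in> Dr \<and> 0 < j)"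
  by (auto simp: psi_def star_def bsm_def)

text \<open>A repair is a 0/1 allocation that pays for the added facts. Conversely, an arbitrary
  allocation yields the repair adding the facts of \<open>Dr\<close> with positive budget; budget
  beyond 1 on a fact, or spent on any other fact, is wasted, so the repair costs no more.\<close>

lemma attains_psi: "attains E Q (psi D Dr) i m \<longleftrightarrow> m \<le> bsm_optimum Q (D, Dr, i)"
proof -
  let ?S = "{multiplicity Q D' | D'. D \<subseteq> D' \<and> D' \<subseteq> D \<union> Dr \<and> card (D' - D) \<le> i}"
  have "?S \<subseteq> multiplicity Q ` Pow (D \<union> Dr)" by auto
  then have fin: "finite ?S"
    using finite_instance by (meson finite_Pow_iff finite_UnI finite_imageI finite_subset)
  have "multiplicity Q D \<in> ?S" by (auto intro!: exI[of _ D])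
  then have ne: "?S \<noteq> {}" by blast
  have opt: "m \<le> bsm_optimum Q (D, Dr, i) \<longleftrightarrow>
      (\<exists>D'. D \<subseteq> D' \<and> D' \<subseteq> D \<union> Dr \<and> card (D' - D) \<le> i \<and> m \<le> multiplicity Q D')"
    unfolding bsm_optimum_def prod.case Max_ge_iff[OF fin ne] by blast
  \<comment> \<open>Only budgets on \<open>Dr\<close> outside \<open>D\<close> are constrained,
    since every other annotation is a constant vector.\<close>
  have val: "alloc_value E Q (psi D Dr) c = multiplicity Q D'"
    if "D \<subseteq> D'" "D' \<subseteq> D \<union> Dr"
       "\<And>R x. (R, x) \<in> Dr \<Longrightarrow> (R, x) \<notin> D \<Longrightarrow> (R, x) \<in> D' \<longleftrightarrow> 0 < c R x" for c D'
  proof -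
    have "psi D Dr R x (c R x) = of_bool ((R, x) \<in> D')" for R x
      unfolding psi_eq_of_bool using that by (intro arg_cong[where f = of_bool]) blast
    moreover have "D' \<subseteq> active_facts E Q" using that(2) instance_active by blast
    ultimately show ?thesis
      unfolding alloc_value_def
      by (simp add: multiplicity_eq_sum[OF finite_active_domain sjf])
  qed
  show ?thesis
    unfolding opt
  proof
    assume "attains E Q (psi D Dr) i m"
    then obtain c where c: "alloc_cost E Q c \<le> i" "m \<le> alloc_value E Q (psi D Dr) c"
      unfolding attains_def by blast
    define D' where "D' = D \<union> {(R, x) \<in> Dr. 0 < c R x}"
    have D': "D \<subseteq> D'" "D' \<subseteq> D \<union> Dr" unfolding D'_def by auto
    have "D' - D \<subseteq> active_facts E Q" using D'(2) instance_active by blast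
    then have "card (D' - D) = alloc_cost E Q (\<lambda>R x. of_bool ((R, x) \<in> D' - D))"
      by (rule sum_of_bool_facts[OF finite_active_domain sjf, symmetric])
    also have "\<dots> \<le> alloc_cost E Q c"
      unfolding alloc_cost_eq_sum_facts(2)[OF finite_active_domain sjf]
      by (intro sum_mono) (auto simp: D'_def)
    finally have "card (D' - D) \<le> i" using c(1) by simp
    moreover have "alloc_value E Q (psi D Dr) c = multiplicity Q D'"
      by (rule val[OF D']) (simp add: D'_def)
    ultimately show "\<exists>D'. D \<subseteq> D' \<and> D' \<subseteq> D \<union> Dr \<and> card (D' - D) \<le> i \<and> m \<le> multiplicity Q D'"
      using D' c(2) by auto
  next
    assume "\<exists>D'. D \<subseteq> D' \<and> D' \<subseteq> D \<union> Dr \<and> card (D' - D) \<le> i \<and> m \<le> multiplicity Q D'"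
    then obtain D' where D': "D \<subseteq> D'" "D' \<subseteq> D \<union> Dr" "card (D' - D) \<le> i" "m \<le> multiplicity Q D'"
      by blast
    let ?c = "\<lambda>R x. of_bool ((R, x) \<in> D' - D) :: nat"
    have "D' - D \<subseteq> active_facts E Q" using D'(2) instance_active by blast
    then have "alloc_cost E Q ?c = card (D' - D)"
      by (rule sum_of_bool_facts[OF finite_active_domain sjf])
    moreover have "alloc_value E Q (psi D Dr) ?c = multiplicity Q D'"
      by (rule val[OF D'(1,2)]) simp
    ultimately show "attains E Q (psi D Dr) i m"
      unfolding attains_def using D'(3,4) by (intro exI[of _ ?c]) simp
  qed
qed

lemma admissible_psi:
  assumes "hierarchical Q"
  shows "admissible (card Dr) E Q (psi D Dr)"
proof -
  \<comment> \<open>The entries of \<open>star\<close> are constant from index 1 on, the other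
    annotations from index 0 on. The total is the origin of the array length
    \<open>card Dr + 1\<close>.\<close>
  let ?k = "\<lambda>R x. of_bool ((R, x) \<in> Dr) :: nat"
  have "alloc_cost E Q ?k \<le> card Dr"
    using sum_of_bool_facts[OF finite_active_domain sjf, of Dr] instance_active by simp
  moreover have "stable_from (?k R x) (psi D Dr R x)" for R x
    by (auto simp: stable_from_def psi_eq_of_bool)
  moreover have "psi D Dr R x \<in> carrier bsm" for R x
    by (auto simp: carrier_bsm mono_def psi_eq_of_bool)
  moreover have "ran x \<subseteq> E" if "psi D Dr R x \<noteq> \<zero>\<^bsub>bsm\<^esub>" for R x
  proof -
    have "(R, x) \<in> D \<union> Dr" using that by (auto simp: psi_def split: if_splits)
    then show ?thesis by (force simp: E active_domain_def)
  qed
  ultimately show ?thesis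
    unfolding admissible_def using finite_active_domain sjf assms by blast
qed

lemma bsm_optimum_in_carrier: "(\<lambda>i. bsm_optimum Q (D, Dr, i)) \<in> carrier bsm"
proof -
  have "bsm_optimum Q (D, Dr, i) \<le> bsm_optimum Q (D, Dr, j)" if "i \<le> j" for i j
    using attains_psi[of i "bsm_optimum Q (D, Dr, i)"] attains_psi[of j "bsm_optimum Q (D, Dr, i)"] that
    unfolding attains_def by (meson order_refl order_trans)
  then show ?thesis by (simp add: carrier_bsm mono_def)
qed

end

section \<open>Vectors and stored relations\<close>

lemma bind_simps [simp]:
  "result (m \<triangleright> f) = result (f (result m))"
  "ticks (m \<triangleright> f) = ticks m + ticks (f (result m))"
  "cells (m \<triangleright> f) = cells m + cells (f (result m))"
  by (simp_all add: bind_def Let_def)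

lemma prim_simps [simp]:
  "result (ret a) = a" "ticks (ret a) = 0" "cells (ret a) = 0"
  "result (arith a) = a" "ticks (arith a) = 1" "cells (arith a) = 0"
  "result (read v i) = v ! i" "ticks (read v i) = 1" "cells (read v i) = 0"
  "result (project X x) = x |` X" "ticks (project X x) = card (dom x) + 1" "cells (project X x) = card X"
  "result (lookup T x) = map_of T x" "ticks (lookup T x) = card (dom x) + 1" "cells (lookup T x) = 0"
  "result (store x a T) = AList.update x a T" "ticks (store x a T) = card (dom x) + 1"
  "cells (store x a T) = card (dom x) + 1"
  by (simp_all add: ret_def arith_def read_def project_def lookup_def store_def)

lemma result_loop: "result (loop body xs a) = fold (\<lambda>x a. result (body x a)) xs a"
  by (induction xs arbitrary: a) simp_all

lemma loop_ticks_le: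
  "(\<And>x a. x \<in> set xs \<Longrightarrow> ticks (body x a) \<le> b) \<Longrightarrow> ticks (loop body xs a) \<le> length xs * Suc b + 1"
proof (induction xs arbitrary: a)
  case (Cons x xs)
  have "ticks (body x a) \<le> b" using Cons.prems by simp
  moreover have "ticks (loop body xs (result (body x a))) \<le> length xs * Suc b + 1"
    using Cons by simp
  ultimately show ?case by simp
qed simp

lemma loop_cells_le:
  "(\<And>x a. x \<in> set xs \<Longrightarrow> cells (body x a) \<le> b) \<Longrightarrow> cells (loop body xs a) \<le> length xs * b + 2"
proof (induction xs arbitrary: a)
  case (Cons x xs)
  have "cells (body x a) \<le> b" using Cons.prems by simp
  moreover have "cells (loop body xs (result (body x a))) \<le> length xs * b + 2"
    using Cons by simp
  ultimately show ?case by simp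
qed simp

lemma result_fill: "result (fill g is) = map (\<lambda>i. result (g i)) is"
  by (induction "is") simp_all

lemma fill_ticks_le:
  "(\<And>i. i \<in> set is \<Longrightarrow> ticks (g i) \<le> b) \<Longrightarrow> ticks (fill g is) \<le> length is * (b + 2) + 1"
proof (induction "is")
  case (Cons i "is")
  have "ticks (g i) \<le> b" "ticks (fill g is) \<le> length is * (b + 2) + 1" using Cons by simp_all
  then show ?case by simp
qed simp

lemma fill_cells_le:
  "(\<And>i. i \<in> set is \<Longrightarrow> cells (g i) \<le> b) \<Longrightarrow> cells (fill g is) \<le> length is * (b + 1) + 1"
proof (induction "is")
  case (Cons i "is")
  have "cells (g i) \<le> b" "cells (fill g is) \<le> length is * (b + 1) + 1" using Cons by simp_all
  then show ?case by simp
qed simp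

text \<open>Dominated by a convolution: \<open>N + 1\<close> entries, each with an inner loop of at
  most \<open>N + 1\<close> iterations at 6 ticks (5 for the body, 1 for control). The factor 10
  absorbs the linear terms.\<close>

definition op_ticks :: "nat \<Rightarrow> nat" where "op_ticks N = 10 * (Suc N)\<^sup>2"
text \<open>A convolution entry takes one cell and its inner loop two, none of which are reclaimed;
  with one more cell for the array this is \<open>3 * Suc N + 1\<close>.\<close>

definition op_cells :: "nat \<Rightarrow> nat" where "op_cells N = 4 * Suc N"

lemma convolution_cost:
  "ticks (convolution f N v w) \<le> op_ticks N" "cells (convolution f N v w) \<le> op_cells N"
proof -
  have "ticks (convolution f N v w) \<le> length [0..<Suc N] * ((6 * Suc N + 1) + 2) + 1"
    unfolding convolution_def
  proof (rule fill_ticks_le, goal_cases)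
    case (1 i)
    then have "length [0..<Suc i] * Suc 5 + 1 \<le> 6 * Suc N + 1" by auto
    then show ?case by (intro order_trans[OF loop_ticks_le[where b = 5]]) simp_all
  qed
  then show "ticks (convolution f N v w) \<le> op_ticks N"
    by (simp add: op_ticks_def power2_eq_square algebra_simps)
  have "cells (convolution f N v w) \<le> length [0..<Suc N] * (2 + 1) + 1"
    unfolding convolution_def
    by (intro fill_cells_le order_trans[OF loop_cells_le[where b = 0]]) simp_all
  then show "cells (convolution f N v w) \<le> op_cells N"
    by (simp add: op_cells_def)
qed

lemma bsm_ops_cost:
  "ticks (add_op (bsm_ops N) v w) \<le> op_ticks N" "cells (add_op (bsm_ops N) v w) \<le> op_cells N"
  "ticks (mult_op (bsm_ops N) v w) \<le> op_ticks N" "cells (mult_op (bsm_ops N) v w) \<le> op_cells N"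
  "ticks (zero_op (bsm_ops N)) \<le> op_ticks N" "cells (zero_op (bsm_ops N)) \<le> op_cells N"
  "ticks (is_zero_op (bsm_ops N) v) \<le> op_ticks N" "cells (is_zero_op (bsm_ops N) v) \<le> 2"
proof -
  show "ticks (add_op (bsm_ops N) v w) \<le> op_ticks N" "cells (add_op (bsm_ops N) v w) \<le> op_cells N"
    "ticks (mult_op (bsm_ops N) v w) \<le> op_ticks N" "cells (mult_op (bsm_ops N) v w) \<le> op_cells N"
    by (simp_all add: bsm_ops_def convolution_cost)
  have lin: "5 * Suc N \<le> op_ticks N"
    by (simp add: op_ticks_def power2_eq_square)
  have "ticks (zero_op (bsm_ops N)) \<le> length [0..<Suc N] * (0 + 2) + 1"
    by (simp add: bsm_ops_def del: upt_Suc) (rule order_trans[OF fill_ticks_le[where b = 0]]; simp)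
  with lin show "ticks (zero_op (bsm_ops N)) \<le> op_ticks N" by simp
  have "cells (zero_op (bsm_ops N)) \<le> length [0..<Suc N] * (0 + 1) + 1"
    by (simp add: bsm_ops_def del: upt_Suc) (rule order_trans[OF fill_cells_le[where b = 0]]; simp)
  then show "cells (zero_op (bsm_ops N)) \<le> op_cells N" by (simp add: op_cells_def)
  have "ticks (is_zero_op (bsm_ops N) v) \<le> length [0..<Suc N] * Suc 3 + 1"
    by (simp add: bsm_ops_def del: upt_Suc) (rule order_trans[OF loop_ticks_le[where b = 3]]; simp)
  with lin show "ticks (is_zero_op (bsm_ops N) v) \<le> op_ticks N" by simp
  have "cells (is_zero_op (bsm_ops N) v) \<le> length [0..<Suc N] * 0 + 2"
    by (simp add: bsm_ops_def del: upt_Suc) (rule order_trans[OF loop_cells_le[where b = 0]]; simp)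
  then show "cells (is_zero_op (bsm_ops N) v) \<le> 2" by simp
qed

section \<open>Arrays as truncated vectors\<close>

definition encodes :: "nat \<Rightarrow> nat list \<Rightarrow> (nat \<Rightarrow> nat) \<Rightarrow> bool" where
  "encodes N v x \<longleftrightarrow> length v = Suc N \<and> vec_of v = x"

lemma encodes_nth: "encodes N v x \<Longrightarrow> i \<le> N \<Longrightarrow> v ! i = x i"
  by (auto simp: encodes_def vec_of_def min_def)

text \<open>Encoding concerns all indices, although only \<open>N + 1\<close> entries can be
  inspected. A threshold \<open>k \<le> N\<close> carries the agreement over to the indices beyond
  the array.\<close>

lemma encodesI:
  assumes "length v = Suc N" "\<And>i. i \<le> N \<Longrightarrow> v ! i = x i" "stable_from k x" "k \<le> N"
  shows "encodes N v x"
proof -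
  have "x N = x i" if "N \<le> i" for i
    using assms(3,4) that unfolding stable_from_def by (metis order_trans)
  then have "vec_of v i = x i" for i
    using assms(1,2) by (auto simp: vec_of_def min_def)
  then show ?thesis using assms(1) by (auto simp: encodes_def)
qed

lemma fold_max_le_iff:
  "fold (\<lambda>x m. max m (g x)) xs a \<le> (b :: nat) \<longleftrightarrow> a \<le> b \<and> (\<forall>x\<in>set xs. g x \<le> b)"
  by (induction xs arbitrary: a) auto

text \<open>The running maximum and the maximum over all splits have the same upper bounds. Starting
  from 0 changes nothing for natural numbers.\<close>

lemma nth_convolution:
  assumes "encodes N v x" "encodes N w y" "i \<le> N"
  shows "result (convolution f N v w) ! i = Max {f (x i1) (y i2) | i1 i2. i1 + i2 = i}"
proof -
  have "result (convolution f N v w) ! i =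
      fold (\<lambda>i1 m. max m (f (v ! i1) (w ! (i - i1)))) [0..<Suc i] 0" (is "_ = ?m")
    using assms(3) by (simp add: convolution_def result_fill result_loop del: upt_Suc)
  also have "\<dots> = Max {f (x i1) (y i2) | i1 i2. i1 + i2 = i}" (is "_ = ?M")
  proof -
    have le: "?m \<le> b \<longleftrightarrow> ?M \<le> b" for b
    proof -
      have "?m \<le> b \<longleftrightarrow> (\<forall>i1\<le>i. f (v ! i1) (w ! (i - i1)) \<le> b)"
        unfolding fold_max_le_iff by (auto simp: less_Suc_eq_le simp del: upt_Suc)
      also have "\<dots> \<longleftrightarrow> (\<forall>i1\<le>i. f (x i1) (y (i - i1)) \<le> b)"
        using encodes_nth[OF assms(1)] encodes_nth[OF assms(2)] assms(3) by simp
      also have "\<dots> \<longleftrightarrow> (\<forall>i1 i2. i1 + i2 = i \<longrightarrow> f (x i1) (y i2) \<le> b)"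
        by (metis add_diff_cancel_left' le_add1 le_add_diff_inverse)
      finally show ?thesis
        using conv_le_iff(1)[where f = "\<lambda>i1 i2. f (x i1) (y i2)" and i = i and b = b] by simp
    qed
    show ?thesis
      by (rule antisym[OF iffD2[OF le order_refl] iffD1[OF le order_refl]])
  qed
  finally show ?thesis .
qed

lemma length_convolution: "length (result (convolution f N v w)) = Suc N"
  by (simp add: convolution_def result_fill del: upt_Suc)

text \<open>The condition \<open>a + b \<le> N\<close> ensures that the result has become constant
  by the last entry of the array; otherwise truncation could lose later growth.\<close>

lemma encodes_add:
  assumes "encodes N v x" "encodes N w y" "x \<in> carrier bsm" "y \<in> carrier bsm"
    "stable_from a x" "stable_from b y" "a + b \<le> N"
  shows "encodes N (result (add_op (bsm_ops N) v w)) (x \<oplus>\<^bsub>bsm\<^esub> y)"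
  using stable_from_add[OF assms(3-6)] assms(7) nth_convolution[OF assms(1,2)]
  by (intro encodesI) (simp_all add: bsm_ops_def length_convolution add_bsm)

lemma encodes_mult:
  assumes "encodes N v x" "encodes N w y" "x \<in> carrier bsm" "y \<in> carrier bsm"
    "stable_from a x" "stable_from b y" "a + b \<le> N"
  shows "encodes N (result (mult_op (bsm_ops N) v w)) (x \<otimes>\<^bsub>bsm\<^esub> y)"
  using stable_from_mult[OF assms(3-6)] assms(7) nth_convolution[OF assms(1,2)]
  by (intro encodesI) (simp_all add: bsm_ops_def length_convolution mult_bsm)

lemma encodes_zero: "encodes N (result (zero_op (bsm_ops N))) \<zero>\<^bsub>bsm\<^esub>"
  by (rule encodesI[where k = 0])
    (simp_all add: bsm_ops_def result_fill zero_bsm stable_from_def del: upt_Suc)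

text \<open>Inspecting \<open>N + 1\<close> entries decides equality of infinite vectors, because
  all later entries repeat the last one.\<close>

lemma result_is_zero:
  assumes "encodes N v x"
  shows "result (is_zero_op (bsm_ops N) v) \<longleftrightarrow> x = \<zero>\<^bsub>bsm\<^esub>"
proof -
  have fold: "fold (\<lambda>i b. b \<and> v ! i = 0) is c \<longleftrightarrow> c \<and> (\<forall>i\<in>set is. v ! i = 0)" for "is" c
    by (induction "is" arbitrary: c) auto
  have "result (is_zero_op (bsm_ops N) v) \<longleftrightarrow> (\<forall>i\<le>N. v ! i = 0)"
    by (auto simp: bsm_ops_def result_loop fold less_Suc_eq_le simp del: upt_Suc)
  also have "\<dots> \<longleftrightarrow> (\<forall>i. x i = 0)"
  proof
    assume "\<forall>i\<le>N. v ! i = 0"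
    then show "\<forall>i. x i = 0" using assms by (auto simp: encodes_def vec_of_def)
  qed (use encodes_nth[OF assms] in auto)
  finally show ?thesis by (auto simp: zero_bsm fun_eq_iff)
qed

text \<open>The key set \<open>K\<close> is kept separate from the support of \<open>B\<close>:
  intermediate dictionaries may hold entries with annotation zero, and only
  \<open>drop_zeros\<close> makes the two coincide.\<close>

definition represents ::
    "nat \<Rightarrow> ('v, 'd, nat list) stored_relation \<Rightarrow> ('v, 'd) tuple set \<Rightarrow>
     (('v, 'd) tuple \<Rightarrow> nat \<Rightarrow> nat) \<Rightarrow> bool" where
  "represents N T K B \<longleftrightarrow> distinct (map fst T) \<and> fst ` set T = K \<and>
     (\<forall>(x, v)\<in>set T. encodes N v (B x))"

lemma stores_iff:
  "stores N Q S A \<longleftrightarrow>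
     (\<forall>(R, X)\<in>Q. represents N (S R) {x. dom x = X \<and> A R x \<noteq> \<zero>\<^bsub>bsm\<^esub>} (A R))"
  unfolding stores_def represents_def encodes_def by blast

lemma represents_empty: "represents N [] {} B"
  by (simp add: represents_def)

lemma represents_length: "represents N T K B \<Longrightarrow> length T = card K"
  unfolding represents_def by (metis distinct_card length_map list.set_map)

lemma represents_map_of:
  assumes "represents N T K B"
  shows "map_of T x = None \<longleftrightarrow> x \<notin> K" "map_of T x = Some v \<Longrightarrow> encodes N v (B x)"
  using assms map_of_SomeD[of T x v] by (auto simp: represents_def map_of_eq_None_iff)

lemma represents_cong:
  "represents N T K B \<Longrightarrow> (\<And>x. x \<in> K \<Longrightarrow> B x = C x) \<Longrightarrow> represents N T K C"
  unfolding represents_def by (metis (no_types, lifting) case_prodD case_prodI2 fst_conv image_eqI)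

lemma represents_update:
  assumes "represents N T K B" "encodes N v b"
  shows "represents N (AList.update x v T) (insert x K) (B(x := b))"
proof -
  let ?T = "AList.update x v T"
  have dist: "distinct (map fst ?T)"
    using assms(1) by (simp add: represents_def distinct_update)
  have "encodes N u ((B(x := b)) z)" if "(z, u) \<in> set ?T" for z u
  proof -
    have "map_of ?T z = Some u" using that dist by simp
    then show ?thesis
      using represents_map_of(2)[OF assms(1), of z u] assms(2)
      by (auto simp: update_conv' split: if_splits)
  qed
  moreover have "fst ` set ?T = insert x K"
    using assms(1) by (simp add: represents_def dom_update)
  ultimately show ?thesis using dist by (auto simp: represents_def)
qed

text \<open>Covers loops in which each key is either skipped or written with a value not depending
  on the dictionary built so far: \<open>drop_zeros\<close> and both loops of Rule 2. The
  accumulating loop of Rule 1 requires its own induction.\<close>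

lemma represents_loop:
  assumes "\<And>x v U. (x, v) \<in> set T \<Longrightarrow> \<not> P x \<Longrightarrow> result (body (x, v) U) = U"
    and "\<And>x v. (x, v) \<in> set T \<Longrightarrow> P x \<Longrightarrow>
      \<exists>u. encodes N u (C x) \<and> (\<forall>U. result (body (x, v) U) = AList.update x u U)"
    and "represents N U K C"
  shows "represents N (result (loop body T U)) (K \<union> {x \<in> fst ` set T. P x}) C"
  using assms
proof (induction T arbitrary: U K)
  case (Cons p T)
  obtain x v where p: "p = (x, v)" by fastforce
  let ?K = "if P x then insert x K else K"
  have "represents N (result (body p U)) ?K C"
  proof (cases "P x")
    case True
    then obtain u where "encodes N u (C x)" "result (body (x, v) U) = AList.update x u U"
      using Cons.prems(2)[of x v] p by auto
    then show ?thesis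
      using represents_update[OF Cons.prems(3), of u "C x" x] True p by simp
  next
    case False
    then show ?thesis using Cons.prems(1)[of x v U] Cons.prems(3) p by simp
  qed
  then have "represents N (result (loop body T (result (body p U)))) (?K \<union> {x \<in> fst ` set T. P x}) C"
    by (intro Cons.IH) (use Cons.prems in \<open>auto\<close>)
  moreover have "?K \<union> {x \<in> fst ` set T. P x} = K \<union> {x \<in> fst ` set (p # T). P x}"
    using p by auto
  ultimately show ?case by simp
qed simp

lemma represents_drop_zeros:
  assumes "represents N T K B"
  shows "represents N (result (drop_zeros (bsm_ops N) T)) {x \<in> K. B x \<noteq> \<zero>\<^bsub>bsm\<^esub>} B"
proof -
  have enc: "encodes N v (B x)" if "(x, v) \<in> set T" for x v
    using assms that by (auto simp: represents_def)
  have "represents N (result (drop_zeros (bsm_ops N) T))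
      ({} \<union> {x \<in> fst ` set T. B x \<noteq> \<zero>\<^bsub>bsm\<^esub>}) B"
    unfolding drop_zeros_def
  proof (rule represents_loop[OF _ _ represents_empty], goal_cases)
    case (1 x v U)
    then show ?case using result_is_zero[OF enc[OF 1(1)]] by simp
  next
    case (2 x v)
    then show ?case
      using result_is_zero[OF enc[OF 2(1)]] enc[OF 2(1)] by (intro exI[of _ v]) simp
  qed
  moreover have "fst ` set T = K" using assms by (simp add: represents_def)
  ultimately show ?thesis by simp
qed

section \<open>Rule 1 on stored relations\<close>

definition project_loop ::
    "nat \<Rightarrow> 'v set \<Rightarrow> ('v, 'd, nat list) stored_relation \<Rightarrow> ('v, 'd, nat list) stored_relation cost" where
  "project_loop N X' T =
     loop (\<lambda>(x, a) U.
         project X' x \<triangleright> (\<lambda>x'. lookup U x' \<triangleright> (\<lambda>e.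
           case e of
             None \<Rightarrow> store x' a U
           | Some b \<Rightarrow> add_op (bsm_ops N) b a \<triangleright> (\<lambda>c. store x' c U)))) T []"

lemma rule1_prog_eq:
  "rule1_prog (bsm_ops N) X' T = project_loop N X' T \<triangleright> drop_zeros (bsm_ops N)"
  by (simp add: rule1_prog_def project_loop_def)

text \<open>Induction from the end of the list: after a prefix, the dictionary holds for each group
  the sum over the tuples seen so far. Each partial sum fits into an array because the thresholds of
  all stored tuples together are at most \<open>N\<close>.\<close>

lemma represents_project_loop:
  assumes "represents N T K B"
    and "\<And>x. x \<in> K \<Longrightarrow> B x \<in> carrier bsm" "\<And>x. x \<in> K \<Longrightarrow> stable_from (k x) (B x)"
    and "(\<Sum>x\<in>K. k x) \<le> N"
  shows "represents N (result (project_loop N X' T)) ((\<lambda>x. x |` X') ` K)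
    (\<lambda>x'. finsum bsm B {x \<in> K. x |` X' = x'})"
  using assms
proof (induction T arbitrary: K rule: rev_induct)
  case Nil
  then show ?case by (simp add: represents_def project_loop_def result_loop)
next
  case (snoc p T)
  obtain x v where p: "p = (x, v)" by fastforce
  define G where "G = fst ` set T"
  have K: "K = insert x G" and x: "x \<notin> G" and v: "encodes N v (B x)" and T: "represents N T G B"
    using snoc.prems(1) p by (auto simp: represents_def G_def)
  have G: "finite G" by (simp add: G_def)
  let ?F = "\<lambda>x'. finsum bsm B {z \<in> G. z |` X' = x'}"
  let ?x' = "x |` X'"
  let ?U = "result (project_loop N X' T)"
  have U: "represents N ?U ((\<lambda>x. x |` X') ` G) ?F"
    using snoc.prems(2-4) K x G by (intro snoc.IH[OF T]) auto
  have step: "result (project_loop N X' (T @ [p])) =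
      (case map_of ?U ?x' of None \<Rightarrow> AList.update ?x' v ?U
       | Some b \<Rightarrow> AList.update ?x' (result (add_op (bsm_ops N) b v)) ?U)"
    by (simp add: project_loop_def result_loop p split: option.split)
  have car: "B z \<in> carrier bsm" if "z \<in> K" for z using snoc.prems(2) that .
  have sum: "finsum bsm B {z \<in> K. z |` X' = ?x'} = ?F ?x' \<oplus>\<^bsub>bsm\<^esub> B x"
  proof -
    have "{z \<in> K. z |` X' = ?x'} = insert x {z \<in> G. z |` X' = ?x'}" using K by auto
    then have "finsum bsm B {z \<in> K. z |` X' = ?x'} = B x \<oplus>\<^bsub>bsm\<^esub> ?F ?x'"
      using x G car K by (simp add: bsm.finsum_insert Pi_def)
    also have "\<dots> = ?F ?x' \<oplus>\<^bsub>bsm\<^esub> B x"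
      using car K by (intro bsm.a_comm bsm.finsum_closed) auto
    finally show ?thesis .
  qed
  have "\<exists>u. encodes N u (?F ?x' \<oplus>\<^bsub>bsm\<^esub> B x) \<and>
      result (project_loop N X' (T @ [p])) = AList.update ?x' u ?U"
  proof (cases "map_of ?U ?x'")
    case None
    then have "?x' \<notin> (\<lambda>x. x |` X') ` G" using represents_map_of(1)[OF U] by blast
    \<comment> \<open>The first tuple of its group: the sum so far is zero, so the unchanged vector
      \<open>v\<close> already encodes the new sum.\<close>
    then have empty: "{z \<in> G. z |` X' = ?x'} = {}" by (metis (mono_tags, lifting) empty_Collect_eq image_eqI)
    have "?F ?x' \<oplus>\<^bsub>bsm\<^esub> B x = B x" unfolding empty using car K by simp
    then show ?thesis using v None step by (intro exI[of _ v]) simp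
  next
    case (Some b)
    let ?G = "{z \<in> G. z |` X' = ?x'}"
    have b: "encodes N b (?F ?x')" by (rule represents_map_of(2)[OF U Some])
    have "stable_from (\<Sum>z\<in>?G. k z) (?F ?x')"
      using G K snoc.prems(2,3) by (intro stable_from_finsum) auto
    \<comment> \<open>The tuple \<open>x\<close> is new, so its threshold is not counted among those
      of \<open>G\<close>, and both parts belong to the same total over \<open>K\<close>.\<close>
    moreover have "(\<Sum>z\<in>?G. k z) + k x \<le> N"
    proof -
      have "(\<Sum>z\<in>?G. k z) \<le> (\<Sum>z\<in>G. k z)" using G by (intro sum_mono2) auto
      then show ?thesis using snoc.prems(4) G x by (simp add: K)
    qed
    moreover have "?F ?x' \<in> carrier bsm" using car K by (intro bsm.finsum_closed) auto
    ultimately have "encodes N (result (add_op (bsm_ops N) b v)) (?F ?x' \<oplus>\<^bsub>bsm\<^esub> B x)"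
      using car K snoc.prems(3) by (intro encodes_add[OF b v, where b = "k x"]) auto
    then show ?thesis using Some step by auto
  qed
  then obtain u where u: "encodes N u (?F ?x' \<oplus>\<^bsub>bsm\<^esub> B x)"
    "result (project_loop N X' (T @ [p])) = AList.update ?x' u ?U" by blast
  have "represents N (AList.update ?x' u ?U) (insert ?x' ((\<lambda>x. x |` X') ` G))
      (\<lambda>x'. finsum bsm B {x \<in> K. x |` X' = x'})"
  proof (rule represents_cong[OF represents_update[OF U u(1)]])
    fix y
    show "(?F(?x' := ?F ?x' \<oplus>\<^bsub>bsm\<^esub> B x)) y = finsum bsm B {x \<in> K. x |` X' = y}"
    proof (cases "y = ?x'")
      case True
      then show ?thesis using sum by simp
    next
      case False
      then have "{x \<in> K. x |` X' = y} = {z \<in> G. z |` X' = y}" using K by auto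
      then show ?thesis using False by simp
    qed
  qed
  then show ?case using u(2) K by simp
qed

text \<open>The program groups stored tuples by their restriction, while the rule sums over values
  of \<open>Y\<close>; the map sending \<open>y\<close> to the extension of \<open>x'\<close> by
  \<open>y\<close> identifies the two index sets. A tuple without stored extensions has an empty
  sum, so no key with nonzero annotation is missing.\<close>

lemma represents_rule1:
  assumes adm: "admissible N E Q A" and RX: "(R, X) \<in> Q" and Y: "Y \<in> X"
    and T: "represents N T {x. dom x = X \<and> A R x \<noteq> \<zero>\<^bsub>bsm\<^esub>} (A R)"
  shows "represents N (result (rule1_prog (bsm_ops N) (X - {Y}) T))
    {x'. dom x' = X - {Y} \<and> elim_var_annot A R Y x' \<noteq> \<zero>\<^bsub>bsm\<^esub>} (elim_var_annot A R Y)"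
proof -
  let ?K = "{x. dom x = X \<and> A R x \<noteq> \<zero>\<^bsub>bsm\<^esub>}"
  let ?X = "X - {Y}"
  let ?F = "\<lambda>x'. finsum bsm (A R) {x \<in> ?K. x |` ?X = x'}"
  have fin: "finite E" and sjf: "sjf_bcq Q" using adm by (auto simp: admissible_def)
  then have finX: "finite X" using RX by (auto simp: sjf_bcq_def)
  obtain k where k: "alloc_cost E Q k \<le> N"
      "\<And>S Z x. (S, Z) \<in> Q \<Longrightarrow> x \<in> tuples E Z \<Longrightarrow> stable_from (k S x) (A S x)"
    by (rule admissible_stable[OF adm]) (rule that)
  have sub: "?K \<subseteq> tuples E X"
    using admissible_ran[OF adm, of R] RX by (auto simp: tuples_def)
  have car: "A R x \<in> carrier bsm" if "dom x = X" for x
    using admissible_carrier[OF adm, of R x] RX that by simp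
  have "(\<Sum>x\<in>?K. k R x) \<le> (\<Sum>x\<in>tuples E X. k R x)"
    using sub finite_tuples[OF fin finX] by (intro sum_mono2) auto
  also have "\<dots> \<le> alloc_cost E Q k"
    unfolding alloc_cost_def using sjf RX
    by (intro member_le_sum[where f = "\<lambda>(R, X). \<Sum>x\<in>tuples E X. k R x" and i = "(R, X)", simplified])
      (auto simp: sjf_bcq_def)
  finally have "(\<Sum>x\<in>?K. k R x) \<le> N" using k(1) by simp
  then have "represents N (result (project_loop N ?X T)) ((\<lambda>x. x |` ?X) ` ?K) ?F"
    using sub k(2)[OF RX] car by (intro represents_project_loop[OF T, where k = "k R"]) auto
  then have rep: "represents N (result (rule1_prog (bsm_ops N) ?X T))
      {x' \<in> (\<lambda>x. x |` ?X) ` ?K. ?F x' \<noteq> \<zero>\<^bsub>bsm\<^esub>} ?F"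
    unfolding rule1_prog_eq bind_simps by (rule represents_drop_zeros)
  have F: "?F x' = elim_var_annot A R Y x'" if x': "dom x' = ?X" for x'
  proof -
    have None: "x' Y = None" using x' by auto
    have eq: "{x \<in> ?K. x |` ?X = x'} = (\<lambda>y. x'(Y \<mapsto> y)) ` {y. A R (x'(Y \<mapsto> y)) \<noteq> \<zero>\<^bsub>bsm\<^esub>}"
    proof (intro equalityI subsetI)
      fix x assume x: "x \<in> {x \<in> ?K. x |` ?X = x'}"
      then have "Y \<in> dom x" using Y by simp
      then obtain y where y: "x Y = Some y" by blast
      have "x = x'(Y \<mapsto> y)"
      proof
        fix z
        have "z \<in> X \<or> x z = None" using x by auto
        then show "x z = (x'(Y \<mapsto> y)) z"
          using x y by (cases "z = Y") (auto simp: restrict_map_def)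
      qed
      then show "x \<in> (\<lambda>y. x'(Y \<mapsto> y)) ` {y. A R (x'(Y \<mapsto> y)) \<noteq> \<zero>\<^bsub>bsm\<^esub>}"
        using x by blast
    next
      fix x assume "x \<in> (\<lambda>y. x'(Y \<mapsto> y)) ` {y. A R (x'(Y \<mapsto> y)) \<noteq> \<zero>\<^bsub>bsm\<^esub>}"
      then obtain y where y: "x = x'(Y \<mapsto> y)" "A R x \<noteq> \<zero>\<^bsub>bsm\<^esub>" by blast
      have "dom x = X" using y(1) x' Y by auto
      moreover have "x |` ?X = x'"
        unfolding y(1) using x' None by (auto simp: fun_eq_iff restrict_map_def dom_def)
      ultimately show "x \<in> {x \<in> ?K. x |` ?X = x'}" using y(2) by simp
    qed
    have "inj_on (\<lambda>y. x'(Y \<mapsto> y)) {y. A R (x'(Y \<mapsto> y)) \<noteq> \<zero>\<^bsub>bsm\<^esub>}"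
      by (intro inj_onI) (metis fun_upd_same option.inject)
    then show ?thesis
      unfolding eq elim_var_annot_def
      using elim_var_annot_props(4)[OF adm RX Y x'] by (intro bsm.finsum_reindex) auto
  qed
  have dom: "dom (x |` ?X) = ?X" if "x \<in> ?K" for x using that by auto
  have keys: "{x' \<in> (\<lambda>x. x |` ?X) ` ?K. ?F x' \<noteq> \<zero>\<^bsub>bsm\<^esub>} =
      {x'. dom x' = ?X \<and> elim_var_annot A R Y x' \<noteq> \<zero>\<^bsub>bsm\<^esub>}" (is "?A = ?B")
  proof (intro equalityI subsetI)
    fix x' assume x': "x' \<in> ?A"
    then have "dom x' = ?X" using dom by blast
    then show "x' \<in> ?B" using x' F by simp
  next
    fix x' assume x': "x' \<in> ?B"
    then have nz: "?F x' \<noteq> \<zero>\<^bsub>bsm\<^esub>" using F by simp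
    have "{x \<in> ?K. x |` ?X = x'} \<noteq> {}"
    proof
      assume "{x \<in> ?K. x |` ?X = x'} = {}"
      then have "?F x' = \<zero>\<^bsub>bsm\<^esub>" by (simp only: bsm.finsum_empty)
      with nz show False by contradiction
    qed
    then have "x' \<in> (\<lambda>x. x |` ?X) ` ?K" by blast
    with nz show "x' \<in> ?A" by blast
  qed
  show ?thesis
    using rep unfolding keys by (rule represents_cong) (rule F, simp)
qed

section \<open>Rule 2 on stored relations\<close>

lemma result_fetch:
  assumes "represents N T {x. dom x = X \<and> B x \<noteq> \<zero>\<^bsub>bsm\<^esub>} B" "dom x = X"
  shows "encodes N (result (fetch (bsm_ops N) T x)) (B x)"
proof (cases "map_of T x")
  case None
  then have "B x = \<zero>\<^bsub>bsm\<^esub>" using represents_map_of(1)[OF assms(1)] assms(2) by blast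
  then show ?thesis using encodes_zero None by (simp add: fetch_def)
next
  case (Some a)
  then show ?thesis using represents_map_of(2)[OF assms(1)] by (simp add: fetch_def)
qed

text \<open>The two loops together visit the union of both supports, each key once. Keys stored on
  one side only receive the product zero and disappear in \<open>drop_zeros\<close>.\<close>

lemma represents_rule2:
  assumes adm: "admissible N E Q A" and elim: "elim_atom Q R1 R2 X R' Q'"
    and T1: "represents N T1 {x. dom x = X \<and> A R1 x \<noteq> \<zero>\<^bsub>bsm\<^esub>} (A R1)"
    and T2: "represents N T2 {x. dom x = X \<and> A R2 x \<noteq> \<zero>\<^bsub>bsm\<^esub>} (A R2)"
  shows "represents N (result (rule2_prog (bsm_ops N) T1 T2))
    {x. dom x = X \<and> elim_atom_annot A R1 R2 x \<noteq> \<zero>\<^bsub>bsm\<^esub>} (elim_atom_annot A R1 R2)"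
proof -
  let ?C = "elim_atom_annot A R1 R2"
  let ?K1 = "{x. dom x = X \<and> A R1 x \<noteq> \<zero>\<^bsub>bsm\<^esub>}" and ?K2 = "{x. dom x = X \<and> A R2 x \<noteq> \<zero>\<^bsub>bsm\<^esub>}"
  have fin: "finite E" and sjf: "sjf_bcq Q" using adm by (auto simp: admissible_def)
  obtain Q0 where Q0: "Q = insert (R1, X) (insert (R2, X) Q0)" "Q' = insert (R', X) Q0"
    by (rule elim_atomE[OF elim sjf]) (rule that)
  have RX: "(R1, X) \<in> Q" "(R2, X) \<in> Q" "(R', X) \<in> Q'" unfolding Q0 by simp_all
  obtain k where k: "alloc_cost E Q k \<le> N"
      "\<And>S Z x. (S, Z) \<in> Q \<Longrightarrow> x \<in> tuples E Z \<Longrightarrow> stable_from (k S x) (A S x)"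
    by (rule admissible_stable[OF adm]) (rule that)
  have car: "A R1 x \<in> carrier bsm" "A R2 x \<in> carrier bsm" if "dom x = X" for x
    using admissible_carrier[OF adm, of _ x] RX that by simp_all
  have keys1: "fst ` set T1 = ?K1" and keys2: "fst ` set T2 = ?K2"
    using T1 T2 by (simp_all only: represents_def)
  have mult: "encodes N (result (mult_op (bsm_ops N) v w)) (?C x)"
    if "encodes N v (A R1 x)" "encodes N w (A R2 x)" "x \<in> ?K1 \<union> ?K2" for v w x
  proof -
    have dom: "dom x = X" using that(3) by blast
    then have x: "x \<in> tuples E X"
      using that(3) admissible_ran[OF adm, of R1 x] admissible_ran[OF adm, of R2 x] RX
      by (auto simp: tuples_def)
    \<comment> \<open>The two thresholds at \<open>x\<close> form one term of the cost of
      \<open>?k\<close> on the merged query, and this cost equals the total of \<open>k\<close> on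
      \<open>Q\<close>.\<close>
    let ?k = "k(R' := \<lambda>x. k R1 x + k R2 x)"
    have "?k R' x \<le> alloc_cost E Q' ?k"
      by (rule member_le_alloc_cost[OF fin vars_elim_atom(3)[OF elim sjf] RX(3) x])
    also have "\<dots> = alloc_cost E Q k"
      by (rule alloc_cost_elim_atom[OF elim sjf]) simp_all
    finally have "k R1 x + k R2 x \<le> N" using k(1) by simp
    then show ?thesis
      unfolding elim_atom_annot_def
      using that(1,2) car[OF dom] k(2)[OF RX(1) x] k(2)[OF RX(2) x] by (intro encodes_mult)
  qed
  define U1 where "U1 = loop (\<lambda>(x, a) U. fetch (bsm_ops N) T2 x \<triangleright>
      (\<lambda>b. mult_op (bsm_ops N) a b \<triangleright> (\<lambda>c. store x c U))) T1 []"
  define U2 where "U2 U = loop (\<lambda>(x, b) U. lookup T1 x \<triangleright> (\<lambda>e. case e of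
        None \<Rightarrow> zero_op (bsm_ops N) \<triangleright> (\<lambda>a. mult_op (bsm_ops N) a b \<triangleright> (\<lambda>c. store x c U))
      | Some a \<Rightarrow> ret U)) T2 U" for U
  have prog: "rule2_prog (bsm_ops N) T1 T2 = U1 \<triangleright> U2 \<triangleright> drop_zeros (bsm_ops N)"
    unfolding rule2_prog_def U1_def U2_def ..
  have "represents N (result U1) ({} \<union> {x \<in> fst ` set T1. True}) ?C"
    unfolding U1_def
  proof (rule represents_loop[OF _ _ represents_empty], goal_cases)
    case (2 x v)
    have x: "x \<in> ?K1" unfolding keys1[symmetric] using 2(1) by (metis fst_conv image_eqI)
    have "encodes N v (A R1 x)" using T1 2(1) by (auto simp: represents_def)
    moreover have "encodes N (result (fetch (bsm_ops N) T2 x)) (A R2 x)"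
      using x by (intro result_fetch[OF T2]) simp
    ultimately show ?case using mult x by auto
  qed simp
  then have U1: "represents N (result U1) ?K1 ?C" by (simp add: keys1)
  have "represents N (result (U2 (result U1))) (?K1 \<union> {x \<in> fst ` set T2. map_of T1 x = None}) ?C"
    unfolding U2_def
  proof (rule represents_loop[OF _ _ U1], goal_cases)
    case (1 x v U)
    then show ?case by auto
  next
    case (2 x v)
    have x: "x \<in> ?K2" unfolding keys2[symmetric] using 2(1) by (metis fst_conv image_eqI)
    have "encodes N v (A R2 x)" using T2 2(1) by (auto simp: represents_def)
    moreover have "A R1 x = \<zero>\<^bsub>bsm\<^esub>"
      using represents_map_of(1)[OF T1] 2(2) x by blast
    then have "encodes N (result (zero_op (bsm_ops N))) (A R1 x)" using encodes_zero by simp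
    ultimately have "encodes N (result (mult_op (bsm_ops N) (result (zero_op (bsm_ops N))) v)) (?C x)"
      using mult x by blast
    then show ?case using 2(2) by auto
  qed
  then have rep: "represents N (result (rule2_prog (bsm_ops N) T1 T2))
      {x \<in> ?K1 \<union> {x \<in> fst ` set T2. map_of T1 x = None}. ?C x \<noteq> \<zero>\<^bsub>bsm\<^esub>} ?C"
    unfolding prog bind_simps by (rule represents_drop_zeros)
  have "A R1 x \<noteq> \<zero>\<^bsub>bsm\<^esub>" if "?C x \<noteq> \<zero>\<^bsub>bsm\<^esub>" for x
    using that unfolding elim_atom_annot_def by (metis mult_zero_bsm(1))
  then have "{x \<in> ?K1 \<union> {x \<in> fst ` set T2. map_of T1 x = None}. ?C x \<noteq> \<zero>\<^bsub>bsm\<^esub>} =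
      {x. dom x = X \<and> ?C x \<noteq> \<zero>\<^bsub>bsm\<^esub>}"
    unfolding keys2 by blast
  then show ?thesis using rep by simp
qed

section \<open>Costs of the rules\<close>

lemma loop_invariant:
  "P U \<Longrightarrow> (\<And>x U. x \<in> set xs \<Longrightarrow> P U \<Longrightarrow> P (result (body x U))) \<Longrightarrow> P (result (loop body xs U))"
  by (induction xs arbitrary: U) simp_all

text \<open>A row that is read produces at most one new entry, which is why neither rule increases
  the number of stored facts.\<close>

lemma loop_length_le:
  "(\<And>x U. x \<in> set xs \<Longrightarrow> length (result (body x U)) \<le> Suc (length U)) \<Longrightarrow>
     length (result (loop body xs U)) \<le> length xs + length U"
proof (induction xs arbitrary: U)
  case (Cons x xs)
  have "length (result (loop body xs (result (body x U)))) \<le> length xs + length (result (body x U))"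
    using Cons by simp
  moreover have "length (result (body x U)) \<le> Suc (length U)" using Cons.prems by simp
  ultimately show ?case by simp
qed simp

lemma length_update_le: "length (AList.update x a T) \<le> Suc (length T)"
  by (induction T) auto

definition keys_le :: "nat \<Rightarrow> ('v, 'd, 's) stored_relation \<Rightarrow> bool" where
  "keys_le b T \<longleftrightarrow> (\<forall>x\<in>fst ` set T. card (dom x) \<le> b)"

lemma keys_le_Nil: "keys_le b []"
  by (simp add: keys_le_def)

lemma keys_leD: "keys_le b T \<Longrightarrow> (x, a) \<in> set T \<Longrightarrow> card (dom x) \<le> b"
  unfolding keys_le_def by force

lemma keys_le_update: "keys_le b T \<Longrightarrow> card (dom x) \<le> b \<Longrightarrow> keys_le b (AList.update x a T)"
  by (simp add: keys_le_def dom_update)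

text \<open>Bounds the time per row for both rules including \<open>drop_zeros\<close>. The three
  vector operations are those of Rule 2 (fetching or creating a zero, multiplying, testing for
  zero); \<open>4 * b\<close> comes from the dictionary accesses and the projection in Rule
  1.\<close>

definition row_ticks :: "nat \<Rightarrow> nat \<Rightarrow> nat" where
  "row_ticks N b = 3 * op_ticks N + 4 * b + 8"

text \<open>Rule 2 may allocate two vectors for a row, a zero and a product. \<open>3 * b\<close>
  comes from Rule 1: the projected key, its stored copy, and the copy made by
  \<open>drop_zeros\<close>.\<close>

definition row_cells :: "nat \<Rightarrow> nat \<Rightarrow> nat" where
  "row_cells N b = 2 * op_cells N + 3 * b + 8"

lemma drop_zeros_cost:
  assumes "keys_le b T"
  shows "ticks (drop_zeros (bsm_ops N) T) \<le> length T * Suc (op_ticks N + b + 1) + 1"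
    and "cells (drop_zeros (bsm_ops N) T) \<le> length T * (b + 3) + 2"
    and "length (result (drop_zeros (bsm_ops N) T)) \<le> length T"
proof -
  show "ticks (drop_zeros (bsm_ops N) T) \<le> length T * Suc (op_ticks N + b + 1) + 1"
    unfolding drop_zeros_def
  proof (rule loop_ticks_le, goal_cases)
    case (1 p U)
    obtain x a where p: "p = (x, a)" by fastforce
    then have "card (dom x) \<le> b" using keys_leD[OF assms] 1 by blast
    then show ?case
      using bsm_ops_cost(7)[of N a] by (simp add: p)
  qed
  show "cells (drop_zeros (bsm_ops N) T) \<le> length T * (b + 3) + 2"
    unfolding drop_zeros_def
  proof (rule loop_cells_le, goal_cases)
    case (1 p U)
    obtain x a where p: "p = (x, a)" by fastforce
    then have "card (dom x) \<le> b" using keys_leD[OF assms] 1 by blast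
    then show ?case
      using bsm_ops_cost(8)[of N a] by (simp add: p)
  qed
  have "length (result (drop_zeros (bsm_ops N) T)) \<le> length T + length ([] :: ('a, 'b, nat list) stored_relation)"
    unfolding drop_zeros_def
    by (rule loop_length_le) (auto simp: length_update_le)
  then show "length (result (drop_zeros (bsm_ops N) T)) \<le> length T" by simp
qed

lemma project_loop_cost:
  assumes "keys_le b T" "finite X" "card X \<le> b"
  shows "ticks (project_loop N X T) \<le> length T * Suc (op_ticks N + 3 * b + 3) + 1"
    and "cells (project_loop N X T) \<le> length T * (op_cells N + 2 * b + 1) + 2"
    and "length (result (project_loop N X T)) \<le> length T"
    and "keys_le b (result (project_loop N X T))"
proof -
  have dom: "card (dom x \<inter> X) \<le> b" for x :: "('a, 'b) tuple"
    using assms(2,3) card_mono[of X "dom x \<inter> X"] by simp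
  show "ticks (project_loop N X T) \<le> length T * Suc (op_ticks N + 3 * b + 3) + 1"
    unfolding project_loop_def
  proof (rule loop_ticks_le, goal_cases)
    case (1 p U)
    obtain x a where p: "p = (x, a)" by fastforce
    then have "card (dom x) \<le> b" using keys_leD[OF assms(1)] 1 by blast
    then show ?case
      using dom[of x] bsm_ops_cost(1)[of N "the (map_of U (x |` X))" a]
      by (cases "map_of U (x |` X)") (simp_all add: p)
  qed
  show "cells (project_loop N X T) \<le> length T * (op_cells N + 2 * b + 1) + 2"
    unfolding project_loop_def
  proof (rule loop_cells_le, goal_cases)
    case (1 p U)
    obtain x a where p: "p = (x, a)" by fastforce
    show ?case
      using dom[of x] assms(3) bsm_ops_cost(2)[of N "the (map_of U (x |` X))" a]
      by (cases "map_of U (x |` X)") (simp_all add: p)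
  qed
  have "length (result (project_loop N X T)) \<le> length T + length ([] :: ('a, 'b, nat list) stored_relation)"
    unfolding project_loop_def
    by (rule loop_length_le) (auto simp: length_update_le split: option.split)
  then show "length (result (project_loop N X T)) \<le> length T" by simp
  show "keys_le b (result (project_loop N X T))"
    unfolding project_loop_def
    by (rule loop_invariant) (auto simp: keys_le_Nil dom intro!: keys_le_update split: option.split)
qed

lemma rule1_prog_cost:
  assumes "keys_le b T" "finite X" "card X \<le> b"
  shows "ticks (rule1_prog (bsm_ops N) X T) \<le> length T * row_ticks N b + 3"
    and "cells (rule1_prog (bsm_ops N) X T) \<le> length T * row_cells N b + 6"
    and "length (result (rule1_prog (bsm_ops N) X T)) \<le> length T"
proof -
  let ?U = "result (project_loop N X T)"
  note P = project_loop_cost[OF assms, of N]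
  note D = drop_zeros_cost[OF P(4), of N]
  have "ticks (rule1_prog (bsm_ops N) X T) \<le>
      (length T * Suc (op_ticks N + 3 * b + 3) + 1) + (length T * Suc (op_ticks N + b + 1) + 1)"
    unfolding rule1_prog_eq bind_simps
    by (intro add_mono P(1) order_trans[OF D(1)] mult_le_mono1 P(3) order_refl)
  also have "\<dots> \<le> length T * row_ticks N b + 3"
    by (simp add: row_ticks_def algebra_simps)
  finally show "ticks (rule1_prog (bsm_ops N) X T) \<le> length T * row_ticks N b + 3" .
  have "cells (rule1_prog (bsm_ops N) X T) \<le>
      (length T * (op_cells N + 2 * b + 1) + 2) + (length T * (b + 3) + 2)"
    unfolding rule1_prog_eq bind_simps
    by (intro add_mono P(2) order_trans[OF D(2)] mult_le_mono1 P(3) order_refl)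
  also have "\<dots> \<le> length T * row_cells N b + 6"
    by (simp add: row_cells_def algebra_simps)
  finally show "cells (rule1_prog (bsm_ops N) X T) \<le> length T * row_cells N b + 6" .
  show "length (result (rule1_prog (bsm_ops N) X T)) \<le> length T"
    unfolding rule1_prog_eq bind_simps using P(3) D(3) by (rule order_trans[rotated])
qed

lemma fetch_cost:
  "ticks (fetch (bsm_ops N) T x) \<le> card (dom x) + 1 + op_ticks N"
  "cells (fetch (bsm_ops N) T x) \<le> op_cells N"
  using bsm_ops_cost(5,6)[of N] by (simp_all add: fetch_def split: option.split)

lemma rule2_prog_cost:
  assumes "keys_le b T1" "keys_le b T2"
  shows "ticks (rule2_prog (bsm_ops N) T1 T2) \<le> (length T1 + length T2) * row_ticks N b + 3"
    and "cells (rule2_prog (bsm_ops N) T1 T2) \<le> (length T1 + length T2) * row_cells N b + 6"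
    and "length (result (rule2_prog (bsm_ops N) T1 T2)) \<le> length T1 + length T2"
proof -
  let ?body1 = "\<lambda>(x, a) U. fetch (bsm_ops N) T2 x \<triangleright>
      (\<lambda>b. mult_op (bsm_ops N) a b \<triangleright> (\<lambda>c. store x c U))"
  let ?body2 = "\<lambda>(x, b) U. lookup T1 x \<triangleright> (\<lambda>e. case e of
        None \<Rightarrow> zero_op (bsm_ops N) \<triangleright> (\<lambda>a. mult_op (bsm_ops N) a b \<triangleright> (\<lambda>c. store x c U))
      | Some a \<Rightarrow> ret U)"
  define L1 where "L1 = loop ?body1 T1 []"
  define L2 where "L2 = loop ?body2 T2 (result L1)"
  have prog: "rule2_prog (bsm_ops N) T1 T2 = L1 \<triangleright> loop ?body2 T2 \<triangleright> drop_zeros (bsm_ops N)"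
    unfolding rule2_prog_def L1_def ..
  have t1: "ticks L1 \<le> length T1 * Suc (2 * op_ticks N + 2 * b + 2) + 1"
    unfolding L1_def
  proof (rule loop_ticks_le, goal_cases)
    case (1 p U)
    obtain x a where p: "p = (x, a)" by fastforce
    then have "card (dom x) \<le> b" using keys_leD[OF assms(1)] 1 by blast
    then show ?case
      using fetch_cost(1)[of N T2 x] bsm_ops_cost(3)[of N a "result (fetch (bsm_ops N) T2 x)"]
      by (simp add: p)
  qed
  have c1: "cells L1 \<le> length T1 * (2 * op_cells N + b + 1) + 2"
    unfolding L1_def
  proof (rule loop_cells_le, goal_cases)
    case (1 p U)
    obtain x a where p: "p = (x, a)" by fastforce
    then have "card (dom x) \<le> b" using keys_leD[OF assms(1)] 1 by blast
    then show ?case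
      using fetch_cost(2)[of N T2 x] bsm_ops_cost(4)[of N a "result (fetch (bsm_ops N) T2 x)"]
      by (simp add: p)
  qed
  have t2: "ticks L2 \<le> length T2 * Suc (2 * op_ticks N + 2 * b + 2) + 1"
    unfolding L2_def
  proof (rule loop_ticks_le, goal_cases)
    case (1 p U)
    obtain x a where p: "p = (x, a)" by fastforce
    then have "card (dom x) \<le> b" using keys_leD[OF assms(2)] 1 by blast
    then show ?case
      using bsm_ops_cost(5)[of N] bsm_ops_cost(3)[of N "result (zero_op (bsm_ops N))" a]
      by (cases "map_of T1 x") (simp_all add: p)
  qed
  have c2: "cells L2 \<le> length T2 * (2 * op_cells N + b + 1) + 2"
    unfolding L2_def
  proof (rule loop_cells_le, goal_cases)
    case (1 p U)
    obtain x a where p: "p = (x, a)" by fastforce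
    then have "card (dom x) \<le> b" using keys_leD[OF assms(2)] 1 by blast
    then show ?case
      using bsm_ops_cost(6)[of N] bsm_ops_cost(4)[of N "result (zero_op (bsm_ops N))" a]
      by (cases "map_of T1 x") (simp_all add: p)
  qed
  have "length (result L1) \<le> length T1 + length ([] :: ('a, 'b, nat list) stored_relation)"
    unfolding L1_def by (rule loop_length_le) (auto simp: length_update_le)
  moreover have "length (result L2) \<le> length T2 + length (result L1)"
    unfolding L2_def by (rule loop_length_le) (auto simp: length_update_le split: option.split)
  ultimately have len: "length (result L2) \<le> length T1 + length T2" by simp
  have "keys_le b (result L1)"
    unfolding L1_def
    by (rule loop_invariant) (auto simp: keys_le_Nil intro!: keys_le_update dest: keys_leD[OF assms(1)])
  then have keys: "keys_le b (result L2)"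
    unfolding L2_def
    by (rule loop_invariant)
      (auto intro!: keys_le_update dest: keys_leD[OF assms(2)] split: option.split)
  note D = drop_zeros_cost[OF keys, of N]
  have "ticks (rule2_prog (bsm_ops N) T1 T2) \<le>
      (length T1 * Suc (2 * op_ticks N + 2 * b + 2) + 1) +
      (length T2 * Suc (2 * op_ticks N + 2 * b + 2) + 1) +
      ((length T1 + length T2) * Suc (op_ticks N + b + 1) + 1)"
    unfolding prog bind_simps L2_def[symmetric]
    by (intro add_mono t1 t2 order_trans[OF D(1)] mult_le_mono1 len order_refl)
  also have "\<dots> \<le> (length T1 + length T2) * row_ticks N b + 3"
    by (simp add: row_ticks_def algebra_simps)
  finally show "ticks (rule2_prog (bsm_ops N) T1 T2) \<le> (length T1 + length T2) * row_ticks N b + 3" .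
  have "cells (rule2_prog (bsm_ops N) T1 T2) \<le>
      (length T1 * (2 * op_cells N + b + 1) + 2) + (length T2 * (2 * op_cells N + b + 1) + 2) +
      ((length T1 + length T2) * (b + 3) + 2)"
    unfolding prog bind_simps L2_def[symmetric]
    by (intro add_mono c1 c2 order_trans[OF D(2)] mult_le_mono1 len order_refl)
  also have "\<dots> \<le> (length T1 + length T2) * row_cells N b + 6"
    by (simp add: row_cells_def algebra_simps)
  finally show "cells (rule2_prog (bsm_ops N) T1 T2) \<le> (length T1 + length T2) * row_cells N b + 6" .
  show "length (result (rule2_prog (bsm_ops N) T1 T2)) \<le> length T1 + length T2"
    unfolding prog bind_simps L2_def[symmetric] using D(3) len by (rule order_trans)
qed

section \<open>Query scans and the number of stored facts\<close>

lemma card_atom_le: "sjf_bcq Q \<Longrightarrow> (R, X) \<in> Q \<Longrightarrow> card X \<le> card (vars Q)"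
  by (intro card_mono finite_vars) (auto simp: vars_def)

lemma sum_card_atoms_le:
  assumes "sjf_bcq Q"
  shows "(\<Sum>(R, X)\<in>Q. card X + 1) \<le> card Q * (card (vars Q) + 1)"
  using sum_bounded_above[of Q "\<lambda>(R, X). card X + 1" "card (vars Q) + 1"] card_atom_le[OF assms]
  by auto

text \<open>Depends only on upper bounds for the numbers of variables and atoms, so that the values
  for the initial query bound every later scan.\<close>

definition scan_bound :: "nat \<Rightarrow> nat \<Rightarrow> nat" where
  "scan_bound v a = (v + a + 1) * (a * (v + 1))"

lemma scan_cost_le:
  assumes "sjf_bcq Q" "card (vars Q) \<le> v" "card Q \<le> a"
  shows "scan_cost Q \<le> scan_bound v a"
proof -
  have "scan_cost Q \<le> (card (vars Q) + card Q + 1) * (card Q * (card (vars Q) + 1))"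
    unfolding scan_cost_def by (intro mult_le_mono2 sum_card_atoms_le assms)
  also have "\<dots> \<le> scan_bound v a"
    unfolding scan_bound_def using assms by (intro mult_le_mono add_mono order_refl)
  finally show ?thesis .
qed

definition storage :: "('r, 'v) query \<Rightarrow> ('r, 'v, 'd, 's) stored_db \<Rightarrow> nat" where
  "storage Q S = (\<Sum>(R, X)\<in>Q. length (S R))"

lemma storage_insert:
  assumes "finite Q" "R \<notin> fst ` Q"
  shows "storage (insert (R, X) Q) S = length (S R) + storage Q S"
proof -
  have "(R, X) \<notin> Q" using assms(2) by force
  then show ?thesis using assms(1) by (simp add: storage_def)
qed

lemma storage_fun_upd: "R \<notin> fst ` Q \<Longrightarrow> storage Q (S(R := T)) = storage Q S"
  unfolding storage_def by (rule sum.cong) force+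

lemma stores_keys_le:
  assumes "stores N Q S A" "sjf_bcq Q" "(R, X) \<in> Q" "card (vars Q) \<le> b"
  shows "keys_le b (S R)"
proof -
  have "represents N (S R) {x. dom x = X \<and> A R x \<noteq> \<zero>\<^bsub>bsm\<^esub>} (A R)"
    using assms(1,3) unfolding stores_iff by blast
  then have "fst ` set (S R) = {x. dom x = X \<and> A R x \<noteq> \<zero>\<^bsub>bsm\<^esub>}"
    by (simp only: represents_def)
  then show ?thesis
    using card_atom_le[OF assms(2,3)] assms(4) unfolding keys_le_def by auto
qed

lemma stores_insert:
  "stores N (insert (R, X) Q) S A \<longleftrightarrow>
     represents N (S R) {x. dom x = X \<and> A R x \<noteq> \<zero>\<^bsub>bsm\<^esub>} (A R) \<and> stores N Q S A"
  unfolding stores_iff by simp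

lemma stores_fun_upd:
  assumes "R \<notin> fst ` Q" "stores N Q S A"
  shows "stores N Q (S(R := T)) (A(R := B))"
  unfolding stores_iff
proof (rule ballI, clarify)
  fix S' X assume SX: "(S', X) \<in> Q"
  then have "S' \<noteq> R" using not_in_fst_imageD[OF assms(1)] by blast
  moreover have "represents N (S S') {x. dom x = X \<and> A S' x \<noteq> \<zero>\<^bsub>bsm\<^esub>} (A S')"
    using assms(2) SX unfolding stores_iff by blast
  ultimately show "represents N ((S(R := T)) S') {x. dom x = X \<and> (A(R := B)) S' x \<noteq> \<zero>\<^bsub>bsm\<^esub>} ((A(R := B)) S')"
    by simp
qed

text \<open>Simulation and cost of one step together. The cost is charged to the storage of the
  whole query instead of to \<open>S R\<close>, since only the total is known not to grow.\<close>

lemma exec_elim_var: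
  assumes adm: "admissible N E Q A" and elim: "elim_var Q R X Y R' Q'" and st: "stores N Q S A"
    and b: "card (vars Q) \<le> b" and m: "m = rule1_prog (bsm_ops N) (X - {Y}) (S R)"
  shows "hea_step bsm (Q, A) (Q', A(R' := elim_var_annot A R Y))"
    and "stores N Q' (S(R' := result m)) (A(R' := elim_var_annot A R Y))"
    and "storage Q' (S(R' := result m)) \<le> storage Q S"
    and "ticks m \<le> storage Q S * row_ticks N b + 3" "cells m \<le> storage Q S * row_cells N b + 6"
    and "card (X - {Y}) \<le> b"
proof -
  have sjf: "sjf_bcq Q" using adm by (auto simp: admissible_def)
  obtain Q0 where Q0: "Q = insert (R, X) Q0" "Q' = insert (R', X - {Y}) Q0" "finite Q0"
    "R \<notin> fst ` Q0" "R' \<notin> fst ` Q0" "Y \<in> X" "finite X"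
    by (rule elim_varE[OF elim sjf]) (rule that)
  have RX: "(R, X) \<in> Q" unfolding Q0(1) by simp
  have annot: "elim_var_annot A R Y = (\<lambda>x'. finsum bsm (\<lambda>y. A R (x'(Y \<mapsto> y)))
      {y. A R (x'(Y \<mapsto> y)) \<noteq> \<zero>\<^bsub>bsm\<^esub>})"
    by (rule ext) (rule elim_var_annot_def)
  show "hea_step bsm (Q, A) (Q', A(R' := elim_var_annot A R Y))"
    unfolding annot by (rule hea_step.rule1[OF elim])
  have st0: "represents N (S R) {x. dom x = X \<and> A R x \<noteq> \<zero>\<^bsub>bsm\<^esub>} (A R)" "stores N Q0 S A"
    using st unfolding Q0(1) stores_insert by simp_all
  show "stores N Q' (S(R' := result m)) (A(R' := elim_var_annot A R Y))"
    unfolding Q0(2) stores_insert fun_upd_same m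
    using represents_rule1[OF adm RX Q0(6) st0(1)] stores_fun_upd[OF Q0(5) st0(2)] by blast
  have "card (X - {Y}) \<le> card X" by (rule card_Diff1_le)
  then show card: "card (X - {Y}) \<le> b" using card_atom_le[OF sjf RX] b by simp
  have fin: "finite (X - {Y})" using Q0(7) by simp
  note cost = rule1_prog_cost[OF stores_keys_le[OF st sjf RX b] fin card, of N, folded m]
  have sto: "storage Q S = length (S R) + storage Q0 S"
    unfolding Q0(1) by (rule storage_insert[OF Q0(3,4)])
  show "storage Q' (S(R' := result m)) \<le> storage Q S"
    unfolding Q0(2) storage_insert[OF Q0(3,5)] storage_fun_upd[OF Q0(5)] sto fun_upd_same
    using cost(3) by simp
  have "length (S R) * row_ticks N b \<le> storage Q S * row_ticks N b"
    "length (S R) * row_cells N b \<le> storage Q S * row_cells N b"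
    unfolding sto by (rule mult_le_mono1, simp)+
  then show "ticks m \<le> storage Q S * row_ticks N b + 3" "cells m \<le> storage Q S * row_cells N b + 6"
    using cost(1,2) by linarith+
qed

lemma exec_elim_atom:
  assumes adm: "admissible N E Q A" and elim: "elim_atom Q R1 R2 X R' Q'" and st: "stores N Q S A"
    and b: "card (vars Q) \<le> b" and m: "m = rule2_prog (bsm_ops N) (S R1) (S R2)"
  shows "hea_step bsm (Q, A) (Q', A(R' := elim_atom_annot A R1 R2))"
    and "stores N Q' (S(R' := result m)) (A(R' := elim_atom_annot A R1 R2))"
    and "storage Q' (S(R' := result m)) \<le> storage Q S"
    and "ticks m \<le> storage Q S * row_ticks N b + 3" "cells m \<le> storage Q S * row_cells N b + 6"
    and "card X \<le> b"
proof -
  have sjf: "sjf_bcq Q" using adm by (auto simp: admissible_def)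
  obtain Q0 where Q0: "Q = insert (R1, X) (insert (R2, X) Q0)" "Q' = insert (R', X) Q0" "finite Q0"
    "R1 \<notin> fst ` Q0" "R2 \<notin> fst ` Q0" "R' \<notin> fst ` Q0" "R1 \<noteq> R2"
    by (rule elim_atomE[OF elim sjf]) (rule that)
  have RX: "(R1, X) \<in> Q" "(R2, X) \<in> Q" unfolding Q0(1) by simp_all
  have annot: "elim_atom_annot A R1 R2 = (\<lambda>x. A R1 x \<otimes>\<^bsub>bsm\<^esub> A R2 x)"
    by (rule ext) (rule elim_atom_annot_def)
  show "hea_step bsm (Q, A) (Q', A(R' := elim_atom_annot A R1 R2))"
    unfolding annot by (rule hea_step.rule2[OF elim])
  have st0: "represents N (S R1) {x. dom x = X \<and> A R1 x \<noteq> \<zero>\<^bsub>bsm\<^esub>} (A R1)"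
    "represents N (S R2) {x. dom x = X \<and> A R2 x \<noteq> \<zero>\<^bsub>bsm\<^esub>} (A R2)" "stores N Q0 S A"
    using st unfolding Q0(1) stores_insert by simp_all
  show "stores N Q' (S(R' := result m)) (A(R' := elim_atom_annot A R1 R2))"
    unfolding Q0(2) stores_insert fun_upd_same m
    using represents_rule2[OF adm elim st0(1,2)] stores_fun_upd[OF Q0(6) st0(3)] by blast
  show "card X \<le> b" using card_atom_le[OF sjf RX(1)] b by simp
  note cost = rule2_prog_cost[OF stores_keys_le[OF st sjf RX(1) b] stores_keys_le[OF st sjf RX(2) b],
      of N, folded m]
  have "R1 \<notin> fst ` insert (R2, X) Q0" using Q0(4,7) by simp
  then have sto: "storage Q S = length (S R1) + (length (S R2) + storage Q0 S)"
    unfolding Q0(1) using Q0(3,5) by (simp add: storage_insert)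
  show "storage Q' (S(R' := result m)) \<le> storage Q S"
    unfolding Q0(2) storage_insert[OF Q0(3,6)] storage_fun_upd[OF Q0(6)] sto fun_upd_same
    using cost(3) by simp
  have "(length (S R1) + length (S R2)) * row_ticks N b \<le> storage Q S * row_ticks N b"
    "(length (S R1) + length (S R2)) * row_cells N b \<le> storage Q S * row_cells N b"
    unfolding sto by (rule mult_le_mono1, simp)+
  then show "ticks m \<le> storage Q S * row_ticks N b + 3" "cells m \<le> storage Q S * row_cells N b + 6"
    using cost(1,2) by linarith+
qed

section \<open>Executions\<close>

text \<open>One rule on at most \<open>M\<close> rows, the additive 3 from its loops, and the scan
  of the resulting query.\<close>

definition step_ticks :: "nat \<Rightarrow> nat \<Rightarrow> nat \<Rightarrow> nat \<Rightarrow> nat" where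
  "step_ticks N M v a = M * row_ticks N v + 3 + scan_bound v a"

text \<open>The 7 consists of 6 cells for the loops of a rule and one for the new relation symbol;
  \<open>v\<close> bounds the variables of the new atom.\<close>

definition step_cells :: "nat \<Rightarrow> nat \<Rightarrow> nat \<Rightarrow> nat" where
  "step_cells N M v = M * row_cells N v + 7 + v"

text \<open>An amortized bound with \<open>query_size\<close> as potential: each step lowers it by
  one and thereby releases \<open>step_ticks\<close> and \<open>step_cells\<close>, which pay for
  the step. In this form the induction needs no count of past steps.\<close>

lemma hea_exec_invariant:
  fixes Q0 :: "('r, 'v) query"
  assumes "hea_exec (bsm_ops N) Q0 S0 Q S t s"
    and adm: "admissible N E Q0 A0" and st: "stores N Q0 S0 A0"
    and v: "v = card (vars Q0)" and a: "a = card Q0" and M: "M = storage Q0 S0"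
  shows "\<exists>A. (hea_step bsm)\<^sup>*\<^sup>* (Q0, A0) (Q, A) \<and> stores N Q S A \<and> storage Q S \<le> M \<and>
     card (vars Q) \<le> v \<and> card Q \<le> a \<and>
     t + query_size Q * step_ticks N M v a \<le> scan_bound v a + query_size Q0 * step_ticks N M v a \<and>
     s + query_size Q * step_cells N M v \<le>
       input_cells (bsm_ops N) Q0 S0 + query_size Q0 * step_cells N M v"
  using assms(1)
proof (induction rule: hea_exec.induct)
  case start
  have "sjf_bcq Q0" using adm by (auto simp: admissible_def)
  then have "scan_cost Q0 \<le> scan_bound v a" by (intro scan_cost_le) (simp_all add: v a)
  then show ?case
    using st by (intro exI[of _ A0]) (simp add: v a M)
next
  case (exec1 Q S t s R X Y R' Q' m)
  from exec1.IH obtain A where A: "(hea_step bsm)\<^sup>*\<^sup>* (Q0, A0) (Q, A)" "stores N Q S A" "storage Q S \<le> M"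
     "card (vars Q) \<le> v" "card Q \<le> a"
     "t + query_size Q * step_ticks N M v a \<le> scan_bound v a + query_size Q0 * step_ticks N M v a"
     "s + query_size Q * step_cells N M v \<le>
       input_cells (bsm_ops N) Q0 S0 + query_size Q0 * step_cells N M v"
    by (elim exE conjE)
  have adm': "admissible N E Q A" by (rule hea_steps_invariant(1)[OF A(1) adm])
  then have sjf: "sjf_bcq Q" by (auto simp: admissible_def)
  note step = exec_elim_var[OF adm' exec1.hyps(2) A(2,4) exec1.hyps(3)]
  note elim = vars_elim_var[OF exec1.hyps(2) sjf]
  have v': "card (vars Q') \<le> v"
    using A(4) card_mono[OF finite_vars[OF sjf], of "vars Q'"] by (simp add: elim(1) subset_insertI)
  have a': "card Q' \<le> a" using A(5) elim(3) by simp
  have "scan_cost Q' \<le> scan_bound v a" by (rule scan_cost_le[OF elim(4) v' a'])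
  moreover have "storage Q S * row_ticks N v \<le> M * row_ticks N v"
      "storage Q S * row_cells N v \<le> M * row_cells N v"
    using A(3) by (rule mult_le_mono1)+
  ultimately have "ticks m + scan_cost Q' \<le> step_ticks N M v a"
      "cells m + card (X - {Y}) + 1 \<le> step_cells N M v"
    using step(4-6) unfolding step_ticks_def step_cells_def by linarith+
  moreover have "query_size Q = Suc (query_size Q')"
    by (rule query_size_elim_var[OF exec1.hyps(2) sjf])
  ultimately have "t + ticks m + scan_cost Q' + query_size Q' * step_ticks N M v a \<le>
      scan_bound v a + query_size Q0 * step_ticks N M v a"
      "s + cells m + card (X - {Y}) + 1 + query_size Q' * step_cells N M v \<le>
       input_cells (bsm_ops N) Q0 S0 + query_size Q0 * step_cells N M v"
    using A(6,7) by simp_all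
  moreover have "(hea_step bsm)\<^sup>*\<^sup>* (Q0, A0) (Q', A(R' := elim_var_annot A R Y))"
    using A(1) step(1) by (rule rtranclp.rtrancl_into_rtrancl)
  moreover have "storage Q' (S(R' := result m)) \<le> M" using step(3) A(3) by (rule order_trans)
  ultimately show ?case using step(2) v' a' by blast
next
  case (exec2 Q S t s R1 R2 X R' Q' m)
  from exec2.IH obtain A where A: "(hea_step bsm)\<^sup>*\<^sup>* (Q0, A0) (Q, A)" "stores N Q S A" "storage Q S \<le> M"
     "card (vars Q) \<le> v" "card Q \<le> a"
     "t + query_size Q * step_ticks N M v a \<le> scan_bound v a + query_size Q0 * step_ticks N M v a"
     "s + query_size Q * step_cells N M v \<le>
       input_cells (bsm_ops N) Q0 S0 + query_size Q0 * step_cells N M v"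
    by (elim exE conjE)
  have adm': "admissible N E Q A" by (rule hea_steps_invariant(1)[OF A(1) adm])
  then have sjf: "sjf_bcq Q" by (auto simp: admissible_def)
  note step = exec_elim_atom[OF adm' exec2.hyps(2) A(2,4) exec2.hyps(3)]
  note elim = vars_elim_atom[OF exec2.hyps(2) sjf]
  have v': "card (vars Q') \<le> v" and a': "card Q' \<le> a" using A(4,5) elim(1,2) by simp_all
  have "scan_cost Q' \<le> scan_bound v a" by (rule scan_cost_le[OF elim(3) v' a'])
  moreover have "storage Q S * row_ticks N v \<le> M * row_ticks N v"
      "storage Q S * row_cells N v \<le> M * row_cells N v"
    using A(3) by (rule mult_le_mono1)+
  ultimately have "ticks m + scan_cost Q' \<le> step_ticks N M v a"
      "cells m + card X + 1 \<le> step_cells N M v"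
    using step(4-6) unfolding step_ticks_def step_cells_def by linarith+
  moreover have "query_size Q = Suc (query_size Q')"
    by (rule query_size_elim_atom[OF exec2.hyps(2) sjf])
  ultimately have "t + ticks m + scan_cost Q' + query_size Q' * step_ticks N M v a \<le>
      scan_bound v a + query_size Q0 * step_ticks N M v a"
      "s + cells m + card X + 1 + query_size Q' * step_cells N M v \<le>
       input_cells (bsm_ops N) Q0 S0 + query_size Q0 * step_cells N M v"
    using A(6,7) by simp_all
  moreover have "(hea_step bsm)\<^sup>*\<^sup>* (Q0, A0) (Q', A(R' := elim_atom_annot A R1 R2))"
    using A(1) step(1) by (rule rtranclp.rtrancl_into_rtrancl)
  moreover have "storage Q' (S(R' := result m)) \<le> M" using step(3) A(3) by (rule order_trans)
  ultimately show ?case using step(2) v' a' by blast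
qed

text \<open>A stored row takes \<open>card X\<close> cells for the key, one for the reference and
  \<open>N + 1\<close> for the vector, hence \<open>card X + 2 + N\<close>.\<close>

lemma input_cells_le:
  assumes "stores N Q S A" "sjf_bcq Q"
  shows "input_cells (bsm_ops N) Q S \<le>
    16 + card Q * (card (vars Q) + 1) + storage Q S * (card (vars Q) + 2 + N)"
proof -
  have row: "(\<Sum>(x, a)\<leftarrow>S R. card X + 1 + length a) \<le> length (S R) * (card (vars Q) + 2 + N)"
    if RX: "(R, X) \<in> Q" for R X
  proof -
    have "represents N (S R) {x. dom x = X \<and> A R x \<noteq> \<zero>\<^bsub>bsm\<^esub>} (A R)"
      using assms(1) RX unfolding stores_iff by blast
    then have "length a = Suc N" if "(x, a) \<in> set (S R)" for x a
      using that unfolding represents_def encodes_def by blast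
    then have "(\<Sum>(x, a)\<leftarrow>S R. card X + 1 + length a) = (\<Sum>p\<leftarrow>S R. card X + 2 + N)"
      by (intro arg_cong[where f = sum_list] map_cong) auto
    also have "\<dots> = length (S R) * (card X + 2 + N)" by (simp add: sum_list_triv)
    also have "\<dots> \<le> length (S R) * (card (vars Q) + 2 + N)"
      using card_atom_le[OF assms(2) RX] by (intro mult_le_mono2) simp
    finally show ?thesis .
  qed
  have "(\<Sum>(R, X)\<in>Q. \<Sum>(x, a)\<leftarrow>S R. card X + 1 + length a) \<le>
      (\<Sum>(R, X)\<in>Q. length (S R) * (card (vars Q) + 2 + N))"
    using row by (intro sum_mono) auto
  also have "\<dots> = storage Q S * (card (vars Q) + 2 + N)"
    unfolding storage_def sum_distrib_right by (simp only: case_prod_unfold)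
  finally show ?thesis
    using sum_card_atoms_le[OF assms(2)] unfolding input_cells_def by (simp add: bsm_ops_def)
qed

text \<open>The terms \<open>1 + op_ticks N\<close> and \<open>op_cells N\<close> pay for reading
  off the result: one lookup of the empty tuple, and a new zero vector if nothing is stored there
  because the result is zero.\<close>

lemma hea_runs_within_bsm:
  fixes Q :: "('r::infinite, 'v) query"
  assumes adm: "admissible N E Q A" and st: "stores N Q S A"
    and q: "\<And>i m. attains E Q A i m \<longleftrightarrow> m \<le> q i"
    and v: "v = card (vars Q)" and a: "a = card Q" and M: "M = storage Q S"
  shows "hea_runs_within N Q S A q
    (scan_bound v a + (v + a) * step_ticks N M v a + 1 + op_ticks N)
    (16 + a * (v + 1) + M * (v + 2 + N) + (v + a) * step_cells N M v + op_cells N)"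
  unfolding hea_runs_within_def
proof (intro allI impI)
  fix Q' S' t s
  assume "hea_exec (bsm_ops N) Q S Q' S' t s"
  from hea_exec_invariant[OF this adm st v a M]
  obtain A' where A': "(hea_step bsm)\<^sup>*\<^sup>* (Q, A) (Q', A')" "stores N Q' S' A'"
     and t: "t + query_size Q' * step_ticks N M v a \<le> scan_bound v a + query_size Q * step_ticks N M v a"
     and s: "s + query_size Q' * step_cells N M v \<le>
       input_cells (bsm_ops N) Q S + query_size Q * step_cells N M v"
    by (elim exE conjE)
  have sjf: "sjf_bcq Q" using adm by (auto simp: admissible_def)
  have size: "query_size Q = v + a" by (simp add: query_size_def v a)
  have t': "t \<le> scan_bound v a + (v + a) * step_ticks N M v a"
    using t unfolding size by simp
  have s': "s \<le> 16 + a * (v + 1) + M * (v + 2 + N) + (v + a) * step_cells N M v"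
    using s input_cells_le[OF st sjf, folded v a M] unfolding size by linarith
  have final: "\<exists>R. Q' = {(R, {})} \<and>
      (let m = fetch (bsm_ops N) (S' R) Map.empty in vec_of (result m) = q \<and>
        t + ticks m \<le> scan_bound v a + (v + a) * step_ticks N M v a + 1 + op_ticks N \<and>
        s + cells m \<le> 16 + a * (v + 1) + M * (v + 2 + N) + (v + a) * step_cells N M v + op_cells N)"
    if terminal: "no_rule_applies Q'"
  proof -
    obtain R where R: "Q' = {(R, {})}" "A' R Map.empty = q"
      using hea_outputs_bsm(2)[OF adm q A'(1) terminal] by blast
    have "represents N (S' R) {x. dom x = {} \<and> A' R x \<noteq> \<zero>\<^bsub>bsm\<^esub>} (A' R)"
      using A'(2) unfolding R(1) stores_iff by blast
    then have "encodes N (result (fetch (bsm_ops N) (S' R) Map.empty)) (A' R Map.empty)"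
      by (rule result_fetch) simp
    then have "vec_of (result (fetch (bsm_ops N) (S' R) Map.empty)) = q"
      unfolding R(2) encodes_def by (rule conjunct2)
    then show ?thesis
      using R(1) t' s' fetch_cost[of N "S' R" Map.empty] by (intro exI[of _ R]) (simp add: Let_def)
  qed
  show "t \<le> scan_bound v a + (v + a) * step_ticks N M v a + 1 + op_ticks N \<and>
     s \<le> 16 + a * (v + 1) + M * (v + 2 + N) + (v + a) * step_cells N M v + op_cells N \<and>
     (\<exists>A'. (hea_step bsm)\<^sup>*\<^sup>* (Q, A) (Q', A') \<and> stores N Q' S' A') \<and>
     (no_rule_applies Q' \<longrightarrow> (\<exists>R. Q' = {(R, {})} \<and>
      (let m = fetch (bsm_ops N) (S' R) Map.empty in vec_of (result m) = q \<and>
        t + ticks m \<le> scan_bound v a + (v + a) * step_ticks N M v a + 1 + op_ticks N \<and>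
        s + cells m \<le> 16 + a * (v + 1) + M * (v + 2 + N) + (v + a) * step_cells N M v + op_cells N)))"
    using t' s' A' final by auto
qed

section \<open>From explicit bounds to the asymptotic form\<close>

lemma hea_runs_within_mono:
  "hea_runs_within N Q S A q tm sp \<Longrightarrow> tm \<le> tm' \<Longrightarrow> sp \<le> sp' \<Longrightarrow> hea_runs_within N Q S A q tm' sp'"
  unfolding hea_runs_within_def Let_def by (meson order_trans)

text \<open>Both \<open>\<one>\<close> and \<open>star\<close> are nonzero, so exactly the facts of
  the union of \<open>D\<close> and \<open>Dr\<close> are stored, each once.\<close>

lemma storage_psi:
  assumes "sjf_bcq Q" "bsm_instance Q (D, Dr, \<theta>)" "stores N Q S (psi D Dr)"
  shows "storage Q S \<le> card D + card Dr"
proof -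
  let ?E = "active_domain (D \<union> Dr)"
  note fin = finite_active_domain[OF assms(1,2) refl]
  note act = instance_active[OF assms(1,2) refl]
  have row: "length (S R) = (\<Sum>x\<in>tuples ?E X. of_bool ((R, x) \<in> D \<union> Dr))" if RX: "(R, X) \<in> Q" for R X
  proof -
    have "represents N (S R) {x. dom x = X \<and> psi D Dr R x \<noteq> \<zero>\<^bsub>bsm\<^esub>} (psi D Dr R)"
      using assms(3) RX unfolding stores_iff by blast
    then have "length (S R) = card {x. dom x = X \<and> psi D Dr R x \<noteq> \<zero>\<^bsub>bsm\<^esub>}"
      by (rule represents_length)
    also have "{x. dom x = X \<and> psi D Dr R x \<noteq> \<zero>\<^bsub>bsm\<^esub>} = tuples ?E X \<inter> {x. (R, x) \<in> D \<union> Dr}"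
      using act by (auto simp: psi_def star_def bsm_def tuples_def active_facts_def fun_eq_iff)
    also have "card \<dots> = (\<Sum>x\<in>tuples ?E X. of_bool ((R, x) \<in> D \<union> Dr))"
      using finite_tuples[OF fin] RX assms(1) by (subst sum_of_bool_eq) (auto simp: sjf_bcq_def)
    finally show ?thesis .
  qed
  have "storage Q S = alloc_cost ?E Q (\<lambda>R x. of_bool ((R, x) \<in> D \<union> Dr))"
    unfolding storage_def alloc_cost_def using row by (intro sum.cong) auto
  also have "\<dots> = card (D \<union> Dr)"
    by (rule sum_of_bool_facts[OF fin assms(1) act])
  also have "\<dots> \<le> card D + card Dr" by (rule card_Un_le)
  finally show ?thesis .
qed

text \<open>As \<open>m\<close> and \<open>n\<close> are at least 1, every lower-order term is
  absorbed by \<open>m\<close> times the square of \<open>n\<close>. From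
  \<open>Suc N \<le> 2 * n\<close> an operation takes at most 40 times the square of
  \<open>n\<close>; then 128 is \<open>3 * 40 + 8\<close>, 131 adds the 3 of
  \<open>step_ticks\<close>, and 41 is 40 plus the final lookup.\<close>

lemma time_bound:
  fixes N M m n v a :: nat
  assumes "M \<le> m" "1 \<le> m" "N \<le> n" "1 \<le> n"
  shows "scan_bound v a + (v + a) * step_ticks N M v a + 1 + op_ticks N \<le>
    (scan_bound v a + (v + a) * (131 + 4 * v + scan_bound v a) + 41) * (m * n\<^sup>2)"
proof -
  let ?w = "m * n\<^sup>2" and ?b = "scan_bound v a"
  have n2: "1 \<le> n\<^sup>2" "1 \<le> ?w" "n\<^sup>2 \<le> ?w" using assms by simp_all
  have "(Suc N)\<^sup>2 \<le> (2 * n)\<^sup>2" using assms by (intro power_mono) auto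
  then have op: "op_ticks N \<le> 40 * n\<^sup>2" by (simp add: op_ticks_def power_mult_distrib)
  have "row_ticks N v \<le> 120 * n\<^sup>2 + (4 * v + 8) * 1"
    using op by (simp add: row_ticks_def)
  also have "\<dots> \<le> 120 * n\<^sup>2 + (4 * v + 8) * n\<^sup>2"
    using n2(1) by (intro add_left_mono mult_le_mono2)
  finally have row: "row_ticks N v \<le> (128 + 4 * v) * n\<^sup>2" by (simp add: algebra_simps)
  have "step_ticks N M v a \<le> m * ((128 + 4 * v) * n\<^sup>2) + (3 + ?b) * 1"
    using mult_le_mono[OF assms(1) row] by (simp add: step_ticks_def)
  also have "\<dots> \<le> m * ((128 + 4 * v) * n\<^sup>2) + (3 + ?b) * ?w"
    using n2(2) by (intro add_left_mono mult_le_mono2)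
  also have "\<dots> = (131 + 4 * v + ?b) * ?w" by (simp add: algebra_simps)
  finally have step: "step_ticks N M v a \<le> (131 + 4 * v + ?b) * ?w" .
  have b: "?b \<le> ?b * ?w" using mult_le_mono2[OF n2(2), of ?b] by simp
  have "?b + (v + a) * step_ticks N M v a + 1 + op_ticks N \<le>
      ?b * ?w + (v + a) * ((131 + 4 * v + ?b) * ?w) + ?w + 40 * ?w"
    by (rule add_mono[OF add_mono[OF add_mono[OF b mult_le_mono2[OF step]] n2(2)]
        order_trans[OF op mult_le_mono2[OF n2(3)]]])
  then show ?thesis by (simp add: algebra_simps)
qed

text \<open>As for time, with \<open>Suc N \<le> 2 * n\<close> giving at most \<open>8 * n\<close>
  cells per operation; then 24 is \<open>2 * 8 + 8\<close>, and 31 adds the 7 of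
  \<open>step_cells\<close>. The summand \<open>v + 3\<close> covers the vectors and keys of the
  input.\<close>

lemma space_bound:
  fixes N M m n v a :: nat
  assumes "M \<le> m" "1 \<le> m" "N \<le> n" "1 \<le> n"
  shows "16 + a * (v + 1) + M * (v + 2 + N) + (v + a) * step_cells N M v + op_cells N \<le>
    (16 + a * (v + 1) + (v + 3) + (v + a) * (31 + 4 * v) + 8) * (m * n)"
proof -
  let ?w = "m * n"
  have w: "1 \<le> ?w" "n \<le> ?w" using assms by simp_all
  have op: "op_cells N \<le> 8 * n" using assms by (simp add: op_cells_def)
  have "row_cells N v \<le> 16 * n + (3 * v + 8) * 1" using op by (simp add: row_cells_def)
  also have "\<dots> \<le> 16 * n + (3 * v + 8) * n"
    using assms(4) by (intro add_left_mono mult_le_mono2)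
  finally have row: "row_cells N v \<le> (24 + 3 * v) * n" by (simp add: algebra_simps)
  have "step_cells N M v \<le> m * ((24 + 3 * v) * n) + (7 + v) * 1"
    using mult_le_mono[OF assms(1) row] by (simp add: step_cells_def)
  also have "\<dots> \<le> m * ((24 + 3 * v) * n) + (7 + v) * ?w"
    using w(1) by (intro add_left_mono mult_le_mono2)
  also have "\<dots> = (31 + 4 * v) * ?w" by (simp add: algebra_simps)
  finally have step: "step_cells N M v \<le> (31 + 4 * v) * ?w" .
  have "v + 2 + N \<le> (v + 2) * 1 + n" using assms(3) by simp
  also have "\<dots> \<le> (v + 2) * n + n" using assms(4) by (intro add_right_mono mult_le_mono2)
  finally have "v + 2 + N \<le> (v + 3) * n" by (simp add: algebra_simps)
  then have input: "M * (v + 2 + N) \<le> m * ((v + 3) * n)" by (rule mult_le_mono[OF assms(1)])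
  have const: "16 + a * (v + 1) \<le> (16 + a * (v + 1)) * ?w"
    using mult_le_mono2[OF w(1), of "16 + a * (v + 1)"] by (simp only: mult_1_right)
  have "16 + a * (v + 1) + M * (v + 2 + N) + (v + a) * step_cells N M v + op_cells N \<le>
      (16 + a * (v + 1)) * ?w + m * ((v + 3) * n) + (v + a) * ((31 + 4 * v) * ?w) + 8 * ?w"
    by (rule add_mono[OF add_mono[OF add_mono[OF const input] mult_le_mono2[OF step]]
        order_trans[OF op mult_le_mono2[OF w(2)]]])
  then show ?thesis by (simp add: algebra_simps)
qed

theorem theorem5p11:
  fixes Q :: "('r::infinite, 'v) query"
  assumes "sjf_bcq Q" and "hierarchical Q"
  shows "\<exists>C::nat. \<forall>(D :: ('r, 'v, 'd::{countable, infinite}) fact set) Dr \<theta>.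
    bsm_instance Q (D, Dr, \<theta>) \<longrightarrow>
    (\<exists>q\<in>carrier bsm.
       hea_outputs bsm Q (psi D Dr) q \<and>
       (\<forall>S. stores (card Dr) Q S (psi D Dr) \<longrightarrow>
          hea_runs_within (card Dr) Q S (psi D Dr) q
            (C * (max 1 (card D + card Dr) * (max 1 (card Dr))\<^sup>2))
            (C * (max 1 (card D + card Dr) * max 1 (card Dr)))) \<and>
       (\<forall>i. q i = bsm_optimum Q (D, Dr, i)))"
proof -
  define v where "v = card (vars Q)"
  define a where "a = card Q"
  define CT where "CT = scan_bound v a + (v + a) * (131 + 4 * v + scan_bound v a) + 41"
  define CS where "CS = 16 + a * (v + 1) + (v + 3) + (v + a) * (31 + 4 * v) + 8"
  show ?thesis
  \<comment> \<open>One constant has to serve for time and space. It is built from \<open>v\<close>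
    and \<open>a\<close> only and so is fixed before the databases are.\<close>
  proof (intro exI[of _ "CT + CS"] allI impI)
    fix D Dr :: "('r, 'v, 'd) fact set" and \<theta>
    assume inst: "bsm_instance Q (D, Dr, \<theta>)"
    let ?q = "\<lambda>i. bsm_optimum Q (D, Dr, i)" and ?E = "active_domain (D \<union> Dr)"
    let ?m = "max 1 (card D + card Dr)" and ?n = "max 1 (card Dr)"
    note adm = admissible_psi[OF assms(1) inst refl assms(2)]
    note q = attains_psi[OF assms(1) inst refl]
    have "hea_runs_within (card Dr) Q S (psi D Dr) ?q
        ((CT + CS) * (?m * ?n\<^sup>2)) ((CT + CS) * (?m * ?n))"
      if st: "stores (card Dr) Q S (psi D Dr)" for S
    proof (rule hea_runs_within_mono[OF hea_runs_within_bsm[OF adm st q v_def a_def refl]])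
      have M: "storage Q S \<le> ?m" using storage_psi[OF assms(1) inst st] by simp
      show "scan_bound v a + (v + a) * step_ticks (card Dr) (storage Q S) v a + 1 + op_ticks (card Dr)
          \<le> (CT + CS) * (?m * ?n\<^sup>2)"
        by (rule order_trans[OF time_bound[OF M, of "card Dr" ?n v a]]) (simp_all add: CT_def)
      show "16 + a * (v + 1) + storage Q S * (v + 2 + card Dr) +
          (v + a) * step_cells (card Dr) (storage Q S) v + op_cells (card Dr) \<le> (CT + CS) * (?m * ?n)"
        by (rule order_trans[OF space_bound[OF M, of "card Dr" ?n a v]]) (simp_all add: CS_def)
    qed
    then show "\<exists>q\<in>carrier bsm. hea_outputs bsm Q (psi D Dr) q \<and>
       (\<forall>S. stores (card Dr) Q S (psi D Dr) \<longrightarrow>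
          hea_runs_within (card Dr) Q S (psi D Dr) q
            ((CT + CS) * (?m * ?n\<^sup>2)) ((CT + CS) * (?m * ?n))) \<and>
       (\<forall>i. q i = bsm_optimum Q (D, Dr, i))"
      using hea_outputs_bsm(1)[OF adm q] bsm_optimum_in_carrier[OF assms(1) inst refl]
      by (intro bexI[of _ ?q]) simp_all
  qed
qed

end
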